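(* (a) For a cluster algebra with principal coefficients which is not of type $A_1$ (i.e. whose principal part is not a single vertex), its cluster automorphism group is (isomorphic to) a subgroup of the cluster automorphism group of its principal part cluster algebra. (b) For a universal geometric cluster algebra which is not of type $A_1$ (i.e. whose principal part is not a single vertex), its cluster automorphism group is (isomorphic to) a subgroup of the cluster automorphism group of its principal part cluster algebra.
   Context: Ice quivers. An ice quiver is a finite quiver $Q$ (no loops, no 2-cycles) with vertex set $\{1,\dots,n+m\}$ and a subset $\{n+1,\dots,n+m\}$ of frozen vertices ($m=0$ allowed); the vertices $1,\dots,n$ are exchangeable; there are no arrows between frozen vertices. The principal part $Q^{ex}$ is the full subquiver on the exchangeable vertices. Standing assumption: an ice quiver and its principal part are connected. The exchange matrix is $B=(b_{ji})$, of size $(n+m)\times n$, with $b_{ji}=\#\{\text{arrows } j\to i\}-\#\{\text{arrows } i\to j\}$. Mutation and cluster algebras. The mutation $\mu_i(Q)$ at an exchangeable vertex $i$: add an arrow $j\to k$ for each path $j\to i\to k$; reverse all arrows incident to $i$; remove a maximal set of pairwise disjoint 2-cycles; remove arrows between frozen vertices. A seed is $(Q,\mathbf{x})$ with $\mathbf{x}=\{x_1,\dots,x_{n+m}\}$ (the cluster), initially independent indeterminates, $x_i$ attached to vertex $i$. Mutation at exchangeable $i$ (or at $x_i$) replaces $Q$ by $\mu_i(Q)$ and $x_i$ by $x_i'$, where $x_ix_i'=\prod_{1\le j\le n+m,\,b_{ji}>0}x_j^{b_{ji}}+\prod_{1\le j\le n+m,\,b_{ji}<0}x_j^{-b_{ji}}$.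 The seeds of $\mathcal{A}_Q$ are all seeds obtained from the initial one by iterated mutation; $\mathcal{A}_Q$ is the $\mathbb{Z}$-subalgebra of $\mathbb{Q}(x_1,\dots,x_{n+m})$ generated by all elements of all clusters. Each cluster splits as $\mathbf{x}=\mathbf{ex}\sqcup\mathbf{fx}$ (exchangeable and frozen variables). The principal part cluster algebra of $\mathcal{A}_Q$ is $\mathcal{A}_{Q^{ex}}$. A rooted cluster algebra is a triple $(Q,\mathbf{x},\mathcal{A}_Q)$ with initial seed $(Q,\mathbf{x})$. The coefficient group $\mathbb{P}$ of $\mathcal{A}_Q$ is the multiplicative free abelian group generated by the frozen variables, and $\mathcal{A}_Q[\mathbb{P}^{-1}]$ is the localization of $\mathcal{A}_Q$ at $\mathbb{P}$. Cluster automorphisms. A sequence $(y_1,\dots,y_l)$ is $(Q,\mathbf{x})$-admissible if $y_1$ is exchangeable in $\mathbf{x}$ and each $y_i$ is exchangeable in $\mu_{y_{i-1}}\cdots\mu_{y_1}(\mathbf{x})$. For seeds $(Q,\mathbf{x})$ of $\mathcal{A}$ and $(Q',\mathbf{x}')$ of $\mathcal{A}'$, a rooted cluster morphism $f$ is a ring homomorphism $\mathcal{A}\to\mathcal{A}'$ with $f(\mathbf{ex})\subset\mathbf{ex}'\sqcup\mathbb{Z}$, $f(\mathbf{fx})\subset\mathbf{x}'\sqcup\mathbb{Z}$, and such that for every $(Q,\mathbf{x})$-admissible $(y_1,\dots,y_l)$ for which $(f(y_1),\dots,f(y_l))$ is $(Q',\mathbf{x}')$-admissible, and every $y\in\mathbf{x}$,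 $f(\mu_{y_l}\cdots\mu_{y_1,\mathbf{x}}(y))=\mu_{f(y_l)}\cdots\mu_{f(y_1),\mathbf{x}'}(f(y))$. A cluster automorphism of $\mathcal{A}$ is a map $f:\mathcal{A}\to\mathcal{A}$ which is a bijective rooted cluster morphism with respect to some two seeds of $\mathcal{A}$; these form the cluster automorphism group $\mathrm{Aut}(\mathcal{A})$. Principal coefficients. For a skew-symmetric integer $n\times n$ matrix $B$, a cluster algebra with initial exchange matrix $B^{pr}=\binom{B}{I_n}$ is called a cluster algebra with principal coefficients. Universality. For a quiver $Q$ with $n$ vertices and no frozen vertices, $RCA(Q)$ is the set of rooted cluster algebras $(\tilde Q,\tilde{\mathbf{x}},\mathcal{A}_{\tilde Q})$ with $\tilde Q$ an ice quiver with principal part $Q$. Admissible sequences $\varpi$ are here identified with finite (possibly empty) sequences of exchangeable vertices $1,\dots,n$, and $\mu_\varpi(x_i)$ is the variable at vertex $i$ after mutating the initial seed along $\varpi$. For $(Q',\mathbf{x}',\mathcal{A}_{Q'})$, $(Q'',\mathbf{x}'',\mathcal{A}_{Q''})$ in $RCA(Q)$ with coefficient groups $\mathbb{P}',\mathbb{P}''$, a coefficient specialization is a group homomorphism $\varphi:\mathbb{P}'\to\mathbb{P}''$ that extends to a ring homomorphism $\varphi:\mathcal{A}_{Q'}[\mathbb{P}'^{-1}]\to\mathcal{A}_{Q''}[\mathbb{P}''^{-1}]$ such that $\varphi(\mu_\varpi(x_i'))=\mu_\varpi(x_i'')$ for all $1\le i\le n$ and all admissible $\varpi$; the extension is also called a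 coefficient specialization. For $(Q^{univ},\mathbf{x}^{univ},\mathcal{A}_{Q^{univ}})$ in $RCA(Q)$ with coefficient group $\mathbb{P}$, $\mathcal{A}_{Q^{univ}}$ is a universal geometric cluster algebra of $RCA(Q)$ if for every $(Q',\mathbf{x}',\mathcal{A}_{Q'})$ in $RCA(Q)$ with coefficient group $\mathbb{P}'$ there is a unique coefficient specialization from $\mathcal{A}_{Q^{univ}}[\mathbb{P}^{-1}]$ to $\mathcal{A}_{Q'}[\mathbb{P}'^{-1}]$. *)

theory Defs
  imports
    "HOL-Library.Poly_Mapping"
    "HOL-Computational_Algebra.Fraction_Field"
    "HOL-Algebra.Algebra"
begin

section \<open>Ice quivers\<close>

text \<open>
  A finite quiver on \<open>{1..n+m}\<close> is given by its arrow multiplicities: \<open>arr Q j k\<close> is the number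
  of arrows from \<open>j\<close> to \<open>k\<close>.  Vertices \<open>1..n\<close> are exchangeable, \<open>n+1..n+m\<close> are frozen.
\<close>

record quiver =
  nexch :: nat
  nfroz :: nat
  arr :: "nat \<Rightarrow> nat \<Rightarrow> nat"

definition exch_verts :: "quiver \<Rightarrow> nat set" where
  "exch_verts Q = {1..nexch Q}"

definition frozen_verts :: "quiver \<Rightarrow> nat set" where
  "frozen_verts Q = {nexch Q + 1..nexch Q + nfroz Q}"

definition verts :: "quiver \<Rightarrow> nat set" where
  "verts Q = {1..nexch Q + nfroz Q}"

definition connected_on :: "nat set \<Rightarrow> quiver \<Rightarrow> bool" where
  "connected_on V Q \<longleftrightarrow> V \<noteq> {} \<and>
     (\<forall>u\<in>V. \<forall>v\<in>V. (u, v) \<in> {(a, b). a \<in> V \<and> b \<in> V \<and> (arr Q a b > 0 \<or> arr Q b a > 0)}\<^sup>*)"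

text \<open>
  The second clause makes \<open>arr\<close> vanish off the vertex set, so that equality of records is equality
  of quivers.  The last two are the standing connectedness assumption; in particular \<open>n \<ge> 1\<close>.
\<close>

definition ice_quiver :: "quiver \<Rightarrow> bool" where
  "ice_quiver Q \<longleftrightarrow>
     (\<forall>j k. j \<notin> verts Q \<or> k \<notin> verts Q \<longrightarrow> arr Q j k = 0) \<and>
     (\<forall>j. arr Q j j = 0) \<and>
     (\<forall>j k. arr Q j k = 0 \<or> arr Q k j = 0) \<and>
     (\<forall>j\<in>frozen_verts Q. \<forall>k\<in>frozen_verts Q. arr Q j k = 0) \<and>
     connected_on (verts Q) Q \<and>
     connected_on (exch_verts Q) Q"

definition principal_part :: "quiver \<Rightarrow> quiver" where
  "principal_part Q = \<lparr>nexch = nexch Q, nfroz = 0,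
     arr = (\<lambda>j k. if j \<in> exch_verts Q \<and> k \<in> exch_verts Q then arr Q j k else 0)\<rparr>"

definition exch_matrix :: "quiver \<Rightarrow> nat \<Rightarrow> nat \<Rightarrow> int" where
  "exch_matrix Q j i = int (arr Q j i) - int (arr Q i j)"

text \<open>
  The steps of the mutation: adding arrows along paths through \<open>i\<close>, reversing the arrows at \<open>i\<close>,
  cancelling 2-cycles (truncated subtraction on \<^typ>\<open>nat\<close>), deleting frozen-frozen arrows.
\<close>

definition quiver_mut :: "nat \<Rightarrow> quiver \<Rightarrow> quiver" where
  "quiver_mut i Q =
     (let a1 = (\<lambda>j k. arr Q j k + arr Q j i * arr Q i k);
          a2 = (\<lambda>j k. if j = i \<or> k = i then a1 k j else a1 j k);
          a3 = (\<lambda>j k. a2 j k - a2 k j);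
          a4 = (\<lambda>j k. if j \<in> frozen_verts Q \<and> k \<in> frozen_verts Q then 0 else a3 j k)
      in Q\<lparr>arr := a4\<rparr>)"

section \<open>Seeds and cluster algebras\<close>

text \<open>
  The field of rational functions over the rationals in countably many indeterminates
  \<open>X\<^sub>0, X\<^sub>1, \<dots>\<close>.  An ice quiver with \<open>N\<close> vertices uses \<open>X\<^sub>1, \<dots>, X\<^sub>N\<close> as its initial cluster,
  so its cluster algebra lies in the subfield these generate.
\<close>

type_synonym ratfun = "((nat \<Rightarrow>\<^sub>0 nat) \<Rightarrow>\<^sub>0 rat) fract"

definition indet :: "nat \<Rightarrow> ratfun" where
  "indet j = Fraction_Field.Fract (Poly_Mapping.single (Poly_Mapping.single j 1) 1) 1"

definition ratfun_ring :: "ratfun ring" where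
  "ratfun_ring = \<lparr>carrier = UNIV, monoid.mult = (*), one = 1, ring.zero = 0, add = (+)\<rparr>"

text \<open>A seed; the second component gives the cluster element attached to each vertex.\<close>

type_synonym seed = "quiver \<times> (nat \<Rightarrow> ratfun)"

definition initial_seed :: "quiver \<Rightarrow> seed" where
  "initial_seed Q = (Q, indet)"

definition exchanged_var :: "nat \<Rightarrow> seed \<Rightarrow> ratfun" where
  "exchanged_var i = (\<lambda>(Q, x).
     ((\<Prod>j\<in>{j\<in>verts Q. exch_matrix Q j i > 0}. x j ^ nat (exch_matrix Q j i)) +
      (\<Prod>j\<in>{j\<in>verts Q. exch_matrix Q j i < 0}. x j ^ nat (- exch_matrix Q j i))) / x i)"

definition seed_mut :: "nat \<Rightarrow> seed \<Rightarrow> seed" where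
  "seed_mut i s = (quiver_mut i (fst s), (snd s)(i := exchanged_var i s))"

definition mut_along :: "nat list \<Rightarrow> seed \<Rightarrow> seed" where
  "mut_along is s = fold seed_mut is s"

definition seeds :: "quiver \<Rightarrow> seed set" where
  "seeds Q = {mut_along is (initial_seed Q) | is. set is \<subseteq> exch_verts Q}"

definition exch_vars :: "seed \<Rightarrow> ratfun set" where
  "exch_vars s = snd s ` exch_verts (fst s)"

definition frozen_vars :: "seed \<Rightarrow> ratfun set" where
  "frozen_vars s = snd s ` frozen_verts (fst s)"

definition cluster :: "seed \<Rightarrow> ratfun set" where
  "cluster s = exch_vars s \<union> frozen_vars s"

definition cluster_algebra :: "quiver \<Rightarrow> ratfun ring" where
  "cluster_algebra Q =
     ratfun_ring\<lparr>carrier := generate_ring ratfun_ring (\<Union>s\<in>seeds Q. cluster s)\<rparr>"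

section \<open>Cluster automorphisms\<close>

definition vertex_of :: "seed \<Rightarrow> ratfun \<Rightarrow> nat" where
  "vertex_of s y = (THE i. i \<in> exch_verts (fst s) \<and> snd s i = y)"

definition mut_at :: "ratfun \<Rightarrow> seed \<Rightarrow> seed" where
  "mut_at y s = seed_mut (vertex_of s y) s"

fun admissible :: "seed \<Rightarrow> ratfun list \<Rightarrow> bool" where
  "admissible s [] \<longleftrightarrow> True"
| "admissible s (y # ys) \<longleftrightarrow> y \<in> exch_vars s \<and> admissible (mut_at y s) ys"

text \<open>
  \<open>track s [y\<^sub>1, \<dots>, y\<^sub>l] z\<close> is \<open>\<mu>\<^bsub>y\<^sub>l\<^esub> \<cdots> \<mu>\<^bsub>y\<^sub>1,x\<^esub>(z)\<close>: the element that replaces the cluster element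
  \<open>z\<close> of \<open>s\<close> after the successive mutations.  Elements outside the cluster (integers) stay fixed.
\<close>

fun track :: "seed \<Rightarrow> ratfun list \<Rightarrow> ratfun \<Rightarrow> ratfun" where
  "track s [] z = z"
| "track s (y # ys) z =
     track (mut_at y s) ys (if z = y then exchanged_var (vertex_of s y) s else z)"

definition rooted_cluster_morphism ::
    "quiver \<Rightarrow> seed \<Rightarrow> quiver \<Rightarrow> seed \<Rightarrow> (ratfun \<Rightarrow> ratfun) \<Rightarrow> bool" where
  "rooted_cluster_morphism Q s Q' s' f \<longleftrightarrow>
     f \<in> ring_hom (cluster_algebra Q) (cluster_algebra Q') \<and>
     f ` exch_vars s \<subseteq> exch_vars s' \<union> \<int> \<and>
     f ` frozen_vars s \<subseteq> cluster s' \<union> \<int> \<and>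
     (\<forall>ys. admissible s ys \<and> admissible s' (map f ys) \<longrightarrow>
        (\<forall>y\<in>cluster s. f (track s ys y) = track s' (map f ys) (f y)))"

definition cluster_automorphisms :: "quiver \<Rightarrow> (ratfun \<Rightarrow> ratfun) set" where
  "cluster_automorphisms Q =
     {f \<in> Bij (carrier (cluster_algebra Q)).
        \<exists>s\<in>seeds Q. \<exists>s'\<in>seeds Q. rooted_cluster_morphism Q s Q s' f}"

definition cluster_Aut :: "quiver \<Rightarrow> (ratfun \<Rightarrow> ratfun) monoid" where
  "cluster_Aut Q =
     BijGroup (carrier (cluster_algebra Q)) \<lparr>carrier := cluster_automorphisms Q\<rparr>"

section \<open>Principal coefficients\<close>

definition principal_matrix :: "nat \<Rightarrow> (nat \<Rightarrow> nat \<Rightarrow> int) \<Rightarrow> nat \<Rightarrow> nat \<Rightarrow> int" where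
  "principal_matrix n B j i = (if j \<le> n then B j i else if j = n + i then 1 else 0)"

definition has_principal_coefficients :: "quiver \<Rightarrow> bool" where
  "has_principal_coefficients Q \<longleftrightarrow>
     ice_quiver Q \<and> nfroz Q = nexch Q \<and>
     (\<exists>B. (\<forall>j\<in>exch_verts Q. \<forall>i\<in>exch_verts Q. B j i = - B i j) \<and>
          (\<forall>j\<in>verts Q. \<forall>i\<in>exch_verts Q.
             exch_matrix Q j i = principal_matrix (nexch Q) B j i))"

section \<open>Universal geometric cluster algebras\<close>

definition coeff_group :: "quiver \<Rightarrow> ratfun monoid" where
  "coeff_group Q = \<lparr>carrier = {\<Prod>j\<in>frozen_verts Q. indet j powi a j | a. True},
                    monoid.mult = (*), one = 1\<rparr>"

definition localized_algebra :: "quiver \<Rightarrow> ratfun ring" where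
  "localized_algebra Q = ratfun_ring\<lparr>carrier :=
     {a / p | a p. a \<in> carrier (cluster_algebra Q) \<and> p \<in> carrier (coeff_group Q)}\<rparr>"

text \<open>A rooted cluster algebra is determined by its ice quiver, so it is represented by it.\<close>

definition RCA :: "quiver \<Rightarrow> quiver set" where
  "RCA Q = {Q'. ice_quiver Q' \<and> principal_part Q' = Q}"

text \<open>
  A coefficient specialization as a ring homomorphism of the localized algebras; being extensional
  makes two of them equal as soon as they agree on the localized algebra.
\<close>

definition coefficient_specialization :: "quiver \<Rightarrow> quiver \<Rightarrow> (ratfun \<Rightarrow> ratfun) \<Rightarrow> bool" where
  "coefficient_specialization Q' Q'' \<phi> \<longleftrightarrow>
     \<phi> \<in> extensional (carrier (localized_algebra Q')) \<and>
     \<phi> \<in> ring_hom (localized_algebra Q') (localized_algebra Q'') \<and>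
     \<phi> \<in> hom (coeff_group Q') (coeff_group Q'') \<and>
     (\<forall>is. set is \<subseteq> exch_verts Q' \<longrightarrow> (\<forall>i\<in>exch_verts Q'.
        \<phi> (snd (mut_along is (initial_seed Q')) i) = snd (mut_along is (initial_seed Q'')) i))"

definition universal_geometric :: "quiver \<Rightarrow> quiver \<Rightarrow> bool" where
  "universal_geometric Q Quniv \<longleftrightarrow>
     Quniv \<in> RCA Q \<and> (\<forall>Q'\<in>RCA Q. \<exists>!\<phi>. coefficient_specialization Quniv Q' \<phi>)"

end

theory Submission
  imports Defs "HOL-Computational_Algebra.Polynomial_Factorial"
begin

text \<open>
  Specializing the frozen variables to 1 maps the cluster algebra onto the one of its principal part.
  The first exchange relations force a cluster automorphism \<open>f\<close> to be induced by an isomorphism of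
  seeds up to signs, so \<open>f\<close> descends along this specialization. If the descended map is the identity,
  then \<open>f\<close> sends a cluster \<open>x\<close> to a cluster that specializes to the same cluster as \<open>x\<close>. By the Laurent
  phenomenon and an estimate of degrees such a cluster is equal to \<open>x\<close>; hence \<open>f\<close> fixes all cluster
  variables. It also fixes the frozen variables: with principal coefficients each of them is determined by an exchange
  relation, and with universal coefficients \<open>f\<close> and the identity are two coefficient specializations
  of the algebra into itself, which have to agree.
\<close>

section \<open>Rational functions, substitutions and subtraction-free elements\<close>

text \<open>The specialization is only a partial map on the field of rational functions, since
  denominators may vanish; it is defined on the cluster algebra because cluster variables are
  subtraction-free. Suppose a cluster variable specializes to \<open>X\<^sub>j\<close>. The order of
  \<open>g\<close> along a frozen variable is 0, because in each exchange relation one of the two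
  monomials is free of it. The degree of \<open>g\<close> is not accessible in this way. Mutating
  back gives a second factor \<open>h\<close> of the same kind with \<open>g * h = 1\<close>; both
  degrees are nonnegative and add up to 0, so \<open>g\<close> is constant. All this requires
  \<open>g\<close> and \<open>h\<close> to be Laurent polynomials:
  \<open>(1 + X) / (1 + 2 * X)\<close> has order and degree 0 as well. This is why the Laurent
  phenomenon has to be proved in full.\<close>

type_synonym ratpoly = "(nat \<Rightarrow>\<^sub>0 nat) \<Rightarrow>\<^sub>0 rat"

abbreviation keys where "keys \<equiv> Poly_Mapping.keys"
abbreviation lookup where "lookup \<equiv> Poly_Mapping.lookup"
abbreviation single where "single \<equiv> Poly_Mapping.single"

section \<open>Polynomials and their evaluation at a family of rational functions\<close>

lemma sum_singles:
  fixes p :: "'a \<Rightarrow>\<^sub>0 'b::comm_monoid_add"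
  shows "p = (\<Sum>a\<in>keys p. single a (lookup p a))"
proof (rule poly_mapping_eqI)
  fix k
  have "lookup (\<Sum>a\<in>keys p. single a (lookup p a)) k = (\<Sum>a\<in>keys p. if a = k then lookup p k else 0)"
    unfolding lookup_sum by (rule sum.cong) (auto simp: lookup_single when_def)
  also have "\<dots> = lookup p k" by (simp add: in_keys_iff)
  finally show "lookup p k = lookup (\<Sum>a\<in>keys p. single a (lookup p a)) k" by simp
qed

lemma poly_mapping_induct [case_names zero single add]:
  fixes p :: "'a \<Rightarrow>\<^sub>0 'b::comm_monoid_add"
  assumes "P 0" "\<And>a c. P (single a c)" "\<And>p q. P p \<Longrightarrow> P q \<Longrightarrow> P (p + q)"
  shows "P p"
proof -
  have "P (\<Sum>a\<in>A. single a (lookup p a))" if "finite A" for A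
    using that by induction (use assms in auto)
  then show ?thesis using sum_singles[of p] by (metis finite_keys)
qed

lemma single_eq_0_iff [simp]: "single a c = 0 \<longleftrightarrow> c = 0"
  by (metis lookup_single_eq lookup_zero single_zero)

definition const :: "rat \<Rightarrow> ratfun" where "const c = to_fract (single 0 c)"

definition monom_at :: "(nat \<Rightarrow> ratfun) \<Rightarrow> (nat \<Rightarrow>\<^sub>0 nat) \<Rightarrow> ratfun" where
  "monom_at y a = (\<Prod>k\<in>keys a. y k ^ lookup a k)"

definition evalp :: "(nat \<Rightarrow> ratfun) \<Rightarrow> ratpoly \<Rightarrow> ratfun" where
  "evalp y p = (\<Sum>a\<in>keys p. const (lookup p a) * monom_at y a)"

lemma const_simps [simp]: "const 0 = 0" "const 1 = 1" "const (c + d) = const c + const d"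
  "const (c * d) = const c * const d" "const c = 0 \<longleftrightarrow> c = 0"
proof -
  show "const (c + d) = const c + const d" by (simp add: const_def single_add)
  show "const (c * d) = const c * const d"
    unfolding const_def to_fract_mult[symmetric] mult_single by simp
  show "const c = 0 \<longleftrightarrow> c = 0"
    by (simp add: const_def)
qed (simp_all add: const_def)

lemma const_uminus [simp]: "const (- c) = - const c"
  by (simp add: const_def single_uminus)

lemma monom_at_superset: "finite S \<Longrightarrow> keys a \<subseteq> S \<Longrightarrow> monom_at y a = (\<Prod>k\<in>S. y k ^ lookup a k)"
  unfolding monom_at_def by (rule prod.mono_neutral_left) (auto simp: in_keys_iff)

lemma monom_at_simps [simp]: "monom_at y 0 = 1" "monom_at y (single k n) = y k ^ n"
  by (simp_all add: monom_at_def)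

lemma monom_at_add [simp]: "monom_at y (a + b) = monom_at y a * monom_at y b"
  using keys_add[of a b]
  by (subst (1 2 3) monom_at_superset[of "keys a \<union> keys b"])
     (auto simp: lookup_add power_add prod.distrib)

lemma evalp_superset: "finite S \<Longrightarrow> keys p \<subseteq> S \<Longrightarrow> evalp y p = (\<Sum>a\<in>S. const (lookup p a) * monom_at y a)"
  unfolding evalp_def by (rule sum.mono_neutral_left) (auto simp: in_keys_iff)

lemma evalp_zero [simp]: "evalp y 0 = 0" and evalp_single [simp]: "evalp y (single a c) = const c * monom_at y a"
  by (simp_all add: evalp_def)

lemma evalp_one [simp]: "evalp y 1 = 1"
  using evalp_single[of y 0 1] by (simp del: evalp_single)

lemma evalp_add [simp]: "evalp y (p + q) = evalp y p + evalp y q"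
  using keys_add[of p q]
  by (subst (1 2 3) evalp_superset[of "keys p \<union> keys q"])
     (auto simp: lookup_add sum.distrib distrib_right)

lemma evalp_mult [simp]: "evalp y (p * q) = evalp y p * evalp y q"
proof (induction p rule: poly_mapping_induct)
  case (single a c)
  show ?case
    by (induction q rule: poly_mapping_induct) (simp_all add: mult_single distrib_left)
qed (simp_all add: distrib_right)

lemma monom_at_indet: "monom_at indet a = to_fract (single a 1)"
proof (induction a rule: poly_mapping_induct)
  case (single k n)
  have "indet k ^ n = to_fract (single (single k n) 1)"
  proof (induction n)
    case (Suc n)
    have "single (single k (Suc n)) (1::rat) = single (single k 1) 1 * single (single k n) 1"
      by (simp add: mult_single flip: single_add)
    then show ?case using Suc by (simp add: indet_def to_fract_def)
  qed simp
  then show ?case by simp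
next
  case (add p q)
  have "single (p + q) (1::rat) = single p 1 * single q 1"
    by (simp add: mult_single)
  then show ?case using add by simp
qed simp

lemma evalp_indet [simp]: "evalp indet p = to_fract p"
proof (induction p rule: poly_mapping_induct)
  case (single a c)
  have "single a c = single 0 c * single a 1" by (simp add: mult_single)
  then show ?case by (simp add: monom_at_indet const_def del: mult_single flip: to_fract_mult)
qed simp_all

lemma ratfun_quotient:
  fixes A :: ratfun
  obtains p q :: ratpoly where "A = to_fract p / to_fract q" "q \<noteq> 0"
  by (cases A rule: Fract_cases_nonzero) (auto simp: Fract_conv_to_fract intro: that[of 0 1])

text \<open>The substitution \<open>X\<^sub>k \<mapsto> y k\<close> extends to the fractions whose denominator does not vanish under it;
  the value of \<open>place y\<close> outside \<open>place_dom y\<close> is meaningless.\<close>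

definition place_dom :: "(nat \<Rightarrow> ratfun) \<Rightarrow> ratfun set" where
  "place_dom y = {to_fract p / to_fract q | p q. evalp y q \<noteq> 0}"

definition place :: "(nat \<Rightarrow> ratfun) \<Rightarrow> ratfun \<Rightarrow> ratfun" where
  "place y A = (THE z. \<exists>p q. evalp y q \<noteq> 0 \<and> A = to_fract p / to_fract q \<and> z = evalp y p / evalp y q)"

lemma place_eq:
  assumes "evalp y q \<noteq> 0" shows "place y (to_fract p / to_fract q) = evalp y p / evalp y q"
  unfolding place_def
proof (rule the_equality)
  fix z assume "\<exists>p' q'. evalp y q' \<noteq> 0 \<and> to_fract p / to_fract q = to_fract p' / to_fract q' \<and> z = evalp y p' / evalp y q'"
  then obtain p' q' where *: "evalp y q' \<noteq> 0" "to_fract p / to_fract q = to_fract p' / to_fract q'"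
    "z = evalp y p' / evalp y q'" by blast
  from * assms have "q \<noteq> 0" "q' \<noteq> 0" by auto
  with * have "p * q' = p' * q"
    by (simp add: frac_eq_eq flip: to_fract_mult)
  then have "evalp y p * evalp y q' = evalp y p' * evalp y q" by (metis evalp_mult)
  with * assms show "z = evalp y p / evalp y q" by (simp add: frac_eq_eq)
qed (use assms in blast)

lemma pldomE:
  assumes "A \<in> place_dom y" obtains p q where "evalp y q \<noteq> 0" "q \<noteq> 0" "A = to_fract p / to_fract q"
  using assms evalp_zero unfolding place_dom_def by fastforce

lemma pldomI: "evalp y q \<noteq> 0 \<Longrightarrow> to_fract p / to_fract q \<in> place_dom y"
  unfolding place_dom_def by blast

lemma place_poly [simp]: "to_fract p \<in> place_dom y" "place y (to_fract p) = evalp y p"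
  using pldomI[of y 1 p] place_eq[of y 1 p] by simp_all

lemma place_indet [simp]: "indet j \<in> place_dom y" "place y (indet j) = y j"
  using place_poly[where p = "single (single j 1) 1" and y = y]
  by (simp_all add: indet_def to_fract_def)

lemma place_const [simp]: "const c \<in> place_dom y" "place y (const c) = const c"
  by (simp_all add: const_def)

lemma place_0 [simp]: "0 \<in> place_dom y" "place y 0 = 0" and place_1 [simp]: "1 \<in> place_dom y" "place y 1 = 1"
  using place_const[where c = 0 and y = y] place_const[where c = 1 and y = y] by simp_all

lemma place_add:
  assumes "A \<in> place_dom y" "Z \<in> place_dom y"
  shows "A + Z \<in> place_dom y \<and> place y (A + Z) = place y A + place y Z"
proof -
  obtain p q p' q' where *: "evalp y q \<noteq> 0" "q \<noteq> 0" "A = to_fract p / to_fract q"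
    "evalp y q' \<noteq> 0" "q' \<noteq> 0" "Z = to_fract p' / to_fract q'"
    by (meson assms pldomE)
  then have eq: "A + Z = to_fract (p * q' + p' * q) / to_fract (q * q')"
    by (simp add: field_simps)
  have nz: "evalp y (q * q') \<noteq> 0" using * by simp
  show ?thesis unfolding eq place_eq[OF nz]
    using pldomI[OF nz] * unfolding *(3,6) place_eq[OF *(1)] place_eq[OF *(4)]
    by (simp add: field_simps del: to_fract_add to_fract_mult)
qed

lemma place_mult:
  assumes "A \<in> place_dom y" "Z \<in> place_dom y"
  shows "A * Z \<in> place_dom y \<and> place y (A * Z) = place y A * place y Z"
proof -
  obtain p q p' q' where *: "evalp y q \<noteq> 0" "q \<noteq> 0" "A = to_fract p / to_fract q"
    "evalp y q' \<noteq> 0" "q' \<noteq> 0" "Z = to_fract p' / to_fract q'"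
    by (meson assms pldomE)
  then have eq: "A * Z = to_fract (p * p') / to_fract (q * q')"
    by simp
  have nz: "evalp y (q * q') \<noteq> 0" using * by simp
  show ?thesis unfolding eq place_eq[OF nz]
    using pldomI[OF nz] * unfolding *(3,6) place_eq[OF *(1)] place_eq[OF *(4)]
    by (simp add: field_simps del: to_fract_add to_fract_mult)
qed

lemma place_inverse:
  assumes "A \<in> place_dom y" "place y A \<noteq> 0"
  shows "inverse A \<in> place_dom y \<and> place y (inverse A) = inverse (place y A)"
proof -
  obtain p q where *: "evalp y q \<noteq> 0" "q \<noteq> 0" "A = to_fract p / to_fract q"
    by (meson assms pldomE)
  then have "evalp y p \<noteq> 0" using assms(2) by (simp add: place_eq)
  then show ?thesis using * pldomI[of y p q] place_eq[of y p q] by (simp add: place_eq)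
qed

lemmas place_closed = place_add[THEN conjunct1] place_mult[THEN conjunct1] place_inverse[THEN conjunct1]
lemmas place_hom = place_add[THEN conjunct2] place_mult[THEN conjunct2] place_inverse[THEN conjunct2]

lemma place_divide:
  assumes "A \<in> place_dom y" "Z \<in> place_dom y" "place y Z \<noteq> 0"
  shows "A / Z \<in> place_dom y" "place y (A / Z) = place y A / place y Z"
  using assms by (simp_all add: divide_inverse place_closed place_hom)

lemma place_power: "A \<in> place_dom y \<Longrightarrow> A ^ n \<in> place_dom y \<and> place y (A ^ n) = place y A ^ n"
  by (induction n) (simp_all add: place_closed place_hom)

lemma place_prod:
  assumes "\<And>k. k \<in> S \<Longrightarrow> A k \<in> place_dom y"
  shows "(\<Prod>k\<in>S. A k) \<in> place_dom y \<and> place y (\<Prod>k\<in>S. A k) = (\<Prod>k\<in>S. place y (A k))"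
  using assms by (induction S rule: infinite_finite_induct) (simp_all add: place_closed place_hom)

lemma place_evalp:
  assumes "\<And>k. x k \<in> place_dom y"
  shows "evalp x p \<in> place_dom y \<and> place y (evalp x p) = evalp (\<lambda>k. place y (x k)) p"
proof (induction p rule: poly_mapping_induct)
  case (single a c)
  have "monom_at x a \<in> place_dom y \<and> place y (monom_at x a) = monom_at (\<lambda>k. place y (x k)) a"
    unfolding monom_at_def using place_prod[of "keys a" "\<lambda>k. x k ^ lookup a k" y] place_power assms by simp
  then show ?case by (simp add: place_closed place_hom)
qed (simp_all add: place_closed place_hom)


lemma place_indet_id [simp]: "place_dom indet = UNIV" "place indet A = A"
proof -
  obtain p q where "A = to_fract p / to_fract q" "q \<noteq> 0" by (rule ratfun_quotient)
  then show "place indet A = A" by (simp add: place_eq)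
  show "place_dom indet = UNIV"
    by (metis UNIV_I evalp_indet pldomI ratfun_quotient subsetI subset_antisym to_fract_eq_0_iff)
qed

lemma indet_nonzero [simp]: "indet j \<noteq> 0"
  by (simp add: indet_def flip: to_fract_def)

text \<open>Subtraction-free expressions: every cluster variable is one, so that it survives every
  subtraction-free substitution and its valuations can be computed without cancellation.\<close>

inductive_set subfree :: "ratfun set" where
  subfree_const: "c > 0 \<Longrightarrow> const c \<in> subfree"
| subfree_indet: "indet k \<in> subfree"
| subfree_add: "A \<in> subfree \<Longrightarrow> Y \<in> subfree \<Longrightarrow> A + Y \<in> subfree"
| subfree_mult: "A \<in> subfree \<Longrightarrow> Y \<in> subfree \<Longrightarrow> A * Y \<in> subfree"
| subfree_inverse: "A \<in> subfree \<Longrightarrow> inverse A \<in> subfree"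

definition pos_poly :: "ratpoly set" where
  "pos_poly = {p. p \<noteq> 0 \<and> (\<forall>a. lookup p a \<ge> 0)}"

lemma keys_add_pos_poly: "p \<in> pos_poly \<Longrightarrow> q \<in> pos_poly \<Longrightarrow> keys (p + q) = keys p \<union> keys q"
  by (auto simp: pos_poly_def in_keys_iff lookup_add add_nonneg_eq_0_iff)

lemma pos_poly_add: "p \<in> pos_poly \<Longrightarrow> q \<in> pos_poly \<Longrightarrow> p + q \<in> pos_poly"
  using keys_add_pos_poly[of p q] keys_eq_empty by (fastforce simp: pos_poly_def lookup_add)

lemma pos_poly_mult:
  assumes "p \<in> pos_poly" "q \<in> pos_poly" shows "p * q \<in> pos_poly"
proof -
  have "lookup (p * q) a \<ge> 0" for a
    using assms by (simp add: pos_poly_def lookup_mult Sum_any.expand_set sum_nonneg when_def)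
  with assms show ?thesis by (auto simp: pos_poly_def)
qed

lemma pos_poly_single: "c > 0 \<Longrightarrow> single a c \<in> pos_poly"
  by (auto simp: pos_poly_def lookup_single when_def)

text \<open>All five rules keep numerator and denominator free of negative coefficients. Hence no
  terms cancel in a sum and the value is never 0.\<close>

lemma subfree_pos_poly: "A \<in> subfree \<Longrightarrow> \<exists>p\<in>pos_poly. \<exists>q\<in>pos_poly. A = to_fract p / to_fract q"
proof (induction rule: subfree.induct)
  case (subfree_const c)
  then show ?case using pos_poly_single[of c 0] pos_poly_single[of 1 0]
    by (intro bexI[of _ "single 0 c"] bexI[of _ 1]) (auto simp: const_def)
next
  case (subfree_indet k)
  then show ?case using pos_poly_single[of 1 "single k 1"] pos_poly_single[of 1 0]
    by (intro bexI[of _ "single (single k 1) 1"] bexI[of _ 1]) (auto simp: indet_def to_fract_def)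
next
  case (subfree_add A Y)
  then obtain p q p' q' where *: "p \<in> pos_poly" "q \<in> pos_poly" "A = to_fract p / to_fract q"
    "p' \<in> pos_poly" "q' \<in> pos_poly" "Y = to_fract p' / to_fract q'" by blast
  have "q \<noteq> 0" "q' \<noteq> 0" using * by (auto simp: pos_poly_def)
  then have "A + Y = to_fract (p * q' + p' * q) / to_fract (q * q')"
    using * by (simp add: field_simps)
  then show ?case using * pos_poly_add pos_poly_mult by blast
next
  case (subfree_mult A Y)
  then obtain p q p' q' where *: "p \<in> pos_poly" "q \<in> pos_poly" "A = to_fract p / to_fract q"
    "p' \<in> pos_poly" "q' \<in> pos_poly" "Y = to_fract p' / to_fract q'" by blast
  then have "A * Y = to_fract (p * p') / to_fract (q * q')" by simp
  then show ?case using * pos_poly_mult by blast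
next
  case (subfree_inverse A)
  then obtain p q where "p \<in> pos_poly" "q \<in> pos_poly" "A = to_fract p / to_fract q" by blast
  then show ?case by (intro bexI[of _ q] bexI[of _ p]) auto
qed

lemma subfree_nonzero: "A \<in> subfree \<Longrightarrow> A \<noteq> 0"
  using subfree_pos_poly by (fastforce simp: pos_poly_def)

lemma subfree_1 [simp]: "1 \<in> subfree"
  using subfree_const[of 1] by simp

lemma subfree_power: "A \<in> subfree \<Longrightarrow> A ^ n \<in> subfree"
  by (induction n) (auto intro: subfree_mult)

lemma subfree_prod: "(\<And>k. k \<in> S \<Longrightarrow> A k \<in> subfree) \<Longrightarrow> (\<Prod>k\<in>S. A k) \<in> subfree"
  by (induction S rule: infinite_finite_induct) (auto intro: subfree_mult)

lemma subfree_divide: "A \<in> subfree \<Longrightarrow> Y \<in> subfree \<Longrightarrow> A / Y \<in> subfree"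
  by (simp add: divide_inverse subfree_mult subfree_inverse)

lemma place_subfree:
  assumes "A \<in> subfree" "\<And>k. y k \<in> subfree"
  shows "A \<in> place_dom y \<and> place y A \<in> subfree"
  using assms(1)
proof induction
  case (subfree_inverse A)
  then show ?case using subfree_nonzero[of "place y A"] by (simp add: place_closed place_hom subfree.subfree_inverse)
qed (auto simp: place_closed place_hom assms(2) intro: subfree.intros)

section \<open>Mutation of matrix seeds\<close>

lemma place_place_subfree:
  assumes "A \<in> subfree" "\<And>k. y k \<in> subfree" "\<And>k. z k \<in> subfree"
  shows "place z (place y A) = place (\<lambda>k. place z (y k)) A"
  using assms(1)
proof induction
  case (subfree_add A B)
  have "place (\<lambda>k. place z (y k)) A \<in> subfree" "place (\<lambda>k. place z (y k)) B \<in> subfree"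
    by (intro place_subfree[THEN conjunct2] subfree_add place_subfree[OF assms(2,3), THEN conjunct2])+
  then show ?case
    using subfree_add assms place_subfree[OF assms(2,3)] by (simp add: place_subfree place_hom)
next
  case (subfree_mult A B)
  then show ?case
    using assms place_subfree[OF assms(2,3)] by (simp add: place_subfree place_hom)
next
  case (subfree_inverse A)
  then show ?case
    using assms place_subfree[OF assms(2,3)] subfree_nonzero place_subfree by (simp add: place_hom)
qed (simp_all)

text \<open>The substitution by \<open>x\<close> has an inverse substitution. Both are required to
  be subtraction-free, so that the composites are defined and can be computed on generators;
  \<open>place x\<close> is then an automorphism of the whole field.\<close>

definition basis :: "(nat \<Rightarrow> ratfun) \<Rightarrow> bool" where
  "basis x \<longleftrightarrow> (\<forall>k. x k \<in> subfree) \<and>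
     (\<exists>y. (\<forall>k. y k \<in> subfree) \<and> (\<forall>k. place y (x k) = indet k) \<and> (\<forall>k. place x (y k) = indet k))"

text \<open>Substituting \<open>y\<close> recovers a polynomial from its value at \<open>x\<close>,
  so no nonzero denominator is killed. A one-sided inverse is enough for this.\<close>

lemma place_left_inverse:
  assumes "\<And>k. x k \<in> subfree" "\<And>k. y k \<in> subfree" "\<And>k. place y (x k) = indet k"
  shows "place_dom x = UNIV" "place y (place x A) = A"
proof -
  have evalp: "evalp x p \<in> place_dom y \<and> place y (evalp x p) = to_fract p" for p
    using place_evalp[of x y p] place_subfree assms by simp
  then have nz: "evalp x p \<noteq> 0" if "p \<noteq> 0" for p
    using that by (metis place_0(2) to_fract_eq_0_iff)
  then show "place_dom x = UNIV"
    by (metis UNIV_eq_I pldomI ratfun_quotient)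
  obtain p q where "A = to_fract p / to_fract q" "q \<noteq> 0" by (rule ratfun_quotient)
  then show "place y (place x A) = A"
    using nz[of q] evalp by (simp add: place_eq place_divide)
qed

lemma
  assumes "basis x"
  shows basis_dom: "place_dom x = UNIV" and basis_bij: "bij (place x)" and basis_subfree: "x k \<in> subfree"
proof -
  obtain y where *: "\<And>k. x k \<in> subfree" "\<And>k. y k \<in> subfree" "\<And>k. place y (x k) = indet k" "\<And>k. place x (y k) = indet k"
    using assms by (auto simp: basis_def)
  show "place_dom x = UNIV" by (rule place_left_inverse[OF *(1-3)])
  show "bij (place x)"
    using place_left_inverse(2)[OF *(1-3)] place_left_inverse(2)[OF *(2,1,4)]
    by (metis bijI')
  show "x k \<in> subfree" by fact
qed

lemma basis_hom:
  assumes "basis x"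
  shows "place x (A + B) = place x A + place x B" "place x (A * B) = place x A * place x B"
    "place x (inverse A) = inverse (place x A)" "place x A = 0 \<longleftrightarrow> A = 0"
    "place x (A / B) = place x A / place x B" "place x (- A) = - place x A"
proof -
  show 0: "place x A = 0 \<longleftrightarrow> A = 0" for A
    using basis_bij[OF assms] by (metis bij_pointE place_0(2))
  show "place x (A + B) = place x A + place x B" and m: "place x (A * B) = place x A * place x B" for A B
    by (simp_all add: basis_dom[OF assms] place_hom)
  show i: "place x (inverse A) = inverse (place x A)" for A
    by (cases "A = 0") (simp_all add: basis_dom[OF assms] place_hom 0)
  show "place x (A / B) = place x A / place x B"
    by (simp add: divide_inverse m i)
  have "place x (- A) + place x A = 0"
    by (simp flip: \<open>\<And>A B. place x (A + B) = place x A + place x B\<close>)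
  then show "place x (- A) = - place x A" by (simp add: eq_neg_iff_add_eq_0)
qed

lemma basis_perm:
  assumes "basis x" "bij \<pi>"
  shows "basis (\<lambda>k. x (\<pi> k))"
proof -
  obtain y where *: "\<And>k. x k \<in> subfree" "\<And>k. y k \<in> subfree" "\<And>k. place y (x k) = indet k" "\<And>k. place x (y k) = indet k"
    using assms by (auto simp: basis_def)
  define z where "z k = place (\<lambda>k. indet (inv_into UNIV \<pi> k)) (y k)" for k
  have z: "z k \<in> subfree" for k unfolding z_def by (rule place_subfree[THEN conjunct2]) (auto intro: * subfree.intros)
  have "place z (x (\<pi> k)) = indet k" for k
  proof -
    have "place z (x (\<pi> k)) = place (\<lambda>k. indet (inv_into UNIV \<pi> k)) (place y (x (\<pi> k)))"
      unfolding z_def by (rule place_place_subfree[symmetric]) (auto intro: * subfree.intros)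
    also have "\<dots> = indet k" using assms(2) by (simp add: *(3) bij_is_inj)
    finally show ?thesis .
  qed
  moreover have "place (\<lambda>k. x (\<pi> k)) (z k) = indet k" for k
  proof -
    have "place (\<lambda>k. x (\<pi> k)) (z k) = place (\<lambda>k. place (\<lambda>k. x (\<pi> k)) (indet (inv_into UNIV \<pi> k))) (y k)"
      unfolding z_def by (rule place_place_subfree) (auto intro: * subfree.intros)
    also have "(\<lambda>k. place (\<lambda>k. x (\<pi> k)) (indet (inv_into UNIV \<pi> k))) = x"
      using assms(2) by (simp add: bij_is_surj surj_f_inv_f)
    finally show ?thesis by (simp add: *(4))
  qed
  ultimately show ?thesis using * z unfolding basis_def by blast
qed

section \<open>Seeds given by an integer matrix and a family of rational functions\<close>

definition exchange_var :: "nat set \<Rightarrow> (nat \<Rightarrow> nat \<Rightarrow> int) \<Rightarrow> (nat \<Rightarrow> ratfun) \<Rightarrow> nat \<Rightarrow> ratfun" where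
  "exchange_var V b x i = ((\<Prod>j\<in>V. x j ^ nat (b j i)) + (\<Prod>j\<in>V. x j ^ nat (- b j i))) / x i"

text \<open>Fomin-Zelevinsky matrix mutation. It is computed for all pairs of natural numbers;
  mutations at \<open>E\<close> only read entries with row in \<open>V\<close> and column in
  \<open>E\<close>.\<close>

definition matrix_mut :: "nat \<Rightarrow> (nat \<Rightarrow> nat \<Rightarrow> int) \<Rightarrow> nat \<Rightarrow> nat \<Rightarrow> int" where
  "matrix_mut i b j k = (if j = i \<or> k = i then - b j k
     else b j k + (max 0 (b j i) * max 0 (b i k) - max 0 (- b j i) * max 0 (- b i k)))"

type_synonym mseed = "(nat \<Rightarrow> nat \<Rightarrow> int) \<times> (nat \<Rightarrow> ratfun)"

definition mseed_mut :: "nat set \<Rightarrow> nat \<Rightarrow> mseed \<Rightarrow> mseed" where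
  "mseed_mut V i s = (matrix_mut i (fst s), (snd s)(i := exchange_var V (fst s) (snd s) i))"

definition mseed_path :: "nat set \<Rightarrow> nat list \<Rightarrow> mseed \<Rightarrow> mseed" where
  "mseed_path V is s = fold (mseed_mut V) is s"

text \<open>The initial cluster is always \<open>indet\<close>, whatever the matrix; clusters
  relative to another initial seed enter by substitution, see
  \<open>cluster_var_append\<close>.\<close>

definition cluster_var :: "nat set \<Rightarrow> (nat \<Rightarrow> nat \<Rightarrow> int) \<Rightarrow> nat list \<Rightarrow> nat \<Rightarrow> ratfun" where
  "cluster_var V b is = snd (mseed_path V is (b, indet))"

definition matrix_path :: "nat list \<Rightarrow> (nat \<Rightarrow> nat \<Rightarrow> int) \<Rightarrow> nat \<Rightarrow> nat \<Rightarrow> int" where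
  "matrix_path is b = fold matrix_mut is b"

definition skew :: "nat set \<Rightarrow> (nat \<Rightarrow> nat \<Rightarrow> int) \<Rightarrow> bool" where
  "skew E b \<longleftrightarrow> (\<forall>i\<in>E. \<forall>j\<in>E. b i j = - b j i)"

lemma mseed_path_simps [simp]: "mseed_path V [] s = s" "mseed_path V (i # is) s = mseed_path V is (mseed_mut V i s)"
  "mseed_path V (is @ js) s = mseed_path V js (mseed_path V is s)"
  by (simp_all add: mseed_path_def)

lemma matrix_path_simps [simp]: "matrix_path [] b = b" "matrix_path (i # is) b = matrix_path is (matrix_mut i b)"
  "matrix_path (is @ js) b = matrix_path js (matrix_path is b)"
  by (simp_all add: matrix_path_def)

lemma mseed_mut_simps [simp]: "fst (mseed_mut V i s) = matrix_mut i (fst s)"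
  "snd (mseed_mut V i s) = (snd s)(i := exchange_var V (fst s) (snd s) i)"
  by (simp_all add: mseed_mut_def)

lemma fst_mseed_path [simp]: "fst (mseed_path V is s) = matrix_path is (fst s)"
  by (induction "is" arbitrary: s) simp_all

lemma mseed_path_cluster_var: "mseed_path V is (b, indet) = (matrix_path is b, cluster_var V b is)"
  by (simp add: cluster_var_def prod_eq_iff)

lemma mseed_path_outside: "k \<notin> set is \<Longrightarrow> snd (mseed_path V is s) k = snd s k"
  by (induction "is" arbitrary: s) simp_all

lemma cluster_var_outside: "k \<notin> set is \<Longrightarrow> cluster_var V b is k = indet k"
  by (simp add: cluster_var_def mseed_path_outside)

lemma cluster_var_Nil [simp]: "cluster_var V b [] = indet"
  by (simp add: cluster_var_def)

lemma cluster_var_snoc: "cluster_var V b (is @ [i]) = (cluster_var V b is)(i := exchange_var V (matrix_path is b) (cluster_var V b is) i)"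
  by (simp add: cluster_var_def)

lemma exchange_var_subfree: "(\<And>k. x k \<in> subfree) \<Longrightarrow> exchange_var V b x i \<in> subfree"
  unfolding exchange_var_def by (intro subfree_divide subfree_add subfree_prod subfree_power) auto

lemma mseed_path_subfree: "(\<And>k. snd s k \<in> subfree) \<Longrightarrow> snd (mseed_path V is s) k \<in> subfree"
  by (induction "is" arbitrary: s) (simp_all add: exchange_var_subfree)

lemma cluster_var_subfree [simp]: "cluster_var V b is k \<in> subfree"
  unfolding cluster_var_def by (rule mseed_path_subfree) (simp add: subfree_indet)

lemma place_exchange_var:
  assumes "\<And>k. x k \<in> subfree" "\<And>k. y k \<in> subfree"
  shows "place y (exchange_var V b x i) = exchange_var V b (\<lambda>k. place y (x k)) i"
proof -
  have prod: "(\<Prod>j\<in>V. x j ^ n j) \<in> place_dom y \<and>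
      place y (\<Prod>j\<in>V. x j ^ n j) = (\<Prod>j\<in>V. place y (x j) ^ n j)" for n
    using place_prod[of V "\<lambda>j. x j ^ n j" y] place_power place_subfree[OF assms(1,2)] by simp
  show ?thesis
    unfolding exchange_var_def
    using prod place_subfree[OF assms(1,2)] subfree_nonzero by (simp add: place_divide place_closed place_hom)
qed

lemma place_mseed_path:
  assumes "\<And>k. x k \<in> subfree" "\<And>k. y k \<in> subfree"
  shows "place y (snd (mseed_path V is (b, x)) k) = snd (mseed_path V is (b, \<lambda>k. place y (x k))) k"
  using assms(1)
proof (induction "is" arbitrary: b x)
  case (Cons i "is")
  let ?x = "x(i := exchange_var V b x i)"
  have eq: "(\<lambda>k. place y (?x k)) =
      (\<lambda>k. place y (x k))(i := exchange_var V b (\<lambda>k. place y (x k)) i)"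
    using place_exchange_var[OF Cons.prems assms(2)] by auto
  have subfree: "?x m \<in> subfree" for m using Cons.prems exchange_var_subfree[of x V b i] by simp
  show ?case
    using Cons.IH[of ?x "matrix_mut i b", OF subfree] unfolding eq by (simp add: mseed_mut_def del: fun_upd_apply)
qed simp

lemma place_cluster_var: "(\<And>k. y k \<in> subfree) \<Longrightarrow> place y (cluster_var V b is k) = snd (mseed_path V is (b, y)) k"
  unfolding cluster_var_def by (subst place_mseed_path) (simp_all add: subfree_indet)

text \<open>Change of the initial seed: exchange relations are subtraction-free, so mutation
  commutes with substituting a cluster for the indeterminates.\<close>

lemma cluster_var_append: "cluster_var V b (is @ js) k = place (cluster_var V b is) (cluster_var V (matrix_path is b) js k)"
proof -
  have "place (cluster_var V b is) (cluster_var V (matrix_path is b) js k) = snd (mseed_path V js (matrix_path is b, cluster_var V b is)) k"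
    by (rule place_cluster_var) simp
  also have "\<dots> = snd (mseed_path V js (mseed_path V is (b, indet))) k" by (simp only: mseed_path_cluster_var)
  also have "\<dots> = cluster_var V b (is @ js) k" by (simp only: cluster_var_def mseed_path_simps)
  finally show ?thesis by simp
qed

lemma skewD: "skew E b \<Longrightarrow> i \<in> E \<Longrightarrow> j \<in> E \<Longrightarrow> b i j = - b j i"
  unfolding skew_def by blast

lemma skew_diag: "skew E b \<Longrightarrow> i \<in> E \<Longrightarrow> b i i = 0"
  using skewD[of E b i i] by linarith

lemma skew_matrix_mut:
  assumes "skew E b" "i \<in> E" shows "skew E (matrix_mut i b)"
  unfolding skew_def
proof (intro ballI)
  fix j k assume "j \<in> E" "k \<in> E"
  then have *: "b k j = - b j k" "b i k = - b k i" "b i j = - b j i"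
    using assms skewD by blast+
  show "matrix_mut i b j k = - matrix_mut i b k j"
  proof (cases "j = i \<or> k = i")
    case False
    have *: "b j i = - b i j" "b k j = - b j k" "b k i = - b i k" using * by simp_all
    from False show ?thesis unfolding matrix_mut_def * by (simp add: algebra_simps)
  qed (auto simp: matrix_mut_def *(1))
qed

lemma skew_matrix_path: "skew E b \<Longrightarrow> set is \<subseteq> E \<Longrightarrow> skew E (matrix_path is b)"
  by (induction "is" arbitrary: b) (simp_all add: skew_matrix_mut)

lemma matrix_mut_matrix_mut [simp]: "matrix_mut i (matrix_mut i b) = b"
proof (intro ext)
  fix j k
  show "matrix_mut i (matrix_mut i b) j k = b j k"
    by (cases "j = i \<or> k = i") (simp_all add: matrix_mut_def)
qed

text \<open>Mutation negates column \<open>i\<close>, so the two monomials trade places and their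
  sum is unchanged; \<open>b i i = 0\<close> keeps the replaced variable out of them.\<close>

lemma exchange_var_involution:
  assumes "b i i = 0" "x i \<noteq> 0" "exchange_var V b x i \<noteq> 0"
  shows "exchange_var V (matrix_mut i b) (x(i := exchange_var V b x i)) i = x i"
proof -
  let ?x = "x(i := exchange_var V b x i)" and ?M = "\<Prod>j\<in>V. x j ^ nat (b j i)" and ?N = "\<Prod>j\<in>V. x j ^ nat (- b j i)"
  have "(\<Prod>j\<in>V. ?x j ^ nat (matrix_mut i b j i)) = ?N"
    by (rule prod.cong) (use assms(1) in \<open>auto simp: matrix_mut_def\<close>)
  moreover have "(\<Prod>j\<in>V. ?x j ^ nat (- matrix_mut i b j i)) = ?M"
    by (rule prod.cong) (use assms(1) in \<open>auto simp: matrix_mut_def\<close>)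
  ultimately have "exchange_var V (matrix_mut i b) ?x i = (?N + ?M) / exchange_var V b x i"
    by (simp add: exchange_var_def)
  also have "\<dots> = x i"
  proof -
    have *: "exchange_var V b x i = (?N + ?M) / x i" unfolding exchange_var_def by (simp add: add.commute)
    with assms(3) have "?N + ?M \<noteq> 0" by auto
    with assms(2) show ?thesis unfolding * by simp
  qed
  finally show ?thesis .
qed

lemma mseed_mut_involution:
  assumes "skew E b" "i \<in> E" "\<And>k. x k \<in> subfree"
  shows "mseed_mut V i (mseed_mut V i (b, x)) = (b, x)"
proof -
  have "exchange_var V (matrix_mut i b) (x(i := exchange_var V b x i)) i = x i"
    by (rule exchange_var_involution)
       (use skew_diag[OF assms(1,2)] exchange_var_subfree[of x V b i] subfree_nonzero assms(3) in auto)
  then show ?thesis by (simp add: mseed_mut_def del: fun_upd_apply)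
qed

lemma mseed_path_rev:
  assumes "skew E b" "set is \<subseteq> E" "\<And>k. x k \<in> subfree"
  shows "mseed_path V (rev is) (mseed_path V is (b, x)) = (b, x)"
  using assms
proof (induction "is" arbitrary: b x)
  case (Cons i "is")
  have "mseed_path V (rev is) (mseed_path V is (mseed_mut V i (b, x))) = mseed_mut V i (b, x)"
    unfolding mseed_mut_def using Cons.prems
    by (simp, intro Cons.IH) (auto intro: skew_matrix_mut exchange_var_subfree)
  with Cons.prems show ?case by (simp add: mseed_mut_involution[of E])
qed simp

lemma matrix_path_rev: "matrix_path (rev is) (matrix_path is b) = b"
  by (induction "is" arbitrary: b) simp_all

text \<open>Walking back along the path expresses the old variables in the new ones. This is the
  inverse substitution that \<open>basis\<close> asks for.\<close>

lemma cluster_var_rev: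
  assumes "skew E b" "set is \<subseteq> E"
  shows "place (cluster_var V b is) (cluster_var V (matrix_path is b) (rev is) k) = indet k"
    "place (cluster_var V (matrix_path is b) (rev is)) (cluster_var V b is k) = indet k"
proof -
  have *: "place (cluster_var V b is) (cluster_var V (matrix_path is b) (rev is) k) = indet k"
    if "skew E b" "set is \<subseteq> E" for b "is"
  proof -
    have "place (cluster_var V b is) (cluster_var V (matrix_path is b) (rev is) k) = cluster_var V b (is @ rev is) k"
      by (rule cluster_var_append[symmetric])
    also have "\<dots> = snd (mseed_path V (rev is) (mseed_path V is (b, indet))) k"
      by (simp only: cluster_var_def mseed_path_simps)
    also have "mseed_path V (rev is) (mseed_path V is (b, indet)) = (b, indet)"
      by (rule mseed_path_rev[OF that]) (rule subfree_indet)
    finally show ?thesis by simp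
  qed
  show "place (cluster_var V b is) (cluster_var V (matrix_path is b) (rev is) k) = indet k" by (rule *[OF assms])
  show "place (cluster_var V (matrix_path is b) (rev is)) (cluster_var V b is k) = indet k"
    using *[OF skew_matrix_path[OF assms], of "rev is"] assms(2) by (simp add: matrix_path_rev)
qed

lemma basis_cluster_var:
  assumes "skew E b" "set is \<subseteq> E"
  shows "basis (cluster_var V b is)"
  unfolding basis_def
  by (intro conjI exI[of _ "cluster_var V (matrix_path is b) (rev is)"] allI cluster_var_subfree cluster_var_rev[OF assms])

section \<open>Degree valuations\<close>

definition weight :: "int \<Rightarrow> nat \<Rightarrow> (nat \<Rightarrow>\<^sub>0 nat) \<Rightarrow> int" where
  "weight s k a = s * int (lookup a k)"

definition min_weight :: "int \<Rightarrow> nat \<Rightarrow> ratpoly \<Rightarrow> int" where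
  "min_weight s k p = Min (weight s k ` keys p)"

text \<open>For \<open>s = 1\<close> this is the order of vanishing along \<open>X\<^sub>k = 0\<close>, for \<open>s = -1\<close> minus the degree in \<open>X\<^sub>k\<close>.\<close>

definition valuation :: "int \<Rightarrow> nat \<Rightarrow> ratfun \<Rightarrow> int" where
  "valuation s k A = (THE n. \<exists>p q. p \<noteq> 0 \<and> q \<noteq> 0 \<and> A = to_fract p / to_fract q \<and> n = min_weight s k p - min_weight s k q)"

lemma weight_add [simp]: "weight s k (a + b) = weight s k a + weight s k b"
  by (simp add: weight_def lookup_add algebra_simps)

lemma min_weight_le: "a \<in> keys p \<Longrightarrow> min_weight s k p \<le> weight s k a"
  by (simp add: min_weight_def)

lemma min_weight_attained: "p \<noteq> 0 \<Longrightarrow> \<exists>a\<in>keys p. weight s k a = min_weight s k p"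
  unfolding min_weight_def by (metis (no_types, lifting) Min_in finite_imageI finite_keys image_iff image_is_empty keys_eq_empty)

definition restrict_poly :: "(nat \<Rightarrow>\<^sub>0 nat) set \<Rightarrow> ratpoly \<Rightarrow> ratpoly" where
  "restrict_poly S p = (\<Sum>a\<in>keys p \<inter> S. single a (lookup p a))"

lemma lookup_restrict_poly: "lookup (restrict_poly S p) a = (if a \<in> S then lookup p a else 0)"
proof -
  have "lookup (restrict_poly S p) a = (\<Sum>c\<in>keys p \<inter> S. if c = a then lookup p a else 0)"
    unfolding restrict_poly_def lookup_sum by (rule sum.cong) (auto simp: lookup_single when_def)
  then show ?thesis by (auto simp: in_keys_iff)
qed

lemma keys_restrict_poly: "keys (restrict_poly S p) = keys p \<inter> S"
  by (auto simp: in_keys_iff lookup_restrict_poly split: if_splits)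

lemma restrict_poly_split: "p = restrict_poly S p + restrict_poly (- S) p"
  by (rule poly_mapping_eqI) (simp add: lookup_add lookup_restrict_poly)

text \<open>The parts of least weight have a nonzero product because polynomials form a domain, and
  all other products of terms have larger weight, so nothing can cancel that product.\<close>

lemma min_weight_mult:
  assumes "p \<noteq> 0" "q \<noteq> 0"
  shows "min_weight s k (p * q) = min_weight s k p + min_weight s k q"
proof -
  let ?h = "weight s k"
  define S where "S = {a. ?h a = min_weight s k p}"
  define T where "T = {a. ?h a = min_weight s k q}"
  let ?p = "restrict_poly S p" and ?q = "restrict_poly T q"
  have "?p \<noteq> 0" "?q \<noteq> 0"
    using min_weight_attained[OF assms(1), of s k] min_weight_attained[OF assms(2), of s k]
    by (auto simp: S_def T_def keys_restrict_poly simp flip: keys_eq_empty)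
  then have "?p * ?q \<noteq> 0" by simp
  then obtain e where e: "e \<in> keys (?p * ?q)" using keys_eq_empty by fastforce
  have sub: "\<And>p q::ratpoly. keys (p * q) \<subseteq> {a + b | a b. a \<in> keys p \<and> b \<in> keys q}"
    by (rule keys_mult)
  have he: "?h e = min_weight s k p + min_weight s k q"
  proof -
    obtain b c where "e = b + c" "b \<in> S" "c \<in> T"
      using subsetD[OF sub e] by (auto simp: keys_restrict_poly)
    then show ?thesis by (simp add: S_def T_def)
  qed
  \<comment> \<open>All products of terms in which at least one factor is not of least
    weight.\<close>
  let ?r = "?p * restrict_poly (- T) q + restrict_poly (- S) p * q"
  have "p * q = ?p * q + restrict_poly (- S) p * q"
    by (subst (1) restrict_poly_split[of p S]) (rule distrib_right)
  also have "?p * q = ?p * ?q + ?p * restrict_poly (- T) q"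
    by (subst (1) restrict_poly_split[of q T]) (rule distrib_left)
  finally have eq: "p * q = ?p * ?q + ?r" by (simp add: add.assoc)
  have "?h a > min_weight s k p + min_weight s k q" if a: "a \<in> keys (?p * restrict_poly (- T) q)" for a
  proof -
    obtain b c where "a = b + c" "b \<in> keys p" "c \<notin> T" "c \<in> keys q"
      using subsetD[OF sub a] by (auto simp: keys_restrict_poly)
    then show ?thesis using min_weight_le[of b p s k] min_weight_le[of c q s k] by (simp add: T_def)
  qed
  moreover have "?h a > min_weight s k p + min_weight s k q" if a: "a \<in> keys (restrict_poly (- S) p * q)" for a
  proof -
    obtain b c where "a = b + c" "b \<in> keys p" "b \<notin> S" "c \<in> keys q"
      using subsetD[OF sub a] by (auto simp: keys_restrict_poly)
    then show ?thesis using min_weight_le[of b p s k] min_weight_le[of c q s k] by (simp add: S_def)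
  qed
  ultimately have "?h a > min_weight s k p + min_weight s k q" if "a \<in> keys ?r" for a
    using that keys_add[of "?p * restrict_poly (- T) q" "restrict_poly (- S) p * q"] by blast
  then have "e \<notin> keys ?r" using he by force
  then have "e \<in> keys (p * q)" using e unfolding eq by (simp add: in_keys_iff lookup_add)
  moreover have "min_weight s k p + min_weight s k q \<le> ?h a" if a: "a \<in> keys (p * q)" for a
  proof -
    obtain b c where "a = b + c" "b \<in> keys p" "c \<in> keys q"
      using subsetD[OF sub a] by auto
    then show ?thesis using min_weight_le[of b p s k] min_weight_le[of c q s k] by simp
  qed
  ultimately show ?thesis unfolding min_weight_def[of s k "p * q"] he[symmetric]
    by (intro Min_eqI) auto
qed

lemma valuation_eq:
  assumes "p \<noteq> 0" "q \<noteq> 0"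
  shows "valuation s k (to_fract p / to_fract q) = min_weight s k p - min_weight s k q"
  unfolding valuation_def
proof (rule the_equality)
  fix n assume "\<exists>p' q'. p' \<noteq> 0 \<and> q' \<noteq> 0 \<and> to_fract p / to_fract q = to_fract p' / to_fract q' \<and> n = min_weight s k p' - min_weight s k q'"
  then obtain p' q' where *: "p' \<noteq> 0" "q' \<noteq> 0" "to_fract p / to_fract q = to_fract p' / to_fract q'"
    "n = min_weight s k p' - min_weight s k q'" by blast
  with assms have "p * q' = p' * q"
    by (simp add: frac_eq_eq flip: to_fract_mult)
  then have "min_weight s k p + min_weight s k q' = min_weight s k p' + min_weight s k q"
    using * assms by (simp flip: min_weight_mult)
  with * show "n = min_weight s k p - min_weight s k q" by simp
qed (use assms in blast)

lemma nonzero_quotient: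
  fixes A :: ratfun
  assumes "A \<noteq> 0" obtains p q where "A = to_fract p / to_fract q" "p \<noteq> 0" "q \<noteq> 0"
proof -
  obtain p q where "A = to_fract p / to_fract q" "q \<noteq> 0" by (rule ratfun_quotient)
  moreover from this assms have "p \<noteq> 0" by auto
  ultimately show ?thesis using that by blast
qed

lemma valuation_mult:
  assumes "A \<noteq> 0" "B \<noteq> 0" shows "valuation s k (A * B) = valuation s k A + valuation s k B"
proof -
  obtain p q where 1: "A = to_fract p / to_fract q" "p \<noteq> 0" "q \<noteq> 0" by (rule nonzero_quotient[OF assms(1)])
  obtain p' q' where 2: "B = to_fract p' / to_fract q'" "p' \<noteq> 0" "q' \<noteq> 0" by (rule nonzero_quotient[OF assms(2)])
  have "A * B = to_fract (p * p') / to_fract (q * q')" by (simp add: 1 2)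
  then show ?thesis
    using 1(2,3) 2(2,3) unfolding 1(1) 2(1) by (simp add: valuation_eq min_weight_mult del: to_fract_mult)
qed

lemma valuation_const: "c \<noteq> 0 \<Longrightarrow> valuation s k (const c) = 0"
  using valuation_eq[of "single 0 c" 1 s k] by (simp add: const_def min_weight_def weight_def)

lemma valuation_1 [simp]: "valuation s k 1 = 0"
  using valuation_const[of 1] by simp

lemma valuation_inverse: "A \<noteq> 0 \<Longrightarrow> valuation s k (inverse A) = - valuation s k A"
  using valuation_mult[of A "inverse A" s k] by simp

lemma valuation_divide: "A \<noteq> 0 \<Longrightarrow> B \<noteq> 0 \<Longrightarrow> valuation s k (A / B) = valuation s k A - valuation s k B"
  by (simp add: divide_inverse valuation_mult valuation_inverse)

lemma valuation_uminus: "A \<noteq> 0 \<Longrightarrow> valuation s k (- A) = valuation s k A"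
  using valuation_mult[of "const (-1)" A s k] valuation_const[of "-1" s k] by simp

lemma valuation_power: "A \<noteq> 0 \<Longrightarrow> valuation s k (A ^ n) = int n * valuation s k A"
  by (induction n) (simp_all add: valuation_mult algebra_simps)

lemma valuation_prod: "(\<And>i. i \<in> S \<Longrightarrow> A i \<noteq> 0) \<Longrightarrow> valuation s k (\<Prod>i\<in>S. A i) = (\<Sum>i\<in>S. valuation s k (A i))"
  by (induction S rule: infinite_finite_induct) (simp_all add: valuation_mult)

lemma valuation_indet: "valuation s k (indet j) = (if j = k then s else 0)"
  using valuation_eq[of "single (single j 1) 1" 1 s k]
  by (simp add: indet_def min_weight_def weight_def lookup_single when_def flip: to_fract_def)

text \<open>For general summands this is only an inequality. Nonnegative coefficients make the
  support of the sum the union of the supports.\<close>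

lemma valuation_subfree_add:
  assumes "A \<in> subfree" "B \<in> subfree" shows "valuation s k (A + B) = min (valuation s k A) (valuation s k B)"
proof -
  obtain p q where 1: "A = to_fract p / to_fract q" "p \<in> pos_poly" "q \<in> pos_poly" using subfree_pos_poly[OF assms(1)] by blast
  obtain p' q' where 2: "B = to_fract p' / to_fract q'" "p' \<in> pos_poly" "q' \<in> pos_poly" using subfree_pos_poly[OF assms(2)] by blast
  have nz: "p \<noteq> 0" "q \<noteq> 0" "p' \<noteq> 0" "q' \<noteq> 0" using 1 2 by (auto simp: pos_poly_def)
  have eq: "A + B = to_fract (p * q' + p' * q) / to_fract (q * q')"
    using nz by (simp add: 1 2 field_simps)
  have P: "p * q' \<in> pos_poly" "p' * q \<in> pos_poly" using 1 2 pos_poly_mult by auto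
  then have "min_weight s k (p * q' + p' * q) = min (min_weight s k (p * q')) (min_weight s k (p' * q))"
    using nz unfolding min_weight_def keys_add_pos_poly[OF P] image_Un by (intro Min_Un) auto
  moreover have "p * q' + p' * q \<noteq> 0" using pos_poly_add[OF P] by (auto simp: pos_poly_def)
  ultimately show ?thesis
    using nz unfolding eq unfolding 1(1) 2(1) by (simp add: valuation_eq min_weight_mult del: to_fract_mult to_fract_add)
qed

section \<open>Laurent polynomials\<close>

text \<open>Closure rules, rather than fractions with monomial denominators, let membership pass
  through substitutions by induction, for any family \<open>x\<close>.\<close>

inductive_set laurent_in :: "(nat \<Rightarrow> ratfun) \<Rightarrow> ratfun set" for x :: "nat \<Rightarrow> ratfun" where
  laurent_in_const: "const c \<in> laurent_in x"
| laurent_in_var: "x k \<in> laurent_in x"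
| laurent_in_inverse: "inverse (x k) \<in> laurent_in x"
| laurent_in_add: "A \<in> laurent_in x \<Longrightarrow> B \<in> laurent_in x \<Longrightarrow> A + B \<in> laurent_in x"
| laurent_in_mult: "A \<in> laurent_in x \<Longrightarrow> B \<in> laurent_in x \<Longrightarrow> A * B \<in> laurent_in x"

abbreviation laurent :: "ratfun set" where "laurent \<equiv> laurent_in indet"

lemma laurent_in_0 [simp]: "0 \<in> laurent_in x" and laurent_in_1 [simp]: "1 \<in> laurent_in x"
  using laurent_in_const[of 0 x] laurent_in_const[of 1 x] by simp_all

lemma laurent_in_uminus: "A \<in> laurent_in x \<Longrightarrow> - A \<in> laurent_in x"
  using laurent_in_mult[OF laurent_in_const[of "-1" x], of A] by simp

lemma laurent_in_power: "A \<in> laurent_in x \<Longrightarrow> A ^ n \<in> laurent_in x"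
  by (induction n) (auto intro: laurent_in_mult)

lemma laurent_in_sum: "(\<And>i. i \<in> S \<Longrightarrow> A i \<in> laurent_in x) \<Longrightarrow> (\<Sum>i\<in>S. A i) \<in> laurent_in x"
  by (induction S rule: infinite_finite_induct) (auto intro: laurent_in_add)

definition laurent_units :: "ratfun set" where "laurent_units = {A. A \<noteq> 0 \<and> A \<in> laurent \<and> inverse A \<in> laurent}"

lemma laurent_units_closed:
  "indet k \<in> laurent_units" "1 \<in> laurent_units" "A \<in> laurent_units \<Longrightarrow> B \<in> laurent_units \<Longrightarrow> A * B \<in> laurent_units"
  "A \<in> laurent_units \<Longrightarrow> inverse A \<in> laurent_units" "A \<in> laurent_units \<Longrightarrow> - A \<in> laurent_units"
  "A \<in> laurent_units \<Longrightarrow> B \<in> laurent_units \<Longrightarrow> A / B \<in> laurent_units"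
  by (auto simp: laurent_units_def divide_inverse intro: laurent_in.intros laurent_in_uminus)

lemma laurent_units_power: "A \<in> laurent_units \<Longrightarrow> A ^ n \<in> laurent_units"
  by (induction n) (auto intro: laurent_units_closed)

lemma laurent_units_prod: "(\<And>i. i \<in> S \<Longrightarrow> A i \<in> laurent_units) \<Longrightarrow> (\<Prod>i\<in>S. A i) \<in> laurent_units"
  by (induction S rule: infinite_finite_induct) (auto intro: laurent_units_closed)

lemma laurent_units_D: "A \<in> laurent_units \<Longrightarrow> A \<noteq> 0" "A \<in> laurent_units \<Longrightarrow> A \<in> laurent"
  by (auto simp: laurent_units_def)

lemma place_laurent:
  assumes "A \<in> laurent" "\<And>k. y k \<in> laurent_units"
  shows "A \<in> place_dom y \<and> place y A \<in> laurent"
  using assms(1)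
proof induction
  case (laurent_in_inverse k)
  then show ?case
    using assms(2)[of k] by (simp add: place_closed place_hom laurent_units_def)
qed (use assms(2) in \<open>auto simp: place_closed place_hom laurent_units_def intro: laurent_in.intros\<close>)

lemma place_laurent_units:
  assumes "A \<in> laurent_units" "\<And>k. y k \<in> laurent_units"
  shows "place y A \<in> laurent_units"
proof -
  have *: "A \<in> place_dom y" "place y A \<in> laurent" "inverse A \<in> place_dom y" "place y (inverse A) \<in> laurent" "A \<noteq> 0"
    using assms place_laurent by (auto simp: laurent_units_def)
  then have "place y A * place y (inverse A) = 1" by (simp flip: place_hom(2))
  then have "place y A \<noteq> 0" "inverse (place y A) = place y (inverse A)" by (auto simp: inverse_unique)
  then show ?thesis using * by (simp add: laurent_units_def)
qed

lemma place_laurent_in: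
  assumes "A \<in> laurent" "\<And>k. x k \<in> subfree"
  shows "A \<in> place_dom x \<and> place x A \<in> laurent_in x"
  using assms(1)
  by induction (auto simp: place_closed place_hom subfree_nonzero assms(2) intro: laurent_in.intros)

text \<open>One factor \<open>D\<close> pays for each inverse variable; under sums and products the
  exponents needed add up.\<close>

lemma laurent_in_clear_denominator:
  assumes "A \<in> laurent_in x" "\<And>k. x k \<in> laurent" "D \<in> laurent" "\<And>k. inverse (x k) * D \<in> laurent"
  shows "\<exists>a. A * D ^ a \<in> laurent"
  using assms(1)
proof induction
  case (laurent_in_const c)
  show ?case by (rule exI[of _ 0]) (simp add: laurent_in.laurent_in_const)
next
  case (laurent_in_var k)
  show ?case by (rule exI[of _ 0]) (simp add: assms)
next
  case (laurent_in_inverse k)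
  show ?case by (rule exI[of _ 1]) (simp add: assms)
next
  case (laurent_in_add A B)
  then obtain a b where *: "A * D ^ a \<in> laurent" "B * D ^ b \<in> laurent" by blast
  have "A * D ^ a * D ^ b + B * D ^ b * D ^ a \<in> laurent"
    by (rule laurent_in.laurent_in_add; rule laurent_in.laurent_in_mult; (rule * laurent_in_power[OF assms(3)]))
  then show ?case by (intro exI[of _ "a + b"]) (simp add: power_add algebra_simps)
next
  case (laurent_in_mult A B)
  then obtain a b where *: "A * D ^ a \<in> laurent" "B * D ^ b \<in> laurent" by blast
  have "(A * D ^ a) * (B * D ^ b) \<in> laurent"
    by (rule laurent_in.laurent_in_mult[OF *])
  then show ?case by (intro exI[of _ "a + b"]) (simp add: power_add algebra_simps)
qed

text \<open>The factor theorem: \<open>y\<close> only replaces \<open>indet \<alpha>\<close> by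
  \<open>y \<alpha>\<close>, so \<open>A\<close> minus its value is a multiple of
  \<open>indet \<alpha> - y \<alpha>\<close>, hence of \<open>u\<close>. Negative powers cause no
  harm because \<open>y \<alpha>\<close> is a unit.\<close>

lemma laurent_in_division:
  assumes A: "A \<in> laurent" and y: "\<And>k. y k \<in> laurent_units" "\<And>k. k \<noteq> \<alpha> \<Longrightarrow> y k = indet k"
    and u: "indet \<alpha> - y \<alpha> = u * v" "u \<in> laurent" "v \<in> laurent"
  shows "\<exists>B\<in>laurent. A = place y A + u * B"
  using A
proof induction
  case (laurent_in_const c)
  show ?case by (rule bexI[of _ 0]) simp_all
next
  case (laurent_in_var k)
  show ?case
  proof (cases "k = \<alpha>")
    case True
    have "indet \<alpha> = place y (indet \<alpha>) + u * v" unfolding u(1)[symmetric] by simp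
    with True u(3) show ?thesis by blast
  next
    case False
    then show ?thesis by (intro bexI[of _ 0]) (simp_all add: y)
  qed
next
  case (laurent_in_inverse k)
  show ?case
  proof (cases "k = \<alpha>")
    case True
    let ?z = "y \<alpha>"
    have z: "?z \<noteq> 0" "inverse ?z \<in> laurent" using y(1)[of \<alpha>] by (auto simp: laurent_units_def)
    have "inverse (indet \<alpha>) - inverse ?z = - (indet \<alpha> - ?z) * (inverse (indet \<alpha>) * inverse ?z)"
      using z by (simp add: field_simps)
    also have "\<dots> = u * (- v * (inverse (indet \<alpha>) * inverse ?z))" unfolding u(1) by simp
    finally have "inverse (indet \<alpha>) = place y (inverse (indet \<alpha>)) + u * (- v * (inverse (indet \<alpha>) * inverse ?z))"
      using z by (simp add: place_hom diff_eq_eq add.commute)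
    moreover have "- v * (inverse (indet \<alpha>) * inverse ?z) \<in> laurent"
      by (intro laurent_in.intros laurent_in_uminus u(3) z(2))
    ultimately show ?thesis using True by blast
  next
    case False
    then show ?thesis by (intro bexI[of _ 0]) (simp_all add: place_hom y)
  qed
next
  case (laurent_in_add A B)
  then obtain A' B' where "A' \<in> laurent" "B' \<in> laurent" "A = place y A + u * A'" "B = place y B + u * B'" by blast
  moreover from this(3,4) have "A + B = (place y A + place y B) + u * (A' + B')"
    by (metis (no_types, lifting) add.assoc add.left_commute distrib_left)
  moreover have "place y (A + B) = place y A + place y B"
    using place_laurent[OF laurent_in_add(1) y(1)] place_laurent[OF laurent_in_add(2) y(1)] by (simp add: place_hom)
  ultimately show ?case by (metis laurent_in.laurent_in_add)
next
  case (laurent_in_mult A B)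
  then obtain A' B' where *: "A' \<in> laurent" "B' \<in> laurent" "A = place y A + u * A'" "B = place y B + u * B'" by blast
  let ?C = "A' * place y B + place y A * B' + u * A' * B'"
  have mem: "place y A \<in> laurent" "place y B \<in> laurent" and place: "place y (A * B) = place y A * place y B"
    using place_laurent[OF laurent_in_mult(1) y(1)] place_laurent[OF laurent_in_mult(2) y(1)] by (simp_all add: place_hom)
  have "A * B = (place y A + u * A') * (place y B + u * B')" using *(3,4) by simp
  also have "\<dots> = place y (A * B) + u * ?C" unfolding place by (simp add: algebra_simps)
  finally have "A * B = place y (A * B) + u * ?C" .
  moreover have "?C \<in> laurent" by (intro laurent_in.laurent_in_add laurent_in.laurent_in_mult * mem u)
  ultimately show ?case by blast
qed

text \<open>By the division lemma the kernel of the substitution is the prime ideal generated by \<open>u\<close>; this is the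
  only instance of unique factorization that the Laurent phenomenon needs.\<close>

lemma laurent_in_coprime:
  assumes y: "\<And>k. y k \<in> laurent_units" "\<And>k. k \<noteq> \<alpha> \<Longrightarrow> y k = indet k"
    and u: "indet \<alpha> - y \<alpha> = u * v" "u \<in> laurent" "v \<in> laurent" "place y u = 0" "u \<noteq> 0"
    and D: "D \<in> laurent" "place y D \<noteq> 0" "A * D ^ d \<in> laurent"
    and A: "A * u ^ a \<in> laurent"
  shows "A \<in> laurent"
  using A
proof (induction a)
  case (Suc a)
  note dom = place_laurent[OF _ y(1), THEN conjunct1]
  define B where "B = A * u ^ Suc a"
  define C where "C = A * D ^ d"
  have B: "B \<in> laurent" and C: "C \<in> laurent" using Suc.prems D(3) by (simp_all only: B_def C_def)
  have BC: "B * D ^ d = C * u ^ a * u" by (simp add: B_def C_def algebra_simps)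
  \<comment> \<open>The substitution kills \<open>u\<close> but not \<open>D\<close>, so
    \<open>B\<close> must lie in its kernel and one factor \<open>u\<close> can be split
    off.\<close>
  have "place y B * place y D ^ d = place y (B * D ^ d)"
    using dom[OF B] dom[OF D(1)] by (simp add: place_hom place_power)
  also have "\<dots> = 0"
    unfolding BC using dom[OF C] dom[OF u(2)] u(4) by (simp add: place_hom place_power place_closed)
  finally have 0: "place y B = 0" using D(2) by simp
  obtain B' where "B' \<in> laurent" "B = u * B'"
    using laurent_in_division[OF B y u(1-3)] unfolding 0 by auto
  with u(5) have "A * u ^ a \<in> laurent" by (simp add: B_def)
  then show ?case by (rule Suc.IH)
qed simp

section \<open>The Laurent phenomenon\<close>

lemma exchange_var_minus: "exchange_var V (\<lambda>j k. - d j k) x i = exchange_var V d x i"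
  by (simp add: exchange_var_def add.commute)

lemma matrix_mut_minus: "matrix_mut j (\<lambda>k l. - d k l) = (\<lambda>k l. - matrix_mut j d k l)"
  by (simp add: matrix_mut_def fun_eq_iff)

lemma exchange_var_mult: "x i \<noteq> 0 \<Longrightarrow> exchange_var V b x i * x i = (\<Prod>j\<in>V. x j ^ nat (b j i)) + (\<Prod>j\<in>V. x j ^ nat (- b j i))"
  by (simp add: exchange_var_def)

text \<open>After the mutation at \<open>j\<close>, the second monomial of the relation at
  \<open>i\<close> is \<open>W * (Mn / Mp) * (1 + \<kappa>) ^ c\<close> with
  \<open>\<kappa> = x i ^ c * (Nm / Np)\<close>. The constant term of the power combines with the
  first monomial \<open>W\<close> to the old exchange relation at \<open>i\<close>; the rest is
  \<open>\<kappa>\<close> times a geometric sum, and \<open>\<kappa>\<close> contains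
  \<open>x i\<close>. So the division by \<open>x i\<close> disappears from the result.\<close>

lemma two_step:
  fixes x :: "nat \<Rightarrow> ratfun"
  assumes V: "finite V" "i \<in> V" "j \<in> V" "i \<noteq> j"
    and d: "d i i = 0" "d j j = 0" "d j i = int c" "d i j = - int c" "c > 0"
    and x: "\<And>k. x k \<noteq> 0"
  defines "Np \<equiv> \<Prod>k\<in>V. x k ^ nat (d k j)" and "Nm \<equiv> \<Prod>k\<in>V - {i}. x k ^ nat (- d k j)"
    and "Mp \<equiv> \<Prod>k\<in>V. x k ^ nat (d k i)" and "Mn \<equiv> \<Prod>k\<in>V. x k ^ nat (- d k i)"
    and "W \<equiv> \<Prod>k\<in>V. x k ^ nat (matrix_mut j d k i)"
  shows "exchange_var V d x j = (Np + x i ^ c * Nm) / x j"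
    and "exchange_var V (matrix_mut j d) (x(j := exchange_var V d x j)) i =
      W * (exchange_var V d x i / Mp + Mn / Mp * x i ^ (c - 1) * (Nm / Np) * (\<Sum>l<c. (1 + x i ^ c * (Nm / Np)) ^ l))"
proof -
  let ?v = "exchange_var V d x j" and ?d = "matrix_mut j d" and ?u = "x i"
  define \<kappa> where "\<kappa> = ?u ^ c * (Nm / Np)"
  have nz: "Np \<noteq> 0" "Nm \<noteq> 0" "Mp \<noteq> 0" "Mn \<noteq> 0" "W \<noteq> 0"
    using V(1) x by (simp_all add: Np_def Nm_def Mp_def Mn_def W_def prod_zero_iff)
  have "(\<Prod>k\<in>V. x k ^ nat (- d k j)) = ?u ^ c * Nm"
    using V d by (simp add: prod.remove[of V i] Nm_def)
  then show v: "?v = (Np + ?u ^ c * Nm) / x j" by (simp add: exchange_var_def Np_def)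
  define e where "e = 1 + \<kappa>"
  have v': "?v = Np * e / x j" unfolding v e_def \<kappa>_def using nz by (simp add: distrib_left)
  define W' where "W' = (\<Prod>k\<in>V. x k ^ (if k = j then 0 else nat (- ?d k i)))"
  have dj: "?d j i = - int c" and di: "?d i i = 0"
    using V d by (simp_all add: matrix_mut_def)
  have Wm: "(\<Prod>k\<in>V. (x(j := ?v)) k ^ nat (- ?d k i)) = ?v ^ c * W'"
  proof -
    have "(\<Prod>k\<in>V. (x(j := ?v)) k ^ nat (- ?d k i))
        = (\<Prod>k\<in>V. (if k = j then ?v ^ c else 1) * x k ^ (if k = j then 0 else nat (- ?d k i)))"
      by (rule prod.cong) (auto simp: dj)
    also have "\<dots> = ?v ^ c * W'" using V by (simp add: prod.distrib W'_def prod.delta)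
    finally show ?thesis .
  qed
  have Wp: "(\<Prod>k\<in>V. (x(j := ?v)) k ^ nat (?d k i)) = W"
    unfolding W_def by (rule prod.cong) (auto simp: dj)
  have xj: "x j ^ c = (\<Prod>k\<in>V. x k ^ (if k = j then c else 0))"
  proof -
    have "(\<Prod>k\<in>V. x k ^ (if k = j then c else 0)) = (\<Prod>k\<in>V. if k = j then x j ^ c else 1)"
      by (rule prod.cong) auto
    then show ?thesis using V by (simp add: prod.delta)
  qed
  \<comment> \<open>Compare exponents: away from \<open>i\<close> and \<open>j\<close>, the mutated
    column \<open>i\<close> is \<open>d k i + c * max 0 (d k j)\<close>, because
    \<open>d j i = c\<close> is positive.\<close>
  have "W' * Np ^ c * Mp = W * Mn * x j ^ c"
    unfolding W'_def Np_def Mp_def W_def Mn_def xj prod_power_distrib prod.distrib[symmetric]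
      power_mult[symmetric] power_add[symmetric]
  proof (intro prod.cong refl arg_cong[where f = "power _"])
    fix k assume "k \<in> V"
    consider "k = j" | "k = i" | "k \<noteq> i" "k \<noteq> j" by blast
    then show "(if k = j then 0 else nat (- ?d k i)) + nat (d k j) * c + nat (d k i) =
        nat (?d k i) + nat (- d k i) + (if k = j then c else 0)"
    proof cases
      case 1 then show ?thesis using d dj V by simp
    next
      case 2 then show ?thesis using d di V by simp
    next
      case 3
      have "?d k i = d k i + max 0 (d k j) * int c" using 3 V d by (simp add: matrix_mut_def)
      moreover have "int (nat (d k j) * c) = max 0 (d k j) * int c" by (simp add: max_def)
      ultimately have "nat (- ?d k i) + nat (d k j) * c + nat (d k i) = nat (?d k i) + nat (- d k i)"
        by linarith
      with 3 show ?thesis by simp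
    qed
  qed
  then have key: "?v ^ c * W' = W * (Mn / Mp) * e ^ c"
    unfolding v' using nz x by (simp add: power_divide power_mult_distrib field_simps)
  let ?S = "\<Sum>l<c. e ^ l"
  have geo: "e ^ c = 1 + \<kappa> * ?S"
    using power_diff_1_eq[of e c] by (simp add: e_def algebra_simps)
  have \<kappa>: "\<kappa> / ?u = ?u ^ (c - 1) * (Nm / Np)"
    unfolding \<kappa>_def using d(5) x by (cases c) (simp_all add: field_simps)
  have "exchange_var V ?d (x(j := ?v)) i = (W + W * (Mn / Mp) * (1 + \<kappa> * ?S)) / ?u"
    unfolding exchange_var_def[of V ?d] Wp Wm key geo using V by simp
  also have "\<dots> = W * ((Mp + Mn) / ?u / Mp + Mn / Mp * (\<kappa> / ?u) * ?S)"
    using nz x by (simp add: field_simps)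
  also have "(Mp + Mn) / ?u = exchange_var V d x i" by (simp add: exchange_var_def Mp_def Mn_def)
  finally show "exchange_var V ?d (x(j := ?v)) i =
      W * (exchange_var V d x i / Mp + Mn / Mp * x i ^ (c - 1) * (Nm / Np) * (\<Sum>l<c. (1 + x i ^ c * (Nm / Np)) ^ l))"
    unfolding \<kappa> unfolding e_def \<kappa>_def by (simp only: mult.assoc)
qed

text \<open>The substitution \<open>y\<close> is reduction modulo \<open>u\<close>. In
  \<open>v\<close> only the monomial \<open>Np\<close> survives it. In \<open>w\<close> only
  \<open>W * T\<close> survives if \<open>c > 1\<close>; for \<open>c = 1\<close> a second summand
  survives, and the vertex \<open>\<beta>\<close> is there to exclude cancellation between the
  two.\<close>

lemma two_step_laurent:
  assumes V: "finite V" "i \<in> V" "j \<in> V" "i \<noteq> j"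
    and d: "d i i = 0" "d j j = 0" "d j i = int c" "d i j = - int c" "c > 0"
    and u: "u \<noteq> 0" "u \<in> laurent" and x: "x = indet(i := u)" "exchange_var V d x i = indet i"
    and v: "v = exchange_var V d x j" and w: "w = exchange_var V (matrix_mut j d) (x(j := v)) i"
    and y: "\<And>k. y k \<in> laurent_units" "place y u = 0" "\<And>k. valuation 1 \<beta> (y k) = (if k = \<beta> then 1 else 0)"
    and \<beta>: "\<beta> \<in> V" "\<beta> \<noteq> i" "\<beta> \<noteq> j" "d \<beta> i = 0" "d \<beta> j \<noteq> 0"
  shows "v \<in> laurent" "w \<in> laurent" "place y v \<noteq> 0" "place y w \<noteq> 0"
proof -
  define Np where "Np = (\<Prod>k\<in>V. x k ^ nat (d k j))"
  define Nm where "Nm = (\<Prod>k\<in>V - {i}. x k ^ nat (- d k j))"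
  define Mp where "Mp = (\<Prod>k\<in>V. x k ^ nat (d k i))"
  define Mn where "Mn = (\<Prod>k\<in>V. x k ^ nat (- d k i))"
  define W where "W = (\<Prod>k\<in>V. x k ^ nat (matrix_mut j d k i))"
  define S where "S = (\<Sum>l<c. (1 + u ^ c * (Nm / Np)) ^ l)"
  define K R T where "K = Nm / Np" and "R = Mn / Mp" and "T = indet i / Mp"
  have xnz: "x k \<noteq> 0" for k using x u by simp
  have xi: "x i = u" and xj: "x j = indet j" using x V by simp_all
  have mono: "(\<Prod>k\<in>A. x k ^ nat (e k)) = (\<Prod>k\<in>A. indet k ^ nat (e k))" if "i \<in> A \<Longrightarrow> e i \<le> 0" for A e
    by (rule prod.cong) (use that x in auto)
  have Np: "Np = (\<Prod>k\<in>V. indet k ^ nat (d k j))" and Nm: "Nm = (\<Prod>k\<in>V - {i}. indet k ^ nat (- d k j))"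
    and Mp: "Mp = (\<Prod>k\<in>V. indet k ^ nat (d k i))" and Mn: "Mn = (\<Prod>k\<in>V. indet k ^ nat (- d k i))"
    and W: "W = (\<Prod>k\<in>V. indet k ^ nat (matrix_mut j d k i))"
    unfolding Np_def Nm_def Mp_def Mn_def W_def
    by (rule mono; use V d in \<open>simp add: matrix_mut_def\<close>)+
  have U: "Np \<in> laurent_units" "Nm \<in> laurent_units" "Mp \<in> laurent_units" "Mn \<in> laurent_units" "W \<in> laurent_units"
    unfolding Np Nm Mp Mn W by (intro laurent_units_prod laurent_units_power laurent_units_closed)+
  then have U': "K \<in> laurent_units" "R \<in> laurent_units" "T \<in> laurent_units"
    unfolding K_def R_def T_def by (auto intro: laurent_units_closed)
  note L = laurent_units_D(2)[OF U(1)] laurent_units_D(2)[OF U(2)] laurent_units_D(2)[OF U(3)] laurent_units_D(2)[OF U(4)] laurent_units_D(2)[OF U(5)]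
    laurent_units_D(2)[OF U'(1)] laurent_units_D(2)[OF U'(2)] laurent_units_D(2)[OF U'(3)]
  note nz = laurent_units_D(1)[OF U(1)] laurent_units_D(1)[OF U(2)] laurent_units_D(1)[OF U(3)] laurent_units_D(1)[OF U(4)] laurent_units_D(1)[OF U(5)]
  note dom = place_laurent[OF _ y(1), THEN conjunct1]
  note plnz = laurent_units_D(1)[OF place_laurent_units[OF _ y(1)]]
  have v1: "v * indet j = Np + u ^ c * Nm"
    unfolding v two_step(1)[of V i j d c x, OF V d xnz] by (simp add: Np_def Nm_def xi xj)
  have v2: "v = (Np + u ^ c * Nm) * inverse (indet j)" using v1 by (simp add: field_simps)
  show "v \<in> laurent" unfolding v2 by (intro laurent_in.intros laurent_in_power L u)
  then have "place y v * y j = place y (v * indet j)" by (simp add: place_hom dom)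
  also have "\<dots> = place y Np" unfolding v1 using d(5) by (simp add: place_hom place_closed place_power dom L u y)
  finally show "place y v \<noteq> 0" using plnz[OF U(1)] by auto
  have w1: "w = W * (T + R * u ^ (c - 1) * K * S)"
    unfolding w v two_step(2)[of V i j d c x, OF V d xnz]
    by (simp add: Np_def Nm_def Mp_def Mn_def W_def T_def R_def K_def S_def xi x(2))
  have S: "S \<in> laurent" unfolding S_def K_def[symmetric]
    by (intro laurent_in_sum laurent_in_power laurent_in.laurent_in_add laurent_in.laurent_in_mult laurent_in_1 u L)
  show "w \<in> laurent" unfolding w1 by (intro laurent_in.laurent_in_add laurent_in.laurent_in_mult L S laurent_in_power u)
  have plw: "place y w = place y W * (place y T + place y R * place y u ^ (c - 1) * place y K * place y S)"
    unfolding w1 by (simp add: place_hom place_closed place_power dom L u S)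
  show "place y w \<noteq> 0"
  proof (cases "c = 1")
    case False
    with d(5) show ?thesis unfolding plw y(2) using plnz[OF U(5)] plnz[OF U'(3)] by (simp add: power_0_left)
  next
    case True
    then have "S = 1" by (simp add: S_def)
    \<comment> \<open>This sum has the factor \<open>u\<close>, so modulo \<open>u\<close> the two
      monomials of the exchange relation at \<open>i\<close> are opposite.\<close>
    have "Mp + Mn = indet i * u" using exchange_var_mult[of x i V d] u by (simp add: Mp_def Mn_def x(2) xi)
    then have "place y Mp + place y Mn = place y (indet i * u)" by (simp add: place_hom dom L flip: place_hom(1))
    also have "\<dots> = 0" by (simp add: place_hom dom u y(2))
    finally have "place y Mn = - place y Mp" by (simp add: eq_neg_iff_add_eq_0 add.commute)
    then have plR: "place y R = - 1" unfolding R_def using plnz[OF U(3)] by (simp add: place_divide dom L)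
    have place_mono: "place y (\<Prod>k\<in>A. indet k ^ e k) = (\<Prod>k\<in>A. y k ^ e k)" for A and e :: "nat \<Rightarrow> nat"
      using place_prod[of A "\<lambda>k. indet k ^ e k" y] by (simp add: place_power)
    have valuation_mono: "valuation 1 \<beta> (place y (\<Prod>k\<in>A. indet k ^ e k)) = int (e \<beta>)"
      if "finite A" "\<beta> \<in> A" for A and e :: "nat \<Rightarrow> nat"
      unfolding place_mono using that laurent_units_D(1)[OF y(1)]
      by (simp add: valuation_prod valuation_power y(3) if_distrib[of "(*) _"] sum.delta cong: if_cong)
    \<comment> \<open>\<open>T\<close> is free of the variable at \<open>\<beta>\<close>, whereas
      \<open>K\<close> contains it with exponent \<open>- d \<beta> j\<close>; \<open>y\<close>
      preserves the order along this variable.\<close>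
    have "place y T \<noteq> place y K"
    proof
      assume "place y T = place y K"
      moreover have "place y T = y i / place y Mp" "place y K = place y Nm / place y Np"
        unfolding T_def K_def using plnz[OF U(3)] plnz[OF U(1)] by (simp_all add: place_divide dom L)
      moreover have "valuation 1 \<beta> (y i / place y Mp) = 0"
        using laurent_units_D(1)[OF y(1)[of i]] plnz[OF U(3)] \<beta> V unfolding Mp
        by (simp add: valuation_divide valuation_mono y(3))
      moreover have "valuation 1 \<beta> (place y Nm / place y Np) = - d \<beta> j"
        using plnz[OF U(1)] plnz[OF U(2)] \<beta> V unfolding Np Nm
        by (simp add: valuation_divide valuation_mono)
      ultimately show False using \<beta>(5) by simp
    qed
    then show ?thesis
      unfolding plw \<open>S = 1\<close> plR using True plnz[OF U(5)] by simp
  qed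
qed

lemma exchange_var_cong_indet:
  "(\<And>k. k \<in> V \<Longrightarrow> b k i \<noteq> 0 \<Longrightarrow> x k = indet k) \<Longrightarrow> x i = indet i \<Longrightarrow> exchange_var V b x i = exchange_var V b indet i"
  unfolding exchange_var_def
  by (intro arg_cong2[where f = divide] arg_cong2[where f = plus] prod.cong refl; metis minus_zero nat_0 power_0)

lemma exchange_var_indet_laurent: "exchange_var V b indet i \<in> laurent"
  unfolding exchange_var_def divide_inverse
  by (intro laurent_in.laurent_in_mult laurent_in.laurent_in_add laurent_units_D(2)[OF laurent_units_prod] laurent_units_power laurent_units_closed laurent_in.laurent_in_inverse)

lemma place_exchange_var_indet_id:
  assumes "\<And>k. k \<in> V \<Longrightarrow> b k i \<noteq> 0 \<Longrightarrow> y k = indet k" "y i = indet i"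
  shows "place y (exchange_var V b indet i) = exchange_var V b indet i"
proof -
  have P: "(\<Prod>k\<in>V. indet k ^ e k) \<in> place_dom y \<and> place y (\<Prod>k\<in>V. indet k ^ e k) = (\<Prod>k\<in>V. y k ^ e k)" for e
    using place_prod[of V "\<lambda>k. indet k ^ e k" y] by (simp add: place_power)
  have "place y (exchange_var V b indet i) = exchange_var V b y i"
    unfolding exchange_var_def using P assms(2) by (simp add: place_divide place_closed place_hom)
  also have "\<dots> = exchange_var V b indet i" by (rule exchange_var_cong_indet) (use assms in auto)
  finally show ?thesis .
qed

text \<open>The auxiliary frozen variable \<open>\<alpha>\<close> makes the new variable \<open>u\<close> at \<open>i\<close> linear in \<open>\<alpha>\<close>, hence prime; \<open>\<beta>\<close> ensures
  that the next two variables \<open>v\<close> and \<open>w\<close> do not vanish modulo \<open>u\<close>.\<close>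

lemma caterpillar:
  assumes skew: "skew E b" and ij: "i \<in> E" "j \<in> E" "i \<noteq> j" and V: "E \<subseteq> V" "finite V"
    and \<alpha>: "\<alpha> \<in> V - E" "b \<alpha> i = 1" "b \<alpha> j = 0"
    and \<beta>: "\<beta> \<in> V - E" "b \<beta> i = 0" "b \<beta> j = 1"
    and A: "A \<in> laurent_in (cluster_var V b [i])" "A \<in> laurent_in (cluster_var V b [i, j, i])"
  shows "A \<in> laurent"
proof -
  define u where "u = exchange_var V b indet i"
  define x1 where "x1 = indet(i := u)"
  define b1 where "b1 = matrix_mut i b"
  define v where "v = exchange_var V b1 x1 j"
  define w where "w = exchange_var V (matrix_mut j b1) (x1(j := v)) i"
  have c1: "cluster_var V b [i] = x1" by (simp add: cluster_var_def x1_def u_def)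
  have c3: "cluster_var V b [i, j, i] = x1(j := v, i := w)"
    by (simp add: cluster_var_def x1_def u_def v_def w_def b1_def)
  have ne: "\<alpha> \<noteq> i" "\<alpha> \<noteq> j" "\<beta> \<noteq> i" "\<beta> \<noteq> j" "\<alpha> \<noteq> \<beta>" "i \<in> V" "j \<in> V"
    using \<alpha> \<beta> ij V by auto
  have skew1: "skew E b1" unfolding b1_def by (rule skew_matrix_mut[OF skew ij(1)])
  have bii: "b i i = 0" "b1 i i = 0" "b1 j j = 0" "b1 i j = - b1 j i"
    using skew_diag[OF skew] skew_diag[OF skew1] ij skewD[OF skew1 ij(1,2)] by simp_all
  have bk: "b1 k i = - b k i" for k by (simp add: b1_def matrix_mut_def)
  have uL: "u \<in> laurent" unfolding u_def by (rule exchange_var_indet_laurent)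
  have uSF: "u \<in> subfree" unfolding u_def by (rule exchange_var_subfree) (rule subfree_indet)
  have unz: "u \<noteq> 0" using uSF by (rule subfree_nonzero)
  have x1SF: "x1 k \<in> subfree" for k using uSF by (simp add: x1_def subfree_indet)
  have x1i: "exchange_var V b1 x1 i = indet i"
    unfolding b1_def x1_def u_def by (rule exchange_var_involution) (use bii unz in \<open>auto simp: u_def\<close>)
  define P where "P = (\<Prod>k\<in>V - {\<alpha>}. indet k ^ nat (b k i))"
  define N where "N = (\<Prod>k\<in>V - {\<alpha>}. indet k ^ nat (- b k i))"
  \<comment> \<open>The root of \<open>u = (indet \<alpha> * P + N) / indet i\<close>, regarded as a
    linear polynomial in \<open>indet \<alpha>\<close>.\<close>
  define y where "y = indet(\<alpha> := - (N / P))"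
  have PN: "P \<in> laurent_units" "N \<in> laurent_units" unfolding P_def N_def by (intro laurent_units_prod laurent_units_power laurent_units_closed)+
  have y: "y k \<in> laurent_units" "k \<noteq> \<alpha> \<Longrightarrow> y k = indet k" for k
    using PN by (simp_all add: y_def laurent_units_closed)
  note Pnz = laurent_units_D(1)[OF PN(1)]
  have u_eq: "u = (indet \<alpha> * P + N) / indet i"
    using \<alpha> V unfolding u_def exchange_var_def P_def N_def by (simp add: prod.remove[of V \<alpha>])
  have PNpl: "place y P = P" "place y N = N" "P \<in> place_dom y" "N \<in> place_dom y"
  proof -
    have P: "(\<Prod>k\<in>V - {\<alpha>}. indet k ^ e k) \<in> place_dom y \<and>
        place y (\<Prod>k\<in>V - {\<alpha>}. indet k ^ e k) = (\<Prod>k\<in>V - {\<alpha>}. y k ^ e k)" for e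
      using place_prod[of "V - {\<alpha>}" "\<lambda>k. indet k ^ e k" y] by (simp add: place_power)
    show "P \<in> place_dom y" "N \<in> place_dom y" using P unfolding P_def N_def by auto
    show "place y P = P" "place y N = N" unfolding P_def N_def P[THEN conjunct2]
      by (rule prod.cong; simp add: y)+
  qed
  have yu: "place y u = 0"
    unfolding u_eq using PNpl ne Pnz y(2)[of i] by (simp add: place_divide place_closed place_hom) (simp add: y_def)
  have yuv: "indet \<alpha> - y \<alpha> = u * (indet i / P)"
    unfolding u_eq using Pnz by (simp add: y_def field_simps)
  have iP: "indet i / P \<in> laurent" by (intro laurent_units_D(2) laurent_units_closed PN)
  have valuation: "valuation 1 \<beta> (y k) = (if k = \<beta> then 1 else 0)" for k
  proof (cases "k = \<alpha>")
    case True
    have valuation_mono: "valuation 1 \<beta> (\<Prod>k\<in>V - {\<alpha>}. indet k ^ e k) = int (e \<beta>)" for e :: "nat \<Rightarrow> nat"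
      using \<beta> ne V by (simp add: valuation_prod valuation_power valuation_indet if_distrib[of "(*) _"] sum.delta cong: if_cong)
    have "valuation 1 \<beta> (- (N / P)) = 0"
      using laurent_units_D(1)[OF PN(1)] laurent_units_D(1)[OF PN(2)] \<beta>
      by (simp add: valuation_uminus valuation_divide) (simp add: N_def P_def valuation_mono)
    with True ne show ?thesis by (simp add: y_def)
  qed (simp add: y valuation_indet)
  have vw: "v \<in> laurent \<and> w \<in> laurent \<and> place y v \<noteq> 0 \<and> place y w \<noteq> 0"
  proof (cases "b1 j i = 0")
    case True
    \<comment> \<open>Without arrows between \<open>i\<close> and \<open>j\<close> the mutations
      commute: \<open>w\<close> is the old variable at \<open>i\<close> again, and \<open>v\<close>
      does not involve \<open>indet \<alpha>\<close>, so the substitution leaves it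
      unchanged.\<close>
    then have "b i j = 0" using bk[of j] skewD[OF skew ij(1,2)] by simp
    then have "b1 \<alpha> j = 0" using \<alpha> ne ij(3) by (simp add: b1_def matrix_mut_def)
    have v': "v = exchange_var V b1 indet j"
      unfolding v_def by (rule exchange_var_cong_indet) (use True bii ij in \<open>auto simp: x1_def\<close>)
    have "place y v = v" unfolding v'
      by (rule place_exchange_var_indet_id) (use \<open>b1 \<alpha> j = 0\<close> y(2) ne in metis)+
    moreover have "v \<in> subfree" unfolding v_def by (rule exchange_var_subfree) (rule x1SF)
    moreover have "w = indet i"
    proof -
      have *: "matrix_mut j b1 k i = b1 k i" for k using True ij(3) by (simp add: matrix_mut_def)
      have "w = exchange_var V b1 x1 i" unfolding w_def exchange_var_def *
        by (intro arg_cong2[where f = divide] arg_cong2[where f = plus] prod.cong) (use True ij in auto)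
      then show ?thesis by (simp add: x1i)
    qed
    ultimately show ?thesis
      using y(2)[of i] ne subfree_nonzero[of v] exchange_var_indet_laurent[of V b1 j] laurent_in.laurent_in_var[of indet i]
      by (simp add: v')
  next
    case False
    \<comment> \<open>A global sign does not affect exchange relations, so the entry at
      \<open>j\<close>, \<open>i\<close> may be taken to be positive, as \<open>two_step\<close>
      demands.\<close>
    define d where "d = (if b1 j i > 0 then b1 else (\<lambda>k l. - b1 k l))"
    define c where "c = nat (d j i)"
    have dmv: "exchange_var V d = exchange_var V b1" "exchange_var V (matrix_mut j d) = exchange_var V (matrix_mut j b1)"
      unfolding d_def by (auto simp: exchange_var_minus matrix_mut_minus fun_eq_iff)
    have d: "d i i = 0" "d j j = 0" "d j i = int c" "d i j = - int c" "c > 0"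
      using bii False unfolding c_def d_def by auto
    have "b1 \<beta> j = 1" using \<beta> ne ij(3) by (simp add: b1_def matrix_mut_def)
    then have d\<beta>: "d \<beta> i = 0" "d \<beta> j \<noteq> 0" using \<beta> bk[of \<beta>] by (auto simp: d_def)
    have vw: "exchange_var V d x1 i = indet i" "v = exchange_var V d x1 j" "w = exchange_var V (matrix_mut j d) (x1(j := v)) i"
      unfolding dmv x1i v_def w_def by simp_all
    have \<beta>V: "\<beta> \<in> V" using \<beta> by simp
    note ts = two_step_laurent[OF V(2) ne(6,7) ij(3) d unz uL x1_def vw y(1) yu valuation \<beta>V ne(3,4) d\<beta>]
    show ?thesis using ts by blast
  qed
  have vwnz: "v \<noteq> 0" "w \<noteq> 0" using vw by auto
  have inv: "inverse (indet k) \<in> laurent" for k by (rule laurent_in.laurent_in_inverse)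
  \<comment> \<open>Seen from the cluster after \<open>[i]\<close>, the only new denominator of
    \<open>A\<close> is a power of \<open>u\<close>; seen from the cluster after
    \<open>[i, j, i]\<close>, it is a power of \<open>v * w\<close>. Since \<open>v * w\<close> does
    not vanish modulo \<open>u\<close>, neither denominator can be there.\<close>
  obtain a where a: "A * u ^ a \<in> laurent"
  proof -
    have "inverse (x1 k) * u \<in> laurent" "x1 k \<in> laurent" for k
      using unz uL inv by (auto simp: x1_def intro: laurent_in.laurent_in_mult laurent_in.laurent_in_var)
    with laurent_in_clear_denominator[OF A(1)[unfolded c1] _ uL] that show ?thesis by blast
  qed
  obtain n where n: "A * (v * w) ^ n \<in> laurent"
  proof -
    have vwL: "v * w \<in> laurent" using vw by (intro laurent_in.laurent_in_mult) auto
    have e: "inverse v * (v * w) = w" "inverse w * (v * w) = v" using vwnz by simp_all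
    have "inverse v * (v * w) \<in> laurent" "inverse w * (v * w) \<in> laurent" unfolding e using vw by simp_all
    then have "inverse ((x1(j := v, i := w)) k) * (v * w) \<in> laurent" "(x1(j := v, i := w)) k \<in> laurent" for k
      using vw inv[of k] vwL by (auto simp: x1_def intro: laurent_in.laurent_in_mult laurent_in.laurent_in_var)
    with laurent_in_clear_denominator[OF A(2)[unfolded c3] _ vwL] that show ?thesis by blast
  qed
  have D: "v * w \<in> laurent" "place y (v * w) \<noteq> 0"
    using vw place_laurent[OF _ y(1)] by (auto simp: place_hom intro: laurent_in.laurent_in_mult)
  show ?thesis by (rule laurent_in_coprime[OF y yuv uL iP yu unz D n a])
qed

lemma mseed_path_cancel:
  assumes "skew E b" "set is \<subseteq> E" "i \<in> E"
  shows "mseed_path V (is @ i # i # js) (b, indet) = mseed_path V (is @ js) (b, indet)"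
  using mseed_mut_involution[OF skew_matrix_path[OF assms(1,2)] assms(3), of "cluster_var V b is" V]
  unfolding mseed_path_simps unfolding mseed_path_cluster_var by simp

text \<open>Vertices in \<open>V' - V\<close> are never mutated and carry the value 1, so they
  contribute only factors 1 to the exchange relations; setting frozen variables to 1 is the same as
  deleting their rows.\<close>

lemma mseed_path_specialize:
  assumes "finite V'" "V \<subseteq> V'" "E \<subseteq> V" "set is \<subseteq> E"
    and "\<And>k. k \<in> V' - V \<Longrightarrow> x' k = 1" "\<And>k. k \<notin> V' - V \<Longrightarrow> x' k = x k"
    and "\<And>j k. j \<in> V \<Longrightarrow> k \<in> E \<Longrightarrow> b' j k = b j k"
    and "k \<notin> V' - V"
  shows "snd (mseed_path V' is (b', x')) k = snd (mseed_path V is (b, x)) k"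
  using assms(4-)
proof (induction "is" arbitrary: b b' x x')
  case (Cons i "is")
  have i: "i \<in> E" "i \<in> V" using Cons.prems assms(3) by auto
  have P: "(\<Prod>k\<in>V'. x' k ^ e k) = (\<Prod>k\<in>V. x k ^ f k)" if "\<And>k. k \<in> V \<Longrightarrow> e k = f k" for e f :: "nat \<Rightarrow> nat"
  proof -
    have "(\<Prod>k\<in>V'. x' k ^ e k) = (\<Prod>k\<in>V. x' k ^ e k)"
      by (rule prod.mono_neutral_right) (use assms(1,2) Cons.prems in auto)
    also have "\<dots> = (\<Prod>k\<in>V. x k ^ f k)"
      by (rule prod.cong) (use that Cons.prems in auto)
    finally show ?thesis .
  qed
  have m: "exchange_var V' b' x' i = exchange_var V b x i"
    unfolding exchange_var_def
    by (intro arg_cong2[where f = divide] arg_cong2[where f = plus] P) (use Cons.prems i in auto)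
  show ?case
    unfolding mseed_path_simps mseed_mut_def fst_conv snd_conv m
  proof (rule Cons.IH)
    show "matrix_mut i b' j k = matrix_mut i b j k" if "j \<in> V" "k \<in> E" for j k
      using Cons.prems(4) that i assms(3) by (auto simp: matrix_mut_def)
  qed (use Cons.prems i in auto)
qed simp

text \<open>The induction runs over all matrices simultaneously, so that the two rows required by
  \<open>caterpillar\<close> can be added first and specialized to 1 afterwards.\<close>

theorem Laurent_phenomenon:
  assumes "skew E b" "finite V" "E \<subseteq> V" "set is \<subseteq> E"
  shows "cluster_var V b is k \<in> laurent"
  using assms
proof (induction "length is" arbitrary: "is" b V k rule: less_induct)
  case less
  consider "is = []" | i where "is = [i]" | i q where "is = i # i # q" | i j q where "is = i # j # q" "i \<noteq> j"
    by (cases "is" rule: remdups_adj.cases) blast+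
  then show ?case
  proof cases
    case 1
    then show ?thesis using laurent_in.laurent_in_var[of indet k] by simp
  next
    case 2
    then show ?thesis using exchange_var_indet_laurent laurent_in.laurent_in_var[of indet k] by (simp add: cluster_var_def)
  next
    case 3
    then have "cluster_var V b is = cluster_var V b q"
      using mseed_path_cancel[OF less.prems(1), of "[]" i V q] less.prems(4) by (simp add: cluster_var_def)
    with 3 less show ?thesis by simp
  next
    case 4
    obtain \<alpha> where \<alpha>: "\<alpha> \<notin> V" using less.prems(2) ex_new_if_finite infinite_UNIV_nat by blast
    obtain \<beta> where \<beta>: "\<beta> \<notin> V" "\<beta> \<noteq> \<alpha>"
      using less.prems(2) ex_new_if_finite[OF infinite_UNIV_nat, of "insert \<alpha> V"] by auto
    define V' where "V' = insert \<alpha> (insert \<beta> V)"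
    define b' where "b' k l = (if k = \<alpha> then if l = i then 1 else 0
      else if k = \<beta> then if l = j then 1 else 0 else b k l)" for k l
    have ij: "i \<in> E" "j \<in> E" "set q \<subseteq> E" using less.prems(4) 4 by auto
    have nE: "\<alpha> \<notin> E" "\<beta> \<notin> E" using \<alpha> \<beta> less.prems(3) by auto
    have skew': "skew E b'"
      unfolding skew_def
    proof (intro ballI)
      fix k l assume "k \<in> E" "l \<in> E"
      moreover from this nE have "b' k l = b k l" "b' l k = b l k" by (auto simp: b'_def)
      ultimately show "b' k l = - b' l k" using skewD[OF less.prems(1), of k l] by simp
    qed
    have V': "finite V'" "E \<subseteq> V'" using less.prems(2,3) by (auto simp: V'_def)
    have L: "cluster_var V' b' is m \<in> laurent" for m
    proof (rule caterpillar[OF skew' ij(1,2) 4(2) V'(2,1), of \<alpha> \<beta>])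
      have "cluster_var V' (matrix_path [i] b') (j # q) m \<in> laurent"
        using 4 ij by (intro less.hyps[OF _ skew_matrix_path[OF skew'] V']) auto
      then have "place (cluster_var V' b' [i]) (cluster_var V' (matrix_path [i] b') (j # q) m) \<in> laurent_in (cluster_var V' b' [i])"
        by (rule place_laurent_in[OF _ cluster_var_subfree, THEN conjunct2])
      then show "cluster_var V' b' is m \<in> laurent_in (cluster_var V' b' [i])"
        unfolding cluster_var_append[symmetric] 4(1) by simp
      \<comment> \<open>From the seed after \<open>[i, j, i]\<close> the same variable is reached
        along \<open>i # q\<close>, as the two consecutive mutations at \<open>i\<close> cancel.
        This path is shorter than \<open>is\<close>, so the induction hypothesis applies.\<close>
      have "cluster_var V' (matrix_path [i, j, i] b') (i # q) m \<in> laurent"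
        using 4 ij by (intro less.hyps[OF _ skew_matrix_path[OF skew'] V']) auto
      then have "place (cluster_var V' b' [i, j, i]) (cluster_var V' (matrix_path [i, j, i] b') (i # q) m) \<in> laurent_in (cluster_var V' b' [i, j, i])"
        by (rule place_laurent_in[OF _ cluster_var_subfree, THEN conjunct2])
      moreover have "cluster_var V' b' ([i, j, i] @ i # q) m = cluster_var V' b' is m"
        using mseed_path_cancel[OF skew', of "[i, j]" i V' q] ij by (simp add: cluster_var_def 4(1))
      ultimately show "cluster_var V' b' is m \<in> laurent_in (cluster_var V' b' [i, j, i])"
        unfolding cluster_var_append[symmetric] by simp
    qed (use nE \<beta> 4(2) in \<open>auto simp: V'_def b'_def\<close>)
    define \<theta> where "\<theta> = indet(\<alpha> := 1, \<beta> := 1)"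
    have \<theta>: "\<theta> k \<in> laurent_units" "\<theta> k \<in> subfree" for k by (simp_all add: \<theta>_def laurent_units_closed(1,2) subfree_indet)
    show ?thesis
    proof (cases "k \<in> V' - V")
      case True
      then have "k \<notin> set is" by (meson DiffD2 less.prems(3,4) subsetD)
      then show ?thesis using laurent_in.laurent_in_var[of indet k] by (simp add: cluster_var_outside)
    next
      case False
      have "place \<theta> (cluster_var V' b' is k) = snd (mseed_path V' is (b', \<theta>)) k"
        by (rule place_cluster_var[OF \<theta>(2)])
      also have "\<dots> = cluster_var V b is k"
        unfolding cluster_var_def
        by (rule mseed_path_specialize[OF V'(1) _ less.prems(3,4)])
           (use False \<alpha> \<beta> in \<open>auto simp: V'_def \<theta>_def b'_def\<close>)
      finally show ?thesis using place_laurent[of "cluster_var V' b' is k" \<theta>, OF L \<theta>(1)] by simp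
    qed
  qed
qed

section \<open>Clusters that agree after forgetting the frozen variables\<close>

lemma laurent_fraction:
  assumes "A \<in> laurent" shows "\<exists>m N. A * monom_at indet m = to_fract N"
  using assms
proof induction
  case (laurent_in_const c)
  show ?case by (intro exI[of _ 0] exI[of _ "single 0 c"]) (simp add: const_def)
next
  case (laurent_in_var k)
  have "indet k * monom_at indet 0 = to_fract (single (single k 1) 1)" by (simp add: indet_def to_fract_def)
  then show ?case by blast
next
  case (laurent_in_inverse k)
  show ?case by (intro exI[of _ "single k 1"] exI[of _ 1]) simp
next
  case (laurent_in_add A B)
  then obtain m N m' N' where *: "A * monom_at indet m = to_fract N" "B * monom_at indet m' = to_fract N'" by blast
  have "(A + B) * monom_at indet (m + m') = (A * monom_at indet m) * monom_at indet m' + (B * monom_at indet m') * monom_at indet m"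
    by (simp add: algebra_simps)
  also have "\<dots> = to_fract (N * single m' 1 + N' * single m 1)" unfolding * by (simp add: monom_at_indet)
  finally show ?case by blast
next
  case (laurent_in_mult A B)
  then obtain m N m' N' where *: "A * monom_at indet m = to_fract N" "B * monom_at indet m' = to_fract N'" by blast
  have "(A * B) * monom_at indet (m + m') = (A * monom_at indet m) * (B * monom_at indet m')" by simp
  also have "\<dots> = to_fract (N * N')" unfolding * by simp
  finally show ?case by blast
qed

lemma monom_at_nonzero: "(\<And>k. y k \<noteq> 0) \<Longrightarrow> monom_at y a \<noteq> 0"
  by (simp add: monom_at_def prod_zero_iff)

lemma valuation_fraction:
  assumes "A * monom_at indet m = to_fract N" "A \<noteq> 0" "a \<in> keys N"
  shows "valuation s k A \<le> s * (int (lookup a k) - int (lookup m k))"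
proof -
  have N: "N \<noteq> 0" and M: "single m (1::rat) \<noteq> 0" using assms(3) by auto
  have "valuation s k A + valuation s k (monom_at indet m) = min_weight s k N"
    using valuation_mult[OF assms(2) monom_at_nonzero[of indet m], of s k] valuation_eq[OF N one_neq_zero, of s k] assms(1)
    by (simp add: min_weight_def[of s k 1] weight_def)
  moreover have "valuation s k (monom_at indet m) = s * int (lookup m k)"
    using valuation_eq[OF M one_neq_zero, of s k] by (simp add: monom_at_indet min_weight_def weight_def)
  ultimately show ?thesis using min_weight_le[OF assms(3), of s k] by (simp add: weight_def algebra_simps)
qed

text \<open>The second valuation is minus the degree. Every exponent that occurs lies between order
  and degree, and at least one occurs.\<close>

lemma laurent_valuation_sum: "A \<in> laurent \<Longrightarrow> A \<noteq> 0 \<Longrightarrow> valuation 1 k A + valuation (- 1) k A \<le> 0"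
proof -
  assume A: "A \<in> laurent" "A \<noteq> 0"
  then obtain m N where N: "A * monom_at indet m = to_fract N" using laurent_fraction by blast
  with A monom_at_nonzero[of indet m] have "N \<noteq> 0" by auto
  then obtain a where "a \<in> keys N" using keys_eq_empty by blast
  from valuation_fraction[OF N A(2) this, of 1 k] valuation_fraction[OF N A(2) this, of "-1" k] show ?thesis by simp
qed

lemma laurent_exponents:
  assumes "A * monom_at indet m = to_fract N" "A \<noteq> 0" "a \<in> keys N"
    and "valuation 1 k A = d" "valuation (- 1) k A = - d"
  shows "int (lookup a k) = int (lookup m k) + d"
  using valuation_fraction[OF assms(1-3), of 1 k] valuation_fraction[OF assms(1-3), of "-1" k] assms(4,5) by simp

lemma monom_at_exchange:
  assumes "\<And>k. k \<in> E \<Longrightarrow> lookup a k = lookup c k" "\<And>k. k \<notin> E \<Longrightarrow> y k = indet k"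
  shows "monom_at y a * monom_at indet c = monom_at y c * monom_at indet a"
proof -
  let ?S = "keys a \<union> keys c"
  have m: "monom_at z a = (\<Prod>k\<in>?S. z k ^ lookup a k)" "monom_at z c = (\<Prod>k\<in>?S. z k ^ lookup c k)" for z
    by (rule monom_at_superset; simp)+
  have "y k ^ lookup a k * indet k ^ lookup c k = y k ^ lookup c k * indet k ^ lookup a k" for k
    using assms[of k] by (cases "k \<in> E") (simp_all add: mult.commute)
  then show ?thesis unfolding m prod.distrib[symmetric] by simp
qed

text \<open>The exponents say that \<open>A\<close> is \<open>indet i\<close> times a Laurent
  polynomial in the variables outside \<open>E\<close>, which \<open>y\<close> leaves alone; so only
  the factor \<open>indet i\<close> changes.\<close>

lemma place_scale:
  assumes "A * monom_at indet m = to_fract N" "A \<in> place_dom y"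
    and a: "\<And>a k. a \<in> keys N \<Longrightarrow> k \<in> E \<Longrightarrow> lookup a k = lookup m k + (if k = i then 1 else 0)"
    and y: "\<And>k. k \<notin> E \<Longrightarrow> y k = indet k" "\<And>k. y k \<noteq> 0"
  shows "place y A * indet i = y i * A"
proof -
  let ?m = "m + single i 1"
  have "monom_at y a * monom_at indet ?m = monom_at y ?m * monom_at indet a" if "a \<in> keys N" for a
    by (rule monom_at_exchange[of E]) (auto simp: a[OF that] y lookup_add lookup_single when_def)
  then have h1: "evalp y N * monom_at indet ?m = monom_at y ?m * evalp indet N"
    unfolding evalp_def sum_distrib_left sum_distrib_right by (intro sum.cong) (auto simp: ac_simps)
  have h2: "place y A * monom_at y m = evalp y N"
    using arg_cong[OF assms(1), of "place y"] assms(2) by (simp add: monom_at_indet place_hom)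
  have "(place y A * indet i) * (monom_at y m * monom_at indet m) = (place y A * monom_at y m) * monom_at indet ?m"
    by (simp add: ac_simps)
  also have "\<dots> = monom_at y ?m * (A * monom_at indet m)" unfolding h2 h1 assms(1) by simp
  also have "\<dots> = (y i * A) * (monom_at y m * monom_at indet m)" by (simp add: ac_simps)
  finally have "(place y A * indet i) * (monom_at y m * monom_at indet m) = (y i * A) * (monom_at y m * monom_at indet m)" .
  then show ?thesis using monom_at_nonzero[of y m, OF y(2)] monom_at_nonzero[of indet m] by simp
qed

lemma valuation_exchange_var:
  assumes "\<And>k. x k \<in> subfree" "finite V"
  shows "valuation s k (exchange_var V b x i) = min (\<Sum>j\<in>V. int (nat (b j i)) * valuation s k (x j))
    (\<Sum>j\<in>V. int (nat (- b j i)) * valuation s k (x j)) - valuation s k (x i)"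
proof -
  have subfree: "(\<Prod>j\<in>V. x j ^ e j) \<in> subfree" for e by (intro subfree_prod subfree_power assms)
  have v: "valuation s k (\<Prod>j\<in>V. x j ^ e j) = (\<Sum>j\<in>V. int (e j) * valuation s k (x j))" for e
    using subfree_nonzero[OF assms(1)] by (simp add: valuation_prod valuation_power)
  show ?thesis
    unfolding exchange_var_def
    by (simp add: valuation_divide subfree_nonzero subfree_add subfree assms(1) valuation_subfree_add v)
qed

lemma valuation_frozen_free:
  assumes "finite V" "E \<subseteq> V" "set is \<subseteq> E" "j \<in> E"
    and "\<And>k. x k \<in> subfree" "\<And>k. t k \<in> subfree"
    and "\<And>j. j \<in> E \<Longrightarrow> valuation s k (x j) = valuation s k (t j)" "\<And>j. j \<in> V - E \<Longrightarrow> valuation s k (x j) = 0"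
  shows "valuation s k (snd (mseed_path V is (b, x)) j) = valuation s k (snd (mseed_path E is (b, t)) j)"
  using assms(3,5-)
proof (induction "is" arbitrary: b x t)
  case Nil
  then show ?case using assms(4) by simp
next
  case (Cons i "is")
  have i: "i \<in> E" "finite E" using Cons.prems(1) assms(1,2) finite_subset by auto
  have *: "(\<Sum>j\<in>V. e j * valuation s k (x j)) = (\<Sum>j\<in>E. e j * valuation s k (t j))" for e :: "nat \<Rightarrow> int"
  proof -
    have "(\<Sum>j\<in>V. e j * valuation s k (x j)) = (\<Sum>j\<in>E. e j * valuation s k (x j))"
      by (rule sum.mono_neutral_right) (use assms(1,2) Cons.prems(5) in auto)
    then show ?thesis using Cons.prems(4) by simp
  qed
  have m: "valuation s k (exchange_var V b x i) = valuation s k (exchange_var E b t i)"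
    unfolding valuation_exchange_var[OF Cons.prems(2) assms(1)] valuation_exchange_var[OF Cons.prems(3) i(2)] *
    using Cons.prems(4)[OF i(1)] by simp
  show ?case
    unfolding mseed_path_simps mseed_mut_def fst_conv snd_conv
    by (rule Cons.IH) (use Cons.prems i m exchange_var_subfree in auto)
qed

lemma valuation_cluster_var_exchangeable:
  assumes "finite V" "E \<subseteq> V" "set is \<subseteq> E" "j \<in> E" "k \<notin> V - E"
  shows "valuation s k (cluster_var V b is j) = valuation s k (cluster_var E b is j)"
  unfolding cluster_var_def
  by (rule valuation_frozen_free[OF assms(1-4)]) (use assms(5) in \<open>auto simp: subfree_indet valuation_indet\<close>)

text \<open>By induction only \<open>indet k\<close> itself has nonzero order along
  \<open>k\<close>, and it occurs in at most one of the two monomials, so the minimum in the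
  recursion is 0.\<close>

lemma valuation_cluster_var_frozen:
  assumes "finite V" "E \<subseteq> V" "set is \<subseteq> E" "k \<in> V - E"
  shows "valuation 1 k (cluster_var V b is j) = (if j = k then 1 else 0)"
  using assms(3)
proof (induction "is" arbitrary: j rule: rev_induct)
  case (snoc i "is")
  let ?b = "matrix_path is b" and ?x = "cluster_var V b is"
  have x: "valuation 1 k (?x j) = (if j = k then 1 else 0)" for j using snoc by simp
  have "i \<noteq> k" using snoc.prems assms(4) by auto
  have s: "(\<Sum>j\<in>V. e j * valuation 1 k (?x j)) = e k" for e :: "nat \<Rightarrow> int"
    using assms(1,4) by (simp add: x if_distrib[of "(*) _"] sum.delta cong: if_cong)
  have "valuation 1 k (exchange_var V ?b ?x i) = 0"
    using \<open>i \<noteq> k\<close> x[of i] s[of "\<lambda>j. int (nat (?b j i))"] s[of "\<lambda>j. int (nat (- ?b j i))"]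
    unfolding valuation_exchange_var[OF cluster_var_subfree assms(1)] by simp
  then show ?case using \<open>i \<noteq> k\<close> by (simp add: cluster_var_snoc x)
qed (simp add: valuation_indet)

definition forget :: "nat set \<Rightarrow> nat \<Rightarrow> ratfun" where
  "forget F k = (if k \<in> F then 1 else indet k)"

lemma forget_subfree: "forget F k \<in> subfree"
  by (simp add: forget_def subfree_indet)

lemma place_forget_cluster_var:
  assumes "finite V" "E \<subseteq> V" "set is \<subseteq> E" "k \<notin> V - E"
  shows "place (forget (V - E)) (cluster_var V b is k) = cluster_var E b is k"
proof -
  have "place (forget (V - E)) (cluster_var V b is k) = snd (mseed_path V is (b, forget (V - E))) k"
    by (rule place_cluster_var) (rule forget_subfree)
  also have "\<dots> = cluster_var E b is k" unfolding cluster_var_def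
    by (rule mseed_path_specialize[OF assms(1,2) _ assms(3)]) (use assms in \<open>auto simp: forget_def\<close>)
  finally show ?thesis .
qed

text \<open>Every cluster variable is a Laurent polynomial, and its order and degree in each \<open>X\<^sub>k\<close> can be read off
  from the exchange relations without cancellation. If forgetting the frozen variables yields \<open>X\<^sub>j\<close>,
  this leaves \<open>X\<^sub>j\<close> times a Laurent polynomial in the frozen variables; it is a polynomial not divisible by any frozen
  variable and, by symmetry, so is its inverse.\<close>

theorem cluster_determined:
  assumes skew: "skew E b" and V: "finite V" "E \<subseteq> V" "set is \<subseteq> E"
    and \<pi>: "\<pi> ` E \<subseteq> E" "\<And>j. j \<in> E \<Longrightarrow> cluster_var E b is (\<pi> j) = indet j"
    and j: "j \<in> E"
  shows "cluster_var V b is (\<pi> j) = indet j"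
proof -
  define A where "A = cluster_var V b is (\<pi> j)"
  define b' where "b' = matrix_path is b"
  define B where "B = cluster_var V b' (rev is) j"
  have \<pi>j: "\<pi> j \<in> E" using \<pi>(1) j by auto
  have skew': "skew E b'" unfolding b'_def by (rule skew_matrix_path[OF skew V(3)])
  have V': "set (rev is) \<subseteq> E" using V(3) by simp
  have AB: "A \<in> laurent" "B \<in> laurent" "A \<noteq> 0" "B \<noteq> 0"
    unfolding A_def B_def
    by (intro Laurent_phenomenon[OF skew V] Laurent_phenomenon[OF skew' V(1,2) V'] subfree_nonzero cluster_var_subfree)+
  \<comment> \<open>Without frozen variables both sides take the value \<open>indet j\<close> under
    the substitution by the cluster along \<open>is\<close>, which is injective.\<close>
  have t: "cluster_var E b' (rev is) j = indet (\<pi> j)"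
  proof -
    have "place (cluster_var E b is) (cluster_var E b' (rev is) j) = place (cluster_var E b is) (indet (\<pi> j))"
      using cluster_var_rev(1)[OF skew V(3), of E j] \<pi>(2)[OF j] by (simp add: b'_def)
    then show ?thesis
      using basis_bij[OF basis_cluster_var[OF skew V(3), of E]] by (metis bij_pointE)
  qed
  have vA: "valuation s k A = (if j = k then s else 0)" if "k \<notin> V - E" for s k
    unfolding A_def valuation_cluster_var_exchangeable[OF V \<pi>j that] \<pi>(2)[OF j] by (rule valuation_indet)
  have vB: "valuation s k B = (if \<pi> j = k then s else 0)" if "k \<notin> V - E" for s k
    unfolding B_def valuation_cluster_var_exchangeable[OF V(1,2) V' j that] t by (rule valuation_indet)
  have fA: "valuation 1 k A = 0" and fB: "valuation 1 k B = 0" if "k \<in> V - E" for k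
    unfolding A_def B_def valuation_cluster_var_frozen[OF V that] valuation_cluster_var_frozen[OF V(1,2) V' that]
    using that j \<pi>j by auto
  have AB': "indet j * indet (\<pi> j) = A * B"
  proof -
    obtain m N where N: "B * monom_at indet m = to_fract N" using laurent_fraction[OF AB(2)] by blast
    have "place (cluster_var V b is) B * indet (\<pi> j) = cluster_var V b is (\<pi> j) * B"
    proof (rule place_scale[OF N])
      show "B \<in> place_dom (cluster_var V b is)" using basis_dom[OF basis_cluster_var[OF skew V(3)]] by simp
      show "lookup a k = lookup m k + (if k = \<pi> j then 1 else 0)" if "a \<in> keys N" "k \<in> E" for a k
        using laurent_exponents[OF N AB(4) that(1), of k "if k = \<pi> j then 1 else 0"] that(2) vB[of k 1] vB[of k "-1"]
        by (auto split: if_splits)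
      show "cluster_var V b is k = indet k" if "k \<notin> E" for k
        using that V(3) by (intro cluster_var_outside) auto
    qed (intro subfree_nonzero cluster_var_subfree)
    moreover have "place (cluster_var V b is) B = indet j"
      unfolding B_def b'_def by (rule cluster_var_rev(1)[OF skew V(3)])
    ultimately show ?thesis by (simp add: A_def)
  qed
  \<comment> \<open>Order 0 makes the degrees of \<open>A\<close> and \<open>B\<close> in
    \<open>indet k\<close> nonnegative, and by \<open>AB'\<close> they add up to 0.\<close>
  have fA': "valuation (- 1) k A = 0" if k: "k \<in> V - E" for k
  proof -
    have "valuation (- 1) k (indet j * indet (\<pi> j)) = 0" using k j \<pi>j by (auto simp: valuation_mult valuation_indet)
    then have "valuation (- 1) k A + valuation (- 1) k B = 0" unfolding AB' using AB by (simp add: valuation_mult)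
    moreover have "valuation (- 1) k A \<le> 0" using laurent_valuation_sum[OF AB(1,3), of k] fA[OF k] by simp
    moreover have "valuation (- 1) k B \<le> 0" using laurent_valuation_sum[OF AB(2,4), of k] fB[OF k] by simp
    ultimately show ?thesis by simp
  qed
  obtain m N where N: "A * monom_at indet m = to_fract N" using laurent_fraction[OF AB(1)] by blast
  have "N \<noteq> 0" using N AB(3) monom_at_nonzero[of indet m] by auto
  have keys: "a = m + single j 1" if a: "a \<in> keys N" for a
  proof (rule poly_mapping_eqI)
    fix k
    have "valuation 1 k A = (if j = k then 1 else 0)" "valuation (- 1) k A = - (if j = k then 1 else 0)"
      using vA[of k 1] vA[of k "-1"] fA[of k] fA'[of k] j by (cases "k \<in> V - E"; auto)+
    then show "lookup a k = lookup (m + single j 1) k"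
      using laurent_exponents[OF N AB(3) a, of k "if j = k then 1 else 0"]
      by (auto simp: lookup_add lookup_single when_def split: if_splits)
  qed
  define c where "c = lookup N (m + single j 1)"
  have "N = single (m + single j 1) c"
    by (rule poly_mapping_eqI) (use keys in \<open>auto simp: c_def lookup_single when_def in_keys_iff\<close>)
  then have "to_fract N = const c * indet j * monom_at indet m"
    by (simp add: evalp_single mult.commute mult.left_commute flip: evalp_indet)
  with N monom_at_nonzero[of indet m] have A: "A = const c * indet j" by simp
  have "place (forget (V - E)) A = indet j"
    unfolding A_def using place_forget_cluster_var[OF V, of "\<pi> j"] \<pi>j \<pi>(2)[OF j] by simp
  moreover have "place (forget (V - E)) A = const c * indet j"
    unfolding A using j by (simp add: place_hom forget_def)
  ultimately have "const c = 1" by simp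
  then show ?thesis using A by (simp add: A_def)
qed

section \<open>Seed isomorphisms\<close>

lemma place_place_basis:
  assumes "basis x" "basis y"
  shows "place x (place y A) = place (\<lambda>k. place x (y k)) A"
proof -
  obtain p q where A: "A = to_fract p / to_fract q" "q \<noteq> 0" by (rule ratfun_quotient)
  have evalp: "place x (evalp y r) = evalp (\<lambda>k. place x (y k)) r" for r
    using place_evalp[of y x r] by (simp add: basis_dom[OF assms(1)])
  have "evalp y q \<noteq> 0"
    using basis_hom(4)[OF assms(2), of "to_fract q"] A(2) by simp
  then have "evalp (\<lambda>k. place x (y k)) q \<noteq> 0"
    unfolding evalp[symmetric] by (simp add: basis_hom(4)[OF assms(1)])
  then show ?thesis
    using \<open>evalp y q \<noteq> 0\<close> by (simp add: A place_eq basis_hom(5)[OF assms(1)] evalp)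
qed

text \<open>The sign may vary with the column. This weaker relation is stable under mutation without any
  connectedness assumption, since by skew-symmetry the signs of two adjacent columns agree.\<close>

definition equal_up_to_signs :: "nat set \<Rightarrow> nat set \<Rightarrow> (nat \<Rightarrow> nat \<Rightarrow> int) \<Rightarrow> (nat \<Rightarrow> nat \<Rightarrow> int) \<Rightarrow> (nat \<Rightarrow> nat) \<Rightarrow> bool" where
  "equal_up_to_signs V E b b' \<pi> \<longleftrightarrow> (\<forall>i\<in>E. (\<forall>j\<in>V. b' (\<pi> j) (\<pi> i) = b j i) \<or> (\<forall>j\<in>V. b' (\<pi> j) (\<pi> i) = - b j i))"

lemma relE:
  assumes "equal_up_to_signs V E b b' \<pi>" "i \<in> E"
  obtains e where "e = 1 \<or> e = - 1" "\<And>j. j \<in> V \<Longrightarrow> b' (\<pi> j) (\<pi> i) = e * b j i"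
proof -
  from assms consider "\<forall>j\<in>V. b' (\<pi> j) (\<pi> i) = b j i" | "\<forall>j\<in>V. b' (\<pi> j) (\<pi> i) = - b j i"
    unfolding equal_up_to_signs_def by blast
  then show thesis
  proof cases
    case 1 then show thesis by (intro that[of 1]) auto
  next
    case 2 then show thesis by (intro that[of "-1"]) auto
  qed
qed

lemma relI:
  assumes "\<And>i. i \<in> E \<Longrightarrow> \<exists>e. (e = 1 \<or> e = - 1) \<and> (\<forall>j\<in>V. b' (\<pi> j) (\<pi> i) = e * b j i)"
  shows "equal_up_to_signs V E b b' \<pi>"
  unfolding equal_up_to_signs_def
proof
  fix i assume "i \<in> E"
  then obtain e where "e = 1 \<or> e = - 1" "\<forall>j\<in>V. b' (\<pi> j) (\<pi> i) = e * b j i" using assms by blast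
  then show "(\<forall>j\<in>V. b' (\<pi> j) (\<pi> i) = b j i) \<or> (\<forall>j\<in>V. b' (\<pi> j) (\<pi> i) = - b j i)" by auto
qed

lemma max_0_sign: "e = 1 \<or> e = - 1 \<Longrightarrow>
  max 0 (e * x) * max 0 (e * y) - max 0 (- (e * x)) * max 0 (- (e * y)) =
  e * (max 0 x * max 0 y - max 0 (- x) * max 0 (- y))" for x y e :: int
  by auto

lemma equal_up_to_signs_matrix_mut:
  assumes equal_up_to_signs: "equal_up_to_signs V E b b' \<pi>" and skew: "skew E b" "skew E b'"
    and i: "i \<in> E" "\<pi> ` E \<subseteq> E" "inj \<pi>" "E \<subseteq> V"
  shows "equal_up_to_signs V E (matrix_mut i b) (matrix_mut (\<pi> i) b') \<pi>"
proof (rule relI)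
  fix k assume k: "k \<in> E"
  obtain e where e: "e = 1 \<or> e = - 1" "\<And>j. j \<in> V \<Longrightarrow> b' (\<pi> j) (\<pi> i) = e * b j i"
    using relE[OF equal_up_to_signs i(1)] by blast
  obtain f where f: "f = 1 \<or> f = - 1" "\<And>j. j \<in> V \<Longrightarrow> b' (\<pi> j) (\<pi> k) = f * b j k"
    using relE[OF equal_up_to_signs k] by blast
  have kV: "k \<in> V" "i \<in> V" and \<pi>E: "\<pi> k \<in> E" "\<pi> i \<in> E" using i k by auto
  have 1: "e * b k i = b' (\<pi> k) (\<pi> i)" and 2: "f * b i k = b' (\<pi> i) (\<pi> k)"
    using e(2)[OF kV(1)] f(2)[OF kV(2)] by simp_all
  have 3: "b' (\<pi> k) (\<pi> i) = - b' (\<pi> i) (\<pi> k)" by (rule skewD[OF skew(2) \<pi>E])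
  have 4: "b k i = - b i k" by (rule skewD[OF skew(1) k i(1)])
  have "e * b i k = - (e * b k i)" unfolding 4 by simp
  also have "\<dots> = f * b i k" unfolding 1 3 2 by simp
  finally have ef: "e * b i k = f * b i k" .
  have "matrix_mut (\<pi> i) b' (\<pi> j) (\<pi> k) = f * matrix_mut i b j k" if j: "j \<in> V" for j
  proof (cases "j = i \<or> k = i")
    case True
    then show ?thesis using f(2)[OF j] unfolding matrix_mut_def by fastforce
  next
    case False
    then have ne: "\<not> (\<pi> j = \<pi> i \<or> \<pi> k = \<pi> i)" using i(3) by (simp add: inj_eq)
    have eqs: "b' (\<pi> j) (\<pi> k) = f * b j k" "b' (\<pi> i) (\<pi> k) = f * b i k" "b' (\<pi> j) (\<pi> i) = e * b j i"
      using e(2)[OF j] f(2)[OF j] f(2)[OF kV(2)] by simp_all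
    have max: "max 0 (e * b j i) * max 0 (f * b i k) - max 0 (- (e * b j i)) * max 0 (- (f * b i k)) =
        f * (max 0 (b j i) * max 0 (b i k) - max 0 (- b j i) * max 0 (- b i k))"
    proof (cases "b i k = 0")
      case False
      with ef have "e = f" by simp
      show ?thesis unfolding \<open>e = f\<close> by (rule max_0_sign[OF f(1)])
    qed simp
    show ?thesis
      unfolding matrix_mut_def if_not_P[OF ne] if_not_P[OF False] eqs max by (simp only: distrib_left)
  qed
  with f(1) show "\<exists>e. (e = 1 \<or> e = - 1) \<and> (\<forall>j\<in>V. matrix_mut (\<pi> i) b' (\<pi> j) (\<pi> k) = e * matrix_mut i b j k)"
    by (intro exI[of _ f]) simp
qed

lemma equal_up_to_signs_matrix_path:
  assumes "equal_up_to_signs V E b b' \<pi>" "skew E b" "skew E b'" "set q \<subseteq> E" "\<pi> ` E \<subseteq> E" "inj \<pi>" "E \<subseteq> V"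
  shows "equal_up_to_signs V E (matrix_path q b) (matrix_path (map \<pi> q) b') \<pi>"
  using assms(1-4)
proof (induction q arbitrary: b b')
  case (Cons i q)
  have i: "i \<in> E" "\<pi> i \<in> E" using Cons.prems(4) assms(5) by auto
  show ?case unfolding list.map matrix_path_simps
    by (rule Cons.IH[OF equal_up_to_signs_matrix_mut[OF Cons.prems(1-3) i(1) assms(5-7)]
          skew_matrix_mut[OF Cons.prems(2) i(1)] skew_matrix_mut[OF Cons.prems(3) i(2)]])
       (use Cons.prems(4) in simp)
qed simp

text \<open>The sign of a column only decides which of the two monomials comes first.\<close>

lemma exchange_var_equal_up_to_signs:
  assumes "equal_up_to_signs V E b b' \<pi>" "i \<in> E" "inj \<pi>" "\<pi> ` V = V"
  shows "exchange_var V b' x (\<pi> i) = exchange_var V b (\<lambda>k. x (\<pi> k)) i"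
proof -
  have P: "(\<Prod>j\<in>V. x j ^ e j) = (\<Prod>j\<in>V. x (\<pi> j) ^ e (\<pi> j))" for e
    using prod.reindex[of \<pi> V "\<lambda>j. x j ^ e j"] assms(3,4) by (simp add: inj_on_def inj_def)
  from assms(1,2) consider "\<And>j. j \<in> V \<Longrightarrow> b' (\<pi> j) (\<pi> i) = b j i" | "\<And>j. j \<in> V \<Longrightarrow> b' (\<pi> j) (\<pi> i) = - b j i"
    unfolding equal_up_to_signs_def by blast
  then show ?thesis
    by cases (simp_all add: exchange_var_def P[of "\<lambda>j. nat (b' j (\<pi> i))"] P[of "\<lambda>j. nat (- b' j (\<pi> i))"] add.commute)
qed

lemma mseed_path_equal_up_to_signs:
  assumes "equal_up_to_signs V E b b' \<pi>" "skew E b" "skew E b'" "set q \<subseteq> E" "\<pi> ` E \<subseteq> E" "inj \<pi>" "E \<subseteq> V" "\<pi> ` V = V"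
  shows "snd (mseed_path V (map \<pi> q) (b', x)) (\<pi> k) = snd (mseed_path V q (b, \<lambda>k. x (\<pi> k))) k"
  using assms(1-4)
proof (induction q arbitrary: b b' x)
  case (Cons i q)
  have i: "i \<in> E" "\<pi> i \<in> E" using Cons.prems(4) assms(5) by auto
  have "(\<lambda>k. (x(\<pi> i := exchange_var V b' x (\<pi> i))) (\<pi> k)) = (\<lambda>k. x (\<pi> k))(i := exchange_var V b (\<lambda>k. x (\<pi> k)) i)"
    using exchange_var_equal_up_to_signs[OF Cons.prems(1) i(1) assms(6,8), of x] assms(6) by (auto simp: inj_eq)
  moreover have "snd (mseed_path V (map \<pi> q) (matrix_mut (\<pi> i) b', x(\<pi> i := exchange_var V b' x (\<pi> i)))) (\<pi> k) =
      snd (mseed_path V q (matrix_mut i b, \<lambda>k. (x(\<pi> i := exchange_var V b' x (\<pi> i))) (\<pi> k))) k"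
    using Cons.prems i by (intro Cons.IH equal_up_to_signs_matrix_mut skew_matrix_mut assms) auto
  ultimately show ?case by (simp add: mseed_mut_def)
qed simp

lemma equal_up_to_signs_trans:
  assumes "equal_up_to_signs V E b b' \<pi>" "equal_up_to_signs V E b' b'' \<rho>" "\<pi> ` E \<subseteq> E" "\<pi> ` V \<subseteq> V"
  shows "equal_up_to_signs V E b b'' (\<lambda>k. \<rho> (\<pi> k))"
proof (rule relI)
  fix i assume i: "i \<in> E"
  obtain e where e: "e = 1 \<or> e = - 1" "\<And>j. j \<in> V \<Longrightarrow> b' (\<pi> j) (\<pi> i) = e * b j i"
    using relE[OF assms(1) i] by blast
  obtain f where f: "f = 1 \<or> f = - 1" "\<And>j. j \<in> V \<Longrightarrow> b'' (\<rho> j) (\<rho> (\<pi> i)) = f * b' j (\<pi> i)"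
    using relE[OF assms(2), of "\<pi> i"] i assms(3) by blast
  show "\<exists>e. (e = 1 \<or> e = - 1) \<and> (\<forall>j\<in>V. b'' (\<rho> (\<pi> j)) (\<rho> (\<pi> i)) = e * b j i)"
    using e f assms(4) by (intro exI[of _ "e * f"]) auto
qed

lemma equal_up_to_signs_sym:
  assumes "equal_up_to_signs V E b b' \<pi>" "bij \<pi>" "\<pi> ` E = E" "\<pi> ` V = V"
  shows "equal_up_to_signs V E b' b (inv_into UNIV \<pi>)"
proof (rule relI)
  fix i assume i: "i \<in> E"
  define \<rho> where "\<rho> = inv_into UNIV \<pi>"
  have \<rho>: "\<pi> (\<rho> k) = k" for k using assms(2) by (simp add: \<rho>_def bij_is_surj surj_f_inv_f)
  have \<rho>': "\<rho> (\<pi> k) = k" for k using assms(2) by (simp add: \<rho>_def bij_is_inj)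
  have mem: "\<rho> i \<in> E" "\<And>j. j \<in> V \<Longrightarrow> \<rho> j \<in> V" using assms(3,4) i \<rho>' by (metis imageE)+
  obtain e where e: "e = 1 \<or> e = - 1" "\<And>j. j \<in> V \<Longrightarrow> b' (\<pi> j) (\<pi> (\<rho> i)) = e * b j (\<rho> i)"
    using relE[OF assms(1) mem(1)] by blast
  have "b (\<rho> j) (\<rho> i) = e * b' j i" if "j \<in> V" for j
    using e(2)[OF mem(2)[OF that]] e(1) by (auto simp: \<rho>)
  with e(1) show "\<exists>e. (e = 1 \<or> e = - 1) \<and> (\<forall>j\<in>V. b (inv_into UNIV \<pi> j) (inv_into UNIV \<pi> i) = e * b' j i)"
    unfolding \<rho>_def[symmetric] by blast
qed

section \<open>Isomorphisms of the initial seed with other seeds, and the field automorphisms they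
  induce\<close>

locale matrix_seed =
  fixes V E :: "nat set" and b :: "nat \<Rightarrow> nat \<Rightarrow> int"
  assumes finite_V: "finite V" and E_V: "E \<subseteq> V" and skew: "skew E b"
begin

abbreviation x where "x \<equiv> cluster_var V b"

text \<open>Identity outside \<open>V\<close> makes \<open>\<pi>\<close> a permutation of all
  natural numbers, so that the relabelled cluster is again a \<open>basis\<close> and the induced
  substitution an automorphism of the whole field.\<close>

definition seed_iso :: "nat list \<Rightarrow> (nat \<Rightarrow> nat) \<Rightarrow> bool" where
  "seed_iso p \<pi> \<longleftrightarrow> set p \<subseteq> E \<and> bij \<pi> \<and> \<pi> ` E = E \<and> (\<forall>k. k \<notin> V \<longrightarrow> \<pi> k = k) \<and> equal_up_to_signs V E b (matrix_path p b) \<pi>"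

definition field_auto :: "nat list \<Rightarrow> (nat \<Rightarrow> nat) \<Rightarrow> ratfun \<Rightarrow> ratfun" where
  "field_auto p \<pi> = place (\<lambda>k. x p (\<pi> k))"

lemma basis_x: "set p \<subseteq> E \<Longrightarrow> basis (x p)"
  by (rule basis_cluster_var[OF skew])

lemma seed_isoD:
  assumes "seed_iso p \<pi>"
  shows "set p \<subseteq> E" "bij \<pi>" "inj \<pi>" "\<pi> ` E = E" "\<pi> ` V = V" "equal_up_to_signs V E b (matrix_path p b) \<pi>"
    "basis (\<lambda>k. x p (\<pi> k))" "\<And>k. k \<notin> V \<Longrightarrow> \<pi> k = k"
proof -
  show 1: "set p \<subseteq> E" "bij \<pi>" "\<pi> ` E = E" "equal_up_to_signs V E b (matrix_path p b) \<pi>" "\<And>k. k \<notin> V \<Longrightarrow> \<pi> k = k"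
    using assms by (auto simp: seed_iso_def)
  show inj: "inj \<pi>" by (rule bij_is_inj[OF 1(2)])
  show "\<pi> ` V = V"
  proof (intro equalityI subsetI)
    fix k assume "k \<in> \<pi> ` V"
    then obtain j where j: "k = \<pi> j" "j \<in> V" by blast
    show "k \<in> V"
    proof (rule ccontr)
      assume "k \<notin> V"
      then have "\<pi> k = \<pi> j" using 1(5) j(1) by simp
      then show False using injD[OF inj] j(2) \<open>k \<notin> V\<close> by blast
    qed
  next
    fix k assume k: "k \<in> V"
    obtain j where j: "k = \<pi> j" using surjD[OF bij_is_surj[OF 1(2)]] by blast
    then show "k \<in> \<pi> ` V" using 1(5)[of j] k by (cases "j \<in> V") auto
  qed
  show "basis (\<lambda>k. x p (\<pi> k))" by (rule basis_perm[OF basis_x[OF 1(1)] 1(2)])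
qed

text \<open>Both seeds have the same exchange relations up to relabelling, so the automorphism
  carries a path \<open>q\<close> from the initial seed to the path \<open>map \<pi> q\<close> from
  the seed after \<open>p\<close>.\<close>

lemma field_auto_x:
  assumes "seed_iso p \<pi>" "set q \<subseteq> E"
  shows "field_auto p \<pi> (x q k) = x (p @ map \<pi> q) (\<pi> k)"
proof -
  note d = seed_isoD[OF assms(1)]
  have "field_auto p \<pi> (x q k) = snd (mseed_path V q (b, \<lambda>k. x p (\<pi> k))) k"
    unfolding field_auto_def by (rule place_cluster_var) simp
  also have "\<dots> = snd (mseed_path V (map \<pi> q) (matrix_path p b, x p)) (\<pi> k)"
    using d skew_matrix_path[OF skew d(1)] E_V assms(2)
    by (intro mseed_path_equal_up_to_signs[symmetric, of _ E] skew) auto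
  also have "\<dots> = x (p @ map \<pi> q) (\<pi> k)" unfolding cluster_var_append by (rule place_cluster_var[symmetric]) simp
  finally show ?thesis .
qed

lemma field_auto_indet: "field_auto p \<pi> (indet k) = x p (\<pi> k)"
  by (simp add: field_auto_def)

lemma seed_iso_Nil: "seed_iso [] (\<lambda>k. k)"
  unfolding seed_iso_def by (simp add: equal_up_to_signs_def bij_id[unfolded id_def])

lemma field_auto_Nil: "field_auto [] (\<lambda>k. k) A = A"
  by (simp add: field_auto_def)

text \<open>The path \<open>q\<close> has to be relabelled by \<open>\<pi>\<close>, since it is now
  followed from the seed after \<open>p\<close>.\<close>

lemma seed_iso_compose:
  assumes "seed_iso p \<pi>" "seed_iso q \<rho>"
  shows "seed_iso (p @ map \<pi> q) (\<lambda>k. \<pi> (\<rho> k))"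
    and "field_auto (p @ map \<pi> q) (\<lambda>k. \<pi> (\<rho> k)) A = field_auto p \<pi> (field_auto q \<rho> A)"
proof -
  note d = seed_isoD[OF assms(1)] and d' = seed_isoD[OF assms(2)]
  have "equal_up_to_signs V E (matrix_path q b) (matrix_path (map \<pi> q) (matrix_path p b)) \<pi>"
    using d d' skew_matrix_path[OF skew d(1)] E_V by (intro equal_up_to_signs_matrix_path skew) auto
  then have "equal_up_to_signs V E b (matrix_path (p @ map \<pi> q) b) (\<lambda>k. \<pi> (\<rho> k))"
    using equal_up_to_signs_trans[OF d'(6)] d'(4,5) by simp
  moreover have "bij (\<lambda>k. \<pi> (\<rho> k))" using bij_comp[OF d'(2) d(2)] by (simp add: comp_def)
  moreover have "(\<lambda>k. \<pi> (\<rho> k)) ` E = E" using d(4) d'(4) by (metis image_image)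
  moreover have "set (p @ map \<pi> q) \<subseteq> E" using d(1) image_mono[OF d'(1), of \<pi>] unfolding d(4) by simp
  ultimately show "seed_iso (p @ map \<pi> q) (\<lambda>k. \<pi> (\<rho> k))"
    unfolding seed_iso_def by (simp add: d(8) d'(8))
  show "field_auto (p @ map \<pi> q) (\<lambda>k. \<pi> (\<rho> k)) A = field_auto p \<pi> (field_auto q \<rho> A)"
    using place_place_basis[OF d(7) d'(7), of A] field_auto_x[OF assms(1) d'(1)]
    unfolding field_auto_def by simp
qed

lemma x_cancel:
  assumes "set p \<subseteq> E" "set q \<subseteq> E"
  shows "x (p @ rev p @ q) = x q"
proof -
  have "mseed_path V (rev p) (mseed_path V p (b, indet)) = (b, indet)"
    by (rule mseed_path_rev[OF skew assms(1)]) (rule subfree_indet)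
  then show ?thesis unfolding cluster_var_def mseed_path_simps by simp
qed

lemma seed_iso_inverse:
  assumes "seed_iso p \<pi>"
  obtains q \<rho> where "seed_iso q \<rho>"
    "\<And>A. field_auto p \<pi> (field_auto q \<rho> A) = A" "\<And>A. field_auto q \<rho> (field_auto p \<pi> A) = A"
proof -
  note d = seed_isoD[OF assms]
  define \<rho> where "\<rho> = inv_into UNIV \<pi>"
  \<comment> \<open>Chosen so that \<open>map \<pi> q\<close> is \<open>rev p\<close>, which undoes
    \<open>p\<close>.\<close>
  define q where "q = map \<rho> (rev p)"
  have \<rho>: "\<pi> (\<rho> k) = k" "\<rho> (\<pi> k) = k" for k
    using d(2) by (simp_all add: \<rho>_def bij_is_surj surj_f_inv_f bij_is_inj)
  have \<rho>E: "\<rho> ` E = E" and \<rho>V: "\<rho> ` V = V" using d(4,5) \<rho> by (metis (no_types, lifting) image_cong image_image image_ident)+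
  have q: "set q \<subseteq> E" "map \<pi> q = rev p" using d(1) \<rho>E by (auto simp: q_def \<rho> comp_def)
  have "equal_up_to_signs V E (matrix_path q b) (matrix_path (map \<pi> q) (matrix_path p b)) \<pi>"
    using d q(1) skew_matrix_path[OF skew d(1)] E_V by (intro equal_up_to_signs_matrix_path skew) auto
  then have "equal_up_to_signs V E (matrix_path q b) b \<pi>" by (simp add: q(2) matrix_path_rev)
  then have "equal_up_to_signs V E b (matrix_path q b) \<rho>" unfolding \<rho>_def using equal_up_to_signs_sym d by blast
  moreover have "\<rho> k = k" if "k \<notin> V" for k using d(8)[OF that] \<rho>(2)[of k] by simp
  moreover have "bij \<rho>" unfolding \<rho>_def by (rule bij_imp_bij_inv[OF d(2)])
  ultimately have iso: "seed_iso q \<rho>" using q \<rho>E by (simp add: seed_iso_def)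
  have 1: "field_auto p \<pi> (field_auto q \<rho> A) = A" for A
  proof -
    have "field_auto p \<pi> (field_auto q \<rho> A) = place (\<lambda>k. x (p @ rev p @ []) (\<pi> (\<rho> k))) A"
      unfolding seed_iso_compose(2)[OF assms iso, symmetric] by (simp add: field_auto_def q(2))
    also have "\<dots> = A" unfolding x_cancel[OF d(1) empty_subsetI[of E, folded list.set(1)]] by (simp add: \<rho>)
    finally show ?thesis .
  qed
  have "inj (field_auto p \<pi>)" using basis_bij[OF d(7)] by (simp add: field_auto_def bij_is_inj)
  then have "field_auto q \<rho> (field_auto p \<pi> A) = A" for A using 1 by (metis injD)
  with 1 iso that show ?thesis by blast
qed

lemma auto_hom:
  assumes "seed_iso p \<pi>"
  shows "field_auto p \<pi> (A + B) = field_auto p \<pi> A + field_auto p \<pi> B"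
    "field_auto p \<pi> (A * B) = field_auto p \<pi> A * field_auto p \<pi> B"
    "field_auto p \<pi> (- A) = - field_auto p \<pi> A"
    "field_auto p \<pi> (A / B) = field_auto p \<pi> A / field_auto p \<pi> B"
    "field_auto p \<pi> A = 0 \<longleftrightarrow> A = 0"
    "field_auto p \<pi> 1 = 1"
  unfolding field_auto_def using basis_hom[OF seed_isoD(7)[OF assms]] by simp_all

lemma x_inj: "set p \<subseteq> E \<Longrightarrow> x p j = x p k \<longleftrightarrow> j = k"
proof
  assume p: "set p \<subseteq> E" and "x p j = x p k"
  then have "place (x p) (indet j) = place (x p) (indet k)" by simp
  then have "indet j = indet k" by (rule injD[OF bij_is_inj[OF basis_bij[OF basis_x[OF p]]]])
  then show "j = k" using valuation_indet[of 1 k j] valuation_indet[of 1 k k] by (simp split: if_splits)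
qed simp

lemma x_snoc_mult:
  "x (p @ [i]) i * x p i = (\<Prod>j\<in>V. x p j ^ nat (matrix_path p b j i)) + (\<Prod>j\<in>V. x p j ^ nat (- matrix_path p b j i))"
  unfolding cluster_var_snoc using exchange_var_mult[of "x p" i V "matrix_path p b"] subfree_nonzero[OF cluster_var_subfree] by simp

end

section \<open>Cluster algebras of ice quivers\<close>

text \<open>Without 2-cycles the numbers of arrows are the positive and negative parts of the
  entries, which makes the two mutations comparable. Frozen columns are left out:
  \<open>quiver_mut\<close> deletes the arrows between frozen vertices, whereas
  \<open>matrix_mut\<close> need not produce 0 there.\<close>

definition has_matrix :: "quiver \<Rightarrow> (nat \<Rightarrow> nat \<Rightarrow> int) \<Rightarrow> bool" where
  "has_matrix Q b \<longleftrightarrow> (\<forall>j k. arr Q j k = 0 \<or> arr Q k j = 0) \<and>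
     (\<forall>j\<in>verts Q. \<forall>k\<in>exch_verts Q. exch_matrix Q j k = b j k)"

lemma exch_verts_subset: "exch_verts Q \<subseteq> verts Q"
  and verts_Un: "verts Q = exch_verts Q \<union> frozen_verts Q"
  and exch_frozen_disjoint: "exch_verts Q \<inter> frozen_verts Q = {}"
  and finite_verts: "finite (verts Q)"
  by (auto simp: verts_def exch_verts_def frozen_verts_def)

lemma quiver_mut_verts [simp]:
  "verts (quiver_mut i Q) = verts Q" "exch_verts (quiver_mut i Q) = exch_verts Q"
  "frozen_verts (quiver_mut i Q) = frozen_verts Q"
  by (simp_all add: quiver_mut_def Let_def verts_def exch_verts_def frozen_verts_def)

lemma has_matrix_mut:
  assumes "has_matrix Q b" "i \<in> exch_verts Q"
  shows "has_matrix (quiver_mut i Q) (matrix_mut i b)"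
proof -
  have two: "arr Q j k = 0 \<or> arr Q k j = 0" for j k using assms(1) by (simp add: has_matrix_def)
  have loop: "arr Q i i = 0" using two[of i i] by simp
  have i: "i \<in> verts Q" using assms(2) exch_verts_subset by blast
  have b: "b j k = int (arr Q j k) - int (arr Q k j)" if "j \<in> verts Q" "k \<in> exch_verts Q" for j k
    using assms(1) that by (simp add: has_matrix_def exch_matrix_def)
  have pos: "int (arr Q j k) = max 0 (int (arr Q j k) - int (arr Q k j))" for j k
    using two[of j k] by auto
  have pos': "int (arr Q k j) = max 0 (- (int (arr Q j k) - int (arr Q k j)))" for j k
    using two[of j k] by auto
  have "exch_matrix (quiver_mut i Q) j k = matrix_mut i b j k" if jk: "j \<in> verts Q" "k \<in> exch_verts Q" for j k
  proof -
    have nf: "k \<notin> frozen_verts Q" using jk exch_frozen_disjoint by blast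
    show ?thesis
    proof (cases "j = i \<or> k = i")
      case True
      then have "exch_matrix (quiver_mut i Q) j k = int (arr Q k j) - int (arr Q j k)"
        using nf loop by (auto simp: exch_matrix_def quiver_mut_def Let_def)
      with True show ?thesis using b[OF jk] by (simp add: matrix_mut_def)
    next
      case False
      have "exch_matrix (quiver_mut i Q) j k =
          int (arr Q j k + arr Q j i * arr Q i k) - int (arr Q k j + arr Q k i * arr Q i j)"
      proof -
        have "int (m - n) - int (n - m) = int m - int n" for m n by (cases "m \<le> n") auto
        then show ?thesis using nf False by (simp add: exch_matrix_def quiver_mut_def Let_def del: of_nat_add)
      qed
      also have "\<dots> = b j k + (int (arr Q j i) * int (arr Q i k) - int (arr Q i j) * int (arr Q k i))"
        using b[OF jk] by simp
      also have "\<dots> = matrix_mut i b j k"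
      proof -
        have "int (arr Q j i) = max 0 (b j i)" "int (arr Q i j) = max 0 (- b j i)"
          "int (arr Q i k) = max 0 (b i k)" "int (arr Q k i) = max 0 (- b i k)"
          using b[OF jk(1) assms(2)] b[OF i jk(2)] pos[of j i] pos'[of i j] pos[of i k] pos'[of k i]
          by simp_all
        with False show ?thesis by (simp add: matrix_mut_def)
      qed
      finally show ?thesis .
    qed
  qed
  moreover have "arr (quiver_mut i Q) j k = 0 \<or> arr (quiver_mut i Q) k j = 0" for j k
    by (auto simp: quiver_mut_def Let_def)
  ultimately show ?thesis by (simp add: has_matrix_def)
qed

lemma exchanged_var_eq:
  assumes "has_matrix Q b" "i \<in> exch_verts Q"
  shows "exchanged_var i (Q, x) = exchange_var (verts Q) b x i"
proof -
  have b: "exch_matrix Q j i = b j i" if "j \<in> verts Q" for j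
    using assms that by (simp add: has_matrix_def)
  have "(\<Prod>j\<in>{j \<in> verts Q. exch_matrix Q j i > 0}. x j ^ nat (exch_matrix Q j i)) = (\<Prod>j\<in>verts Q. x j ^ nat (b j i))"
  proof (rule prod.mono_neutral_cong_left)
    show "\<forall>j\<in>verts Q - {j \<in> verts Q. exch_matrix Q j i > 0}. x j ^ nat (b j i) = 1"
    proof
      fix j assume "j \<in> verts Q - {j \<in> verts Q. exch_matrix Q j i > 0}"
      then have "nat (b j i) = 0" using b[of j] by auto
      then show "x j ^ nat (b j i) = 1" by simp
    qed
  qed (auto simp: finite_verts b)
  moreover have "(\<Prod>j\<in>{j \<in> verts Q. exch_matrix Q j i < 0}. x j ^ nat (- exch_matrix Q j i)) = (\<Prod>j\<in>verts Q. x j ^ nat (- b j i))"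
  proof (rule prod.mono_neutral_cong_left)
    show "\<forall>j\<in>verts Q - {j \<in> verts Q. exch_matrix Q j i < 0}. x j ^ nat (- b j i) = 1"
    proof
      fix j assume "j \<in> verts Q - {j \<in> verts Q. exch_matrix Q j i < 0}"
      then have "nat (- b j i) = 0" using b[of j] by auto
      then show "x j ^ nat (- b j i) = 1" by simp
    qed
  qed (auto simp: finite_verts b)
  ultimately show ?thesis by (simp add: exchanged_var_def exchange_var_def)
qed

lemma mut_along_mseed_path:
  assumes "has_matrix Q b" "set p \<subseteq> exch_verts Q"
  shows "snd (mut_along p (Q, x)) = snd (mseed_path (verts Q) p (b, x))" "has_matrix (fst (mut_along p (Q, x))) (matrix_path p b)"
    "verts (fst (mut_along p (Q, x))) = verts Q" "exch_verts (fst (mut_along p (Q, x))) = exch_verts Q"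
    "frozen_verts (fst (mut_along p (Q, x))) = frozen_verts Q"
proof -
  have "snd (mut_along p (Q, x)) = snd (mseed_path (verts Q) p (b, x)) \<and> has_matrix (fst (mut_along p (Q, x))) (matrix_path p b) \<and>
    verts (fst (mut_along p (Q, x))) = verts Q \<and> exch_verts (fst (mut_along p (Q, x))) = exch_verts Q \<and>
    frozen_verts (fst (mut_along p (Q, x))) = frozen_verts Q"
    using assms
  proof (induction p arbitrary: Q b x)
    case (Cons i p)
    have i: "i \<in> exch_verts Q" using Cons.prems by simp
    have step: "mut_along (i # p) (Q, x) = mut_along p (quiver_mut i Q, x(i := exchange_var (verts Q) b x i))"
      using exchanged_var_eq[OF Cons.prems(1) i] by (simp add: mut_along_def seed_mut_def)
    show ?case
      unfolding step mseed_path_simps mseed_mut_def fst_conv snd_conv matrix_path_simps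
      using Cons.IH[OF has_matrix_mut[OF Cons.prems(1) i]] Cons.prems(2) by simp
  qed (simp add: mut_along_def)
  then show "snd (mut_along p (Q, x)) = snd (mseed_path (verts Q) p (b, x))" "has_matrix (fst (mut_along p (Q, x))) (matrix_path p b)"
    "verts (fst (mut_along p (Q, x))) = verts Q" "exch_verts (fst (mut_along p (Q, x))) = exch_verts Q"
    "frozen_verts (fst (mut_along p (Q, x))) = frozen_verts Q" by blast+
qed

section \<open>The cluster algebra as a subring of the field\<close>

lemma ring_ratfun: "ring ratfun_ring"
proof (rule ringI)
  show "abelian_group ratfun_ring"
  proof (rule abelian_groupI)
    fix x assume "x \<in> carrier ratfun_ring"
    show "\<exists>y\<in>carrier ratfun_ring. y \<oplus>\<^bsub>ratfun_ring\<^esub> x = \<zero>\<^bsub>ratfun_ring\<^esub>"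
      by (intro bexI[of _ "- x"]) (simp_all add: ratfun_ring_def)
  qed (simp_all add: ratfun_ring_def)
  show "monoid ratfun_ring" by unfold_locales (simp_all add: ratfun_ring_def)
qed (simp_all add: ratfun_ring_def algebra_simps)

lemma ratfun_ring_simps [simp]:
  "carrier ratfun_ring = UNIV" "\<one>\<^bsub>ratfun_ring\<^esub> = 1" "\<zero>\<^bsub>ratfun_ring\<^esub> = 0"
  "a \<oplus>\<^bsub>ratfun_ring\<^esub> c = a + c" "a \<otimes>\<^bsub>ratfun_ring\<^esub> c = a * c"
  by (simp_all add: ratfun_ring_def)

lemma ratfun_ring_a_inv [simp]: "\<ominus>\<^bsub>ratfun_ring\<^esub> a = - a"
  by (rule abelian_group.minus_equality[OF ring.is_abelian_group[OF ring_ratfun]]) simp_all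

lemma const_of_int: "const (of_int n) = of_int n"
proof -
  have "const (of_nat m) = of_nat m" for m by (induction m) simp_all
  then show ?thesis by (cases n) (simp_all flip: of_nat_Suc)
qed

lemma indet_not_int: "indet k \<notin> \<int>"
proof
  assume "indet k \<in> \<int>"
  then obtain n where n: "indet k = of_int n" by (auto elim: Ints_cases)
  then have "const (of_int n) \<noteq> 0" using indet_nonzero[of k] by (simp add: const_of_int del: const_simps)
  then have "(of_int n :: rat) \<noteq> 0" by simp
  then have "valuation 1 k (indet k) = 0" using valuation_const[of "of_int n" 1 k] n by (simp add: const_of_int)
  then show False by (simp add: valuation_indet)
qed

locale quiver_seed =
  fixes Q :: quiver and b :: "nat \<Rightarrow> nat \<Rightarrow> int"
  assumes has_matrix: "has_matrix Q b" and skew_b: "skew (exch_verts Q) b"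

sublocale quiver_seed \<subseteq> matrix_seed "verts Q" "exch_verts Q" b
  by unfold_locales (rule finite_verts exch_verts_subset skew_b)+

context quiver_seed
begin

abbreviation "V \<equiv> verts Q"
abbreviation "E \<equiv> exch_verts Q"
abbreviation "S p \<equiv> mut_along p (initial_seed Q)"
abbreviation "Alg \<equiv> carrier (cluster_algebra Q)"

lemma S_simps:
  assumes "set p \<subseteq> E"
  shows "snd (S p) = x p" "has_matrix (fst (S p)) (matrix_path p b)" "exch_verts (fst (S p)) = E" "verts (fst (S p)) = V"
    "exch_vars (S p) = x p ` E" "frozen_vars (S p) = x p ` frozen_verts Q" "cluster (S p) = x p ` V"
  using mut_along_mseed_path[OF has_matrix assms, of indet]
  by (simp_all add: initial_seed_def exch_vars_def frozen_vars_def cluster_def cluster_var_def verts_Un[of Q] image_Un)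

lemma seeds_eq: "seeds Q = {S p | p. set p \<subseteq> E}"
  by (simp add: seeds_def)

definition cluster_vars :: "ratfun set" where "cluster_vars = {x p k | p k. set p \<subseteq> E \<and> k \<in> V}"

lemma gensI: "set p \<subseteq> E \<Longrightarrow> k \<in> V \<Longrightarrow> x p k \<in> cluster_vars"
  by (auto simp: cluster_vars_def)

lemma Alg_eq: "Alg = generate_ring ratfun_ring cluster_vars"
proof -
  have "(\<Union>s\<in>seeds Q. cluster s) = cluster_vars"
    unfolding seeds_eq cluster_vars_def using S_simps(7) by blast
  then show ?thesis by (simp add: cluster_algebra_def)
qed

lemma Alg_closed:
  "1 \<in> Alg" "A \<in> cluster_vars \<Longrightarrow> A \<in> Alg" "A \<in> Alg \<Longrightarrow> - A \<in> Alg"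
  "A \<in> Alg \<Longrightarrow> B \<in> Alg \<Longrightarrow> A + B \<in> Alg" "A \<in> Alg \<Longrightarrow> B \<in> Alg \<Longrightarrow> A * B \<in> Alg"
  unfolding Alg_eq
  using generate_ring.one[of ratfun_ring cluster_vars] generate_ring.incl[of A cluster_vars ratfun_ring]
    generate_ring.a_inv[of A ratfun_ring cluster_vars] generate_ring.eng_add[of A ratfun_ring cluster_vars B]
    generate_ring.eng_mult[of A ratfun_ring cluster_vars B]
  by simp_all

lemma Alg_0: "0 \<in> Alg"
  using Alg_closed(4)[OF Alg_closed(1) Alg_closed(3)[OF Alg_closed(1)]] by simp

lemma Alg_x: "set p \<subseteq> E \<Longrightarrow> k \<in> V \<Longrightarrow> x p k \<in> Alg"
  by (intro Alg_closed(2) gensI)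

lemma Alg_power: "A \<in> Alg \<Longrightarrow> A ^ n \<in> Alg"
  by (induction n) (simp_all add: Alg_closed(1,5))

lemma Alg_prod: "(\<And>k. k \<in> T \<Longrightarrow> A k \<in> Alg) \<Longrightarrow> (\<Prod>k\<in>T. A k) \<in> Alg"
  by (induction T rule: infinite_finite_induct) (simp_all add: Alg_closed(1,5))

lemma Alg_of_nat: "of_nat n \<in> Alg"
  by (induction n) (simp_all add: Alg_0 Alg_closed(1,4))

lemma Alg_of_int: "of_int n \<in> Alg"
  by (cases n) (auto simp: Alg_of_nat simp del: of_nat_Suc intro: Alg_closed(3))

lemma Alg_induct [consumes 1, case_names one gen minus add mult]:
  assumes "A \<in> Alg" "P 1" "\<And>p k. set p \<subseteq> E \<Longrightarrow> k \<in> V \<Longrightarrow> P (x p k)"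
    "\<And>A. A \<in> Alg \<Longrightarrow> P A \<Longrightarrow> P (- A)" "\<And>A B. A \<in> Alg \<Longrightarrow> B \<in> Alg \<Longrightarrow> P A \<Longrightarrow> P B \<Longrightarrow> P (A + B)"
    "\<And>A B. A \<in> Alg \<Longrightarrow> B \<in> Alg \<Longrightarrow> P A \<Longrightarrow> P B \<Longrightarrow> P (A * B)"
  shows "P A"
  using assms(1) unfolding Alg_eq
  by (induction rule: generate_ring.induct) (use assms(2-) in \<open>auto simp: cluster_vars_def Alg_eq\<close>)

lemma cluster_algebra_simps [simp]:
  "\<one>\<^bsub>cluster_algebra Q\<^esub> = 1" "a \<oplus>\<^bsub>cluster_algebra Q\<^esub> c = a + c" "a \<otimes>\<^bsub>cluster_algebra Q\<^esub> c = a * c"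
  by (simp_all add: cluster_algebra_def ratfun_ring_def)

lemma auto_maps_Alg:
  assumes "seed_iso p \<pi>" "A \<in> Alg" shows "field_auto p \<pi> A \<in> Alg"
  using assms(2)
proof (induction rule: Alg_induct)
  case (gen q k)
  note d = seed_isoD[OF assms(1)]
  have "set (p @ map \<pi> q) \<subseteq> E" using d(1) image_mono[OF gen(1), of \<pi>] unfolding d(4) by simp
  moreover have "\<pi> k \<in> V" using d(5) gen(2) by blast
  ultimately show ?case unfolding field_auto_x[OF assms(1) gen(1)] by (rule Alg_x)
qed (simp_all add: auto_hom[OF assms(1)] Alg_closed(1,3,4,5))

lemma auto_bij_Alg:
  assumes "seed_iso p \<pi>" shows "bij_betw (field_auto p \<pi>) Alg Alg"
proof -
  obtain q \<rho> where q: "seed_iso q \<rho>" "\<And>A. field_auto p \<pi> (field_auto q \<rho> A) = A"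
    "\<And>A. field_auto q \<rho> (field_auto p \<pi> A) = A"
    using seed_iso_inverse[OF assms] by blast
  show ?thesis
    by (rule bij_betw_byWitness[of _ "field_auto q \<rho>"])
       (use q auto_maps_Alg[OF assms] auto_maps_Alg[OF q(1)] in auto)
qed

section \<open>From cluster elements to vertices\<close>

lemma vertex_of_x:
  assumes "set p \<subseteq> E" "i \<in> E" shows "vertex_of (S p) (x p i) = i"
  unfolding vertex_of_def S_simps[OF assms(1)]
  by (rule the_equality) (use assms x_inj in auto)

lemma mut_at_x:
  assumes "set p \<subseteq> E" "i \<in> E" shows "mut_at (x p i) (S p) = S (p @ [i])"
  unfolding mut_at_def vertex_of_x[OF assms] by (simp add: mut_along_def)

lemma exchanged_var_x:
  assumes "set p \<subseteq> E" "i \<in> E" shows "exchanged_var i (S p) = x (p @ [i]) i"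
proof -
  have "exchanged_var i (S p) = snd (S (p @ [i])) i" by (simp add: mut_along_def seed_mut_def)
  also have "\<dots> = x (p @ [i]) i" using assms by (subst S_simps) auto
  finally show ?thesis .
qed

text \<open>\<open>track\<close> follows elements, not vertices. Elements at different vertices of a
  cluster differ, so the vertex can be followed instead.\<close>

lemma track_step:
  assumes "set p \<subseteq> E" "i \<in> E"
  shows "track (S p) (x p i # ys) (x p k) = track (S (p @ [i])) ys (x (p @ [i]) k)"
  using assms x_inj[OF assms(1), of k i]
  by (auto simp: mut_at_x vertex_of_x exchanged_var_x cluster_var_snoc)

text \<open>\<open>f\<close> sends the element at vertex \<open>i\<close> to the element at vertex
  \<open>\<pi> i\<close> of the image seed, so the two tracks run along a path and its
  relabelling.\<close>

lemma auto_track: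
  assumes iso: "seed_iso p \<pi>" and q: "set q \<subseteq> E" and k: "k \<in> V" and ys: "admissible (S q) ys"
    and f: "\<And>A. A \<in> Alg \<Longrightarrow> f A = field_auto p \<pi> A"
  shows "f (track (S q) ys (x q k)) = track (S (p @ map \<pi> q)) (map f ys) (x (p @ map \<pi> q) (\<pi> k))"
  using q ys
proof (induction ys arbitrary: q)
  case Nil
  then show ?case using f[OF Alg_x[OF Nil(1) k]] field_auto_x[OF iso] by simp
next
  case (Cons y ys)
  note d = seed_isoD[OF iso]
  have "y \<in> x q ` E" using Cons.prems S_simps(5) by simp
  then obtain i where i: "i \<in> E" "y = x q i" by blast
  have iV: "i \<in> V" using i exch_verts_subset by blast
  have qi: "set (q @ [i]) \<subseteq> E" using Cons.prems i by simp
  have \<pi>q: "set (p @ map \<pi> q) \<subseteq> E" using d(1) image_mono[OF Cons.prems(1), of \<pi>] unfolding d(4) by simp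
  have \<pi>i: "\<pi> i \<in> E" using d(4) i(1) by blast
  have fy: "f y = x (p @ map \<pi> q) (\<pi> i)"
    unfolding i(2) f[OF Alg_x[OF Cons.prems(1) iV]] field_auto_x[OF iso Cons.prems(1)] ..
  have adm: "admissible (S (q @ [i])) ys"
    using Cons.prems(2) unfolding i(2) admissible.simps mut_at_x[OF Cons.prems(1) i(1)] by simp
  have "f (track (S q) (y # ys) (x q k)) = f (track (S (q @ [i])) ys (x (q @ [i]) k))"
    unfolding i(2) track_step[OF Cons.prems(1) i(1)] ..
  also have "\<dots> = track (S (p @ map \<pi> (q @ [i]))) (map f ys) (x (p @ map \<pi> (q @ [i])) (\<pi> k))"
    by (rule Cons.IH[OF qi adm])
  also have "\<dots> = track (S (p @ map \<pi> q)) (f y # map f ys) (x (p @ map \<pi> q) (\<pi> k))"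
    unfolding fy track_step[OF \<pi>q \<pi>i] by simp
  finally show ?case by simp
qed

text \<open>The definition asks for some pair of seeds; the initial seed and the one after
  \<open>p\<close> serve.\<close>

lemma auto_is_cluster_automorphism:
  assumes iso: "seed_iso p \<pi>"
  shows "restrict (field_auto p \<pi>) Alg \<in> cluster_automorphisms Q"
proof -
  let ?f = "restrict (field_auto p \<pi>) Alg"
  note d = seed_isoD[OF iso]
  have "bij_betw ?f Alg Alg" using auto_bij_Alg[OF iso] by (simp cong: bij_betw_cong)
  then have "?f \<in> Bij Alg" by (simp add: Bij_def)
  moreover have "rooted_cluster_morphism Q (S []) Q (S p) ?f"
    unfolding rooted_cluster_morphism_def
  proof (intro conjI allI impI ballI)
    show "?f \<in> ring_hom (cluster_algebra Q) (cluster_algebra Q)"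
      by (rule ring_hom_memI) (simp_all add: auto_maps_Alg[OF iso] auto_hom[OF iso] Alg_closed(1,4,5))
    have fx: "?f (indet k) = x p (\<pi> k)" if "k \<in> V" for k
      using Alg_x[of "[]" k] that by (simp add: field_auto_indet)
    show "?f ` exch_vars (S []) \<subseteq> exch_vars (S p) \<union> \<int>"
    proof (intro image_subsetI UnI1)
      fix y assume "y \<in> exch_vars (S [])"
      then obtain k where k: "k \<in> E" "y = indet k" using S_simps(5)[of "[]"] by auto
      then have "k \<in> V" "\<pi> k \<in> E" using exch_verts_subset[of Q] d(4) by auto
      then show "?f y \<in> exch_vars (S p)" unfolding k(2) S_simps(5)[OF d(1)] fx[OF \<open>k \<in> V\<close>] by simp
    qed
    show "?f ` frozen_vars (S []) \<subseteq> cluster (S p) \<union> \<int>"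
    proof (intro image_subsetI UnI1)
      fix y assume "y \<in> frozen_vars (S [])"
      then obtain k where k: "k \<in> V" "y = indet k" using S_simps(6)[of "[]"] verts_Un[of Q] by auto
      then have "\<pi> k \<in> V" using d(5) by auto
      then show "?f y \<in> cluster (S p)" unfolding k(2) S_simps(7)[OF d(1)] fx[OF k(1)] by simp
    qed
    fix ys y assume ys: "admissible (S []) ys \<and> admissible (S p) (map ?f ys)" and y: "y \<in> cluster (S [])"
    then obtain k where k: "k \<in> V" "y = x [] k" using S_simps(7)[of "[]"] by auto
    have "?f (track (S []) ys (x [] k)) = track (S (p @ map \<pi> [])) (map ?f ys) (x (p @ map \<pi> []) (\<pi> k))"
      by (rule auto_track[OF iso _ k(1)]) (use ys in simp_all)
    then show "?f (track (S []) ys y) = track (S p) (map ?f ys) (?f y)"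
      using fx[OF k(1)] k(2) by simp
  qed
  moreover have "S [] \<in> seeds Q" unfolding seeds_eq by (rule CollectI, rule exI[of _ "[]"]) simp
  moreover have "S p \<in> seeds Q" unfolding seeds_eq by (rule CollectI, rule exI[of _ p]) (simp add: d(1))
  ultimately show ?thesis unfolding cluster_automorphisms_def by blast
qed

end

section \<open>Cluster automorphisms are seed isomorphisms\<close>

text \<open>As \<open>place y\<close> is injective, this is an identity of polynomials in
  indeterminates; comparing supports determines the exponent vectors up to order. The undetermined
  order is the source of the signs in \<open>equal_up_to_signs\<close>.\<close>

lemma monomial_sums:
  fixes a a' c c' :: "nat \<Rightarrow> nat"
  assumes y: "basis y" and V: "finite V"
    and eq: "(\<Prod>j\<in>V. y j ^ a j) + (\<Prod>j\<in>V. y j ^ a' j) = (\<Prod>j\<in>V. y j ^ c j) + (\<Prod>j\<in>V. y j ^ c' j)"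
  shows "(\<forall>j\<in>V. a j = c j \<and> a' j = c' j) \<or> (\<forall>j\<in>V. a j = c' j \<and> a' j = c j)"
proof -
  define m where "m e = (\<Sum>j\<in>V. single j (e j))" for e :: "nat \<Rightarrow> nat"
  have lookup_m: "lookup (m e) j = (if j \<in> V then e j else 0)" for e j
    using V by (simp add: m_def lookup_sum lookup_single when_def)
  have keys_m: "keys (m e) \<subseteq> V" for e by (auto simp: in_keys_iff lookup_m split: if_splits)
  have monom_at_m: "monom_at y (m e) = (\<Prod>j\<in>V. y j ^ e j)" for e
    unfolding monom_at_superset[OF V keys_m] by (rule prod.cong) (simp_all add: lookup_m)
  have place: "place y (to_fract (single (m e) 1 + single (m e') 1)) = (\<Prod>j\<in>V. y j ^ e j) + (\<Prod>j\<in>V. y j ^ e' j)" for e e'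
    unfolding place_poly(2) by (simp add: monom_at_m)
  have "to_fract (single (m a) 1 + single (m a') 1) = to_fract (single (m c) 1 + single (m c') (1::rat))"
    by (rule injD[OF bij_is_inj[OF basis_bij[OF y]]]) (simp only: place eq)
  then have "keys (single (m a) (1::rat) + single (m a') 1) = keys (single (m c) (1::rat) + single (m c') 1)"
    by (simp only: to_fract_eq_iff)
  then have "{m a, m a'} = {m c, m c'}"
    by (simp add: keys_add_pos_poly pos_poly_single insert_commute)
  then have "m a = m c \<and> m a' = m c' \<or> m a = m c' \<and> m a' = m c" by (simp add: doubleton_eq_iff)
  moreover have "m e = m e' \<Longrightarrow> j \<in> V \<Longrightarrow> e j = e' j" for e e' j using lookup_m by metis
  ultimately show ?thesis by blast
qed

context quiver_seed
begin

text \<open>Exchange relations propagate the agreement from one cluster to all. As \<open>f\<close>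
  is a homomorphism on \<open>Alg\<close> only, they are used in the form without denominators, and
  the factor \<open>field_auto p \<pi> (x ?q i)\<close>, which is nonzero, is cancelled afterwards
  in the field.\<close>

lemma auto_unique:
  assumes iso: "seed_iso p \<pi>" and r: "set r \<subseteq> E"
    and f: "\<And>A B. A \<in> Alg \<Longrightarrow> B \<in> Alg \<Longrightarrow> f (A + B) = f A + f B"
      "\<And>A B. A \<in> Alg \<Longrightarrow> B \<in> Alg \<Longrightarrow> f (A * B) = f A * f B" "f 1 = 1"
    and agree: "\<And>k. k \<in> V \<Longrightarrow> f (x r k) = field_auto p \<pi> (x r k)"
    and A: "A \<in> Alg"
  shows "f A = field_auto p \<pi> A"
proof -
  let ?F = "field_auto p \<pi>"
  have f0: "f 0 = 0" using f(1)[OF Alg_0 Alg_0] unfolding add_0_right by (metis add_left_imp_eq add_0_right)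
  have fm: "f (- A) = - f A" if "A \<in> Alg" for A
    using f(1)[OF that Alg_closed(3)[OF that]] f0 by (simp add: eq_neg_iff_add_eq_0 add.commute)
  have fpow: "f (A ^ n) = f A ^ n" if "A \<in> Alg" for A n
    by (induction n) (simp_all add: f that Alg_power)
  have Fpow: "?F (A ^ n) = ?F A ^ n" for A n
    by (induction n) (simp_all add: auto_hom[OF iso])
  have Fprod: "?F (\<Prod>j\<in>T. A j) = (\<Prod>j\<in>T. ?F (A j))" for T :: "nat set" and A
    by (induction T rule: infinite_finite_induct) (simp_all add: auto_hom[OF iso])
  have fprod: "f (\<Prod>j\<in>T. A j) = (\<Prod>j\<in>T. f (A j))" if "\<And>j. j \<in> T \<Longrightarrow> A j \<in> Alg" for T :: "nat set" and A
    using that by (induction T rule: infinite_finite_induct) (simp_all add: f Alg_prod)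
  have step: "f (x (r @ q) k) = ?F (x (r @ q) k)" if "set q \<subseteq> E" "k \<in> V" for q k
    using that
  proof (induction q arbitrary: k rule: rev_induct)
    case Nil
    then show ?case using agree by simp
  next
    case (snoc i q)
    let ?q = "r @ q"
    have i: "i \<in> E" "set ?q \<subseteq> E" "i \<in> V" "set (?q @ [i]) \<subseteq> E"
      using snoc.prems r exch_verts_subset by auto
    have IH: "f (x ?q j) = ?F (x ?q j)" if "j \<in> V" for j using snoc.IH[OF _ that] snoc.prems by simp
    have Pm: "(\<Prod>j\<in>V. x ?q j ^ e j) \<in> Alg" for e :: "nat \<Rightarrow> nat"
      by (intro Alg_prod Alg_power Alg_x i(2))
    have mono: "f (\<Prod>j\<in>V. x ?q j ^ e j) = ?F (\<Prod>j\<in>V. x ?q j ^ e j)" for e :: "nat \<Rightarrow> nat"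
    proof -
      have "f (\<Prod>j\<in>V. x ?q j ^ e j) = (\<Prod>j\<in>V. f (x ?q j) ^ e j)"
        using Alg_x[OF i(2)] by (simp add: fprod Alg_power fpow)
      also have "\<dots> = ?F (\<Prod>j\<in>V. x ?q j ^ e j)" by (simp add: IH Fprod Fpow)
      finally show ?thesis .
    qed
    have "f (x (?q @ [i]) i) * f (x ?q i) = f (x (?q @ [i]) i * x ?q i)"
      using f(2)[OF Alg_x[OF i(4,3)] Alg_x[OF i(2,3)]] by simp
    also have "\<dots> = ?F (x (?q @ [i]) i * x ?q i)"
      unfolding x_snoc_mult f(1)[OF Pm Pm] mono auto_hom(1)[OF iso] ..
    also have "\<dots> = ?F (x (?q @ [i]) i) * f (x ?q i)" by (simp add: auto_hom[OF iso] IH[OF i(3)])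
    finally have "f (x (?q @ [i]) i) = ?F (x (?q @ [i]) i)"
      using IH[OF i(3)] subfree_nonzero[OF cluster_var_subfree] by (simp add: auto_hom(5)[OF iso])
    then show ?case
      using IH[OF snoc.prems(2)] by (cases "k = i") (simp_all add: cluster_var_snoc flip: append_assoc)
  qed
  \<comment> \<open>Every cluster can be reached from the one at \<open>r\<close> by first walking
    back to the initial seed.\<close>
  have gen: "f (x q k) = ?F (x q k)" if "set q \<subseteq> E" "k \<in> V" for q k
    using step[of "rev r @ q" k] that r x_cancel[OF r that(1)] by simp
  show ?thesis using A
    by (induction rule: Alg_induct) (simp_all add: f fm gen auto_hom[OF iso])
qed

lemma x_not_int: "set p \<subseteq> E \<Longrightarrow> x p k \<noteq> of_int n"
proof
  assume p: "set p \<subseteq> E" and "x p k = of_int n"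
  then have "place (x p) (indet k) = place (x p) (const (of_int n))"
    unfolding place_const(2) by (simp add: const_of_int)
  then have "indet k = const (of_int n)" by (rule injD[OF bij_is_inj[OF basis_bij[OF basis_x[OF p]]]])
  then have "indet k = of_int n" by (simp only: const_of_int)
  then show False using indet_not_int[of k] by simp
qed

text \<open>This normal form refers to the initial seed only, whatever the two seeds that witness
  \<open>f\<close>. It is obtained by comparing exchange relations at these seeds and then
  transporting the result back.\<close>

lemma cluster_automorphism_is_auto:
  assumes "f \<in> cluster_automorphisms Q"
  obtains p \<pi> where "seed_iso p \<pi>" "f = restrict (field_auto p \<pi>) Alg"
proof -
  obtain p0 p1 where p: "set p0 \<subseteq> E" "set p1 \<subseteq> E" and Bij: "f \<in> Bij Alg"
    and mor: "rooted_cluster_morphism Q (S p0) Q (S p1) f"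
    using assms unfolding cluster_automorphisms_def seeds_eq by blast
  have hom: "f \<in> ring_hom (cluster_algebra Q) (cluster_algebra Q)"
    and ex: "f ` exch_vars (S p0) \<subseteq> exch_vars (S p1) \<union> \<int>"
    and fr: "f ` frozen_vars (S p0) \<subseteq> cluster (S p1) \<union> \<int>"
    and track: "\<And>ys y. admissible (S p0) ys \<Longrightarrow> admissible (S p1) (map f ys) \<Longrightarrow> y \<in> cluster (S p0) \<Longrightarrow>
      f (track (S p0) ys y) = track (S p1) (map f ys) (f y)"
    using mor unfolding rooted_cluster_morphism_def by blast+
  have f: "\<And>A B. A \<in> Alg \<Longrightarrow> B \<in> Alg \<Longrightarrow> f (A + B) = f A + f B"
    "\<And>A B. A \<in> Alg \<Longrightarrow> B \<in> Alg \<Longrightarrow> f (A * B) = f A * f B" "f 1 = 1"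
    using ring_hom_add[OF hom] ring_hom_mult[OF hom] ring_hom_one[OF hom] by simp_all
  have inj: "inj_on f Alg" using Bij by (simp add: Bij_def bij_betw_def)
  have f0: "f 0 = 0" using f(1)[OF Alg_0 Alg_0] unfolding add_0_right by (metis add_left_imp_eq add_0_right)
  have fm: "f (- A) = - f A" if "A \<in> Alg" for A
    using f(1)[OF that Alg_closed(3)[OF that]] f0 by (simp add: eq_neg_iff_add_eq_0 add.commute)
  have fnat: "f (of_nat n) = of_nat n" for n
    by (induction n) (simp_all add: f0 f Alg_of_nat Alg_closed(1))
  have fint: "f (of_int n) = of_int n" for n
    by (cases n) (auto simp: fnat fm Alg_of_nat simp del: of_nat_Suc)
  \<comment> \<open>Excludes the integer values that the definition of a morphism allows:
    \<open>f\<close> fixes integers and is injective, while no cluster element is an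
    integer.\<close>
  have not_int: "f (x p0 k) \<notin> \<int>" if "k \<in> V" for k
  proof
    assume "f (x p0 k) \<in> \<int>"
    then obtain n where "f (x p0 k) = f (of_int n)" by (auto simp: fint elim: Ints_cases)
    then have "x p0 k = of_int n" by (rule inj_onD[OF inj _ Alg_x[OF p(1) that] Alg_of_int])
    with x_not_int[OF p(1)] show False by blast
  qed
  have "\<forall>k\<in>V. \<exists>j. j \<in> V \<and> f (x p0 k) = x p1 j \<and> (k \<in> E \<longrightarrow> j \<in> E)"
  proof
    fix k assume k: "k \<in> V"
    show "\<exists>j. j \<in> V \<and> f (x p0 k) = x p1 j \<and> (k \<in> E \<longrightarrow> j \<in> E)"
    proof (cases "k \<in> E")
      case True
      then have "f (x p0 k) \<in> x p1 ` E"
        using ex not_int[OF k] unfolding S_simps(5)[OF p(1)] S_simps(5)[OF p(2)] by blast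
      then show ?thesis using exch_verts_subset by blast
    next
      case False
      then have "k \<in> frozen_verts Q" using k verts_Un by blast
      then have "f (x p0 k) \<in> x p1 ` V"
        using fr not_int[OF k] unfolding S_simps(6)[OF p(1)] S_simps(7)[OF p(2)] by blast
      then show ?thesis using False by blast
    qed
  qed
  then obtain g where g: "\<And>k. k \<in> V \<Longrightarrow> g k \<in> V \<and> f (x p0 k) = x p1 (g k) \<and> (k \<in> E \<longrightarrow> g k \<in> E)"
    by metis
  define \<pi> where "\<pi> k = (if k \<in> V then g k else k)" for k
  have \<pi>V: "\<pi> k \<in> V" "f (x p0 k) = x p1 (\<pi> k)" if "k \<in> V" for k using g[OF that] that by (simp_all add: \<pi>_def)
  have \<pi>E: "\<pi> k \<in> E" if "k \<in> E" for k using g[of k] that exch_verts_subset[of Q] by (auto simp: \<pi>_def)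
  have injV: "inj_on \<pi> V"
  proof (rule inj_onI)
    fix j k assume jk: "j \<in> V" "k \<in> V" "\<pi> j = \<pi> k"
    then have "f (x p0 j) = f (x p0 k)" using \<pi>V by simp
    then have "x p0 j = x p0 k" by (rule inj_onD[OF inj _ Alg_x[OF p(1) jk(1)] Alg_x[OF p(1) jk(2)]])
    then show "j = k" by (simp add: x_inj[OF p(1)])
  qed
  have imV: "\<pi> ` V = V" by (rule endo_inj_surj[OF finite_verts _ injV]) (use \<pi>V in auto)
  \<comment> \<open>A morphism may send frozen elements to exchangeable ones; here the finite set
    \<open>E\<close> is already filled by its own image, so frozen vertices go to frozen
    ones.\<close>
  have imE: "\<pi> ` E = E"
    by (rule endo_inj_surj) (use \<pi>E inj_on_subset[OF injV exch_verts_subset] finite_subset[OF exch_verts_subset finite_verts] in auto)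
  have "\<pi> permutes V"
    by (rule bij_imp_permutes) (use injV imV in \<open>auto simp: bij_betw_def \<pi>_def\<close>)
  then have bij: "bij \<pi>" by (rule permutes_bij)
  have basis: "basis (\<lambda>k. x p1 (\<pi> k))" by (rule basis_perm[OF basis_x[OF p(2)] bij])
  have fpow: "f (A ^ n) = f A ^ n" if "A \<in> Alg" for A n
    by (induction n) (simp_all add: f that Alg_power)
  have fprod: "f (\<Prod>j\<in>T. A j) = (\<Prod>j\<in>T. f (A j))" if "\<And>j. j \<in> T \<Longrightarrow> A j \<in> Alg" for T :: "nat set" and A
    using that by (induction T rule: infinite_finite_induct) (simp_all add: f Alg_prod)
  have mono: "f (\<Prod>j\<in>V. x p0 j ^ e j) = (\<Prod>j\<in>V. x p1 (\<pi> j) ^ e j)" for e :: "nat \<Rightarrow> nat"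
    using Alg_x[OF p(1)] by (simp add: fprod Alg_power fpow \<pi>V)
  have Pm: "(\<Prod>j\<in>V. x p0 j ^ e j) \<in> Alg" for e :: "nat \<Rightarrow> nat"
    by (intro Alg_prod Alg_power Alg_x p(1))
  have equal_up_to_signs: "equal_up_to_signs V E (matrix_path p0 b) (matrix_path p1 b) \<pi>"
    unfolding equal_up_to_signs_def
  proof
    fix i assume i: "i \<in> E"
    then have iV: "i \<in> V" and p0i: "set (p0 @ [i]) \<subseteq> E" using exch_verts_subset[of Q] p by auto
    have fi: "f (x p0 i) = x p1 (\<pi> i)" using \<pi>V iV by simp
    \<comment> \<open>The tracking condition for a sequence of length one carries the exchange
      relation at \<open>i\<close> to the one at \<open>\<pi> i\<close>.\<close>
    have "f (track (S p0) [x p0 i] (x p0 i)) = track (S p1) (map f [x p0 i]) (f (x p0 i))"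
    proof (rule track)
      show "admissible (S p0) [x p0 i]" using i by (simp add: S_simps(5)[OF p(1)])
      show "admissible (S p1) (map f [x p0 i])" using \<pi>E[OF i] by (simp add: S_simps(5)[OF p(2)] fi)
      show "x p0 i \<in> cluster (S p0)" using iV by (simp add: S_simps(7)[OF p(1)])
    qed
    then have "f (x (p0 @ [i]) i) = x (p1 @ [\<pi> i]) (\<pi> i)"
      unfolding fi list.map track_step[OF p(1) i] track_step[OF p(2) \<pi>E[OF i]] by simp
    then have "f (x (p0 @ [i]) i * x p0 i) = x (p1 @ [\<pi> i]) (\<pi> i) * x p1 (\<pi> i)"
      using f(2)[OF Alg_x[OF p0i iV] Alg_x[OF p(1) iV]] fi by simp
    then have "(\<Prod>j\<in>V. x p1 (\<pi> j) ^ nat (matrix_path p0 b j i)) + (\<Prod>j\<in>V. x p1 (\<pi> j) ^ nat (- matrix_path p0 b j i)) =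
        (\<Prod>j\<in>V. x p1 j ^ nat (matrix_path p1 b j (\<pi> i))) + (\<Prod>j\<in>V. x p1 j ^ nat (- matrix_path p1 b j (\<pi> i)))"
      unfolding x_snoc_mult f(1)[OF Pm Pm] mono .
    also have "\<dots> = (\<Prod>j\<in>V. x p1 (\<pi> j) ^ nat (matrix_path p1 b (\<pi> j) (\<pi> i))) + (\<Prod>j\<in>V. x p1 (\<pi> j) ^ nat (- matrix_path p1 b (\<pi> j) (\<pi> i)))"
    proof -
      have "(\<Prod>j\<in>V. x p1 j ^ e j) = (\<Prod>j\<in>V. x p1 (\<pi> j) ^ e (\<pi> j))" for e :: "nat \<Rightarrow> nat"
        using prod.reindex[OF injV, of "\<lambda>j. x p1 j ^ e j"] unfolding imV by simp
      then show ?thesis by (intro arg_cong2[where f = plus])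
    qed
    finally have "(\<forall>j\<in>V. nat (matrix_path p0 b j i) = nat (matrix_path p1 b (\<pi> j) (\<pi> i)) \<and> nat (- matrix_path p0 b j i) = nat (- matrix_path p1 b (\<pi> j) (\<pi> i))) \<or>
        (\<forall>j\<in>V. nat (matrix_path p0 b j i) = nat (- matrix_path p1 b (\<pi> j) (\<pi> i)) \<and> nat (- matrix_path p0 b j i) = nat (matrix_path p1 b (\<pi> j) (\<pi> i)))"
      by (rule monomial_sums[OF basis finite_verts])
    moreover have "d = c" if "nat c = nat d \<and> nat (- c) = nat (- d)" for c d :: int using that by linarith
    moreover have "d = - c" if "nat c = nat (- d) \<and> nat (- c) = nat d" for c d :: int using that by linarith
    ultimately show "(\<forall>j\<in>V. matrix_path p1 b (\<pi> j) (\<pi> i) = matrix_path p0 b j i) \<or> (\<forall>j\<in>V. matrix_path p1 b (\<pi> j) (\<pi> i) = - matrix_path p0 b j i)"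
      by meson
  qed
  \<comment> \<open>Walking back along \<open>p0\<close> leads from the source seed to the initial
    one; the relabelled walk gives the matching seed on the target side.\<close>
  define p where "p = p1 @ map \<pi> (rev p0)"
  have mapE: "set (map \<pi> (rev p0)) \<subseteq> E" using image_mono[OF p(1), of \<pi>] unfolding imE by simp
  have "equal_up_to_signs V E (matrix_path (rev p0) (matrix_path p0 b)) (matrix_path (map \<pi> (rev p0)) (matrix_path p1 b)) \<pi>"
    by (rule equal_up_to_signs_matrix_path[OF equal_up_to_signs skew_matrix_path[OF skew p(1)] skew_matrix_path[OF skew p(2)]])
       (use p imE bij_is_inj[OF bij] exch_verts_subset in auto)
  then have "equal_up_to_signs V E b (matrix_path p b) \<pi>" by (simp add: matrix_path_rev p_def)
  then have iso: "seed_iso p \<pi>"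
    unfolding seed_iso_def using p(2) mapE bij imE by (simp add: p_def \<pi>_def)
  have "f (x p0 k) = field_auto p \<pi> (x p0 k)" if k: "k \<in> V" for k
  proof -
    have "mseed_path V (rev (map \<pi> (rev p0))) (mseed_path V (map \<pi> (rev p0)) (matrix_path p1 b, x p1)) = (matrix_path p1 b, x p1)"
      by (rule mseed_path_rev[OF skew_matrix_path[OF skew p(2)] mapE]) simp
    then have c: "mseed_path V (map \<pi> p0) (mseed_path V (map \<pi> (rev p0)) (matrix_path p1 b, x p1)) = (matrix_path p1 b, x p1)"
      by (simp add: rev_map)
    have "x (p1 @ map \<pi> (rev p0) @ map \<pi> p0) =
        snd (mseed_path V (map \<pi> p0) (mseed_path V (map \<pi> (rev p0)) (mseed_path V p1 (b, indet))))"
      by (simp only: cluster_var_def mseed_path_simps)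
    also have "\<dots> = x p1" unfolding mseed_path_cluster_var c by simp
    finally have "x (p1 @ map \<pi> (rev p0) @ map \<pi> p0) = x p1" .
    then show ?thesis unfolding field_auto_x[OF iso p(1)] using \<pi>V(2)[OF k] by (simp add: p_def)
  qed
  then have "f A = field_auto p \<pi> A" if "A \<in> Alg" for A
    using auto_unique[OF iso p(1) f _ that] by blast
  moreover have "f \<in> extensional Alg" using Bij by (rule Bij_imp_extensional)
  ultimately have "f = restrict (field_auto p \<pi>) Alg"
    by (intro extensionalityI[of _ Alg]) auto
  with iso show thesis by (rule that)
qed

section \<open>The cluster automorphisms form a group\<close>

lemma compose_auto:
  assumes "seed_iso p \<pi>" "seed_iso q \<rho>"
  shows "compose Alg (restrict (field_auto p \<pi>) Alg) (restrict (field_auto q \<rho>) Alg) =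
    restrict (field_auto (p @ map \<pi> q) (\<lambda>k. \<pi> (\<rho> k))) Alg"
  by (rule ext) (simp add: compose_def auto_maps_Alg[OF assms(2)] seed_iso_compose(2)[OF assms])

lemma Aut_Bij: "cluster_automorphisms Q \<subseteq> Bij Alg"
  unfolding cluster_automorphisms_def by blast

text \<open>Closure under composition is not visible in the definition, because two automorphisms
  may be witnessed by unrelated pairs of seeds. The normal form based at the initial seed makes them
  composable.\<close>

lemma subgroup_Aut: "subgroup (cluster_automorphisms Q) (BijGroup Alg)"
proof (rule group.subgroupI[OF group_BijGroup])
  show "cluster_automorphisms Q \<subseteq> carrier (BijGroup Alg)" using Aut_Bij by (simp add: BijGroup_def)
  show "cluster_automorphisms Q \<noteq> {}" using auto_is_cluster_automorphism[OF seed_iso_Nil] by blast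
next
  fix f assume f: "f \<in> cluster_automorphisms Q"
  then obtain p \<pi> where iso: "seed_iso p \<pi>" and f_eq: "f = restrict (field_auto p \<pi>) Alg"
    using cluster_automorphism_is_auto by blast
  obtain q \<rho> where q: "seed_iso q \<rho>" "\<And>A. field_auto p \<pi> (field_auto q \<rho> A) = A"
    "\<And>A. field_auto q \<rho> (field_auto p \<pi> A) = A"
    using seed_iso_inverse[OF iso] by blast
  let ?g = "restrict (field_auto q \<rho>) Alg"
  have g: "?g \<in> cluster_automorphisms Q" by (rule auto_is_cluster_automorphism[OF q(1)])
  have "?g \<otimes>\<^bsub>BijGroup Alg\<^esub> f = \<one>\<^bsub>BijGroup Alg\<^esub>"
    using f g Aut_Bij unfolding f_eq BijGroup_def
    by (auto simp: compose_auto[OF q(1) iso] seed_iso_compose(2)[OF q(1) iso] q(3) subset_iff)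
  then have "inv\<^bsub>BijGroup Alg\<^esub> f = ?g"
    using f g Aut_Bij by (intro group.inv_equality[OF group_BijGroup]) (auto simp: BijGroup_def)
  then show "inv\<^bsub>BijGroup Alg\<^esub> f \<in> cluster_automorphisms Q" using g by simp
next
  fix f g assume fg: "f \<in> cluster_automorphisms Q" "g \<in> cluster_automorphisms Q"
  obtain p \<pi> where iso: "seed_iso p \<pi>" and f_eq: "f = restrict (field_auto p \<pi>) Alg"
    using cluster_automorphism_is_auto[OF fg(1)] by blast
  obtain q \<rho> where iso': "seed_iso q \<rho>" and g_eq: "g = restrict (field_auto q \<rho>) Alg"
    using cluster_automorphism_is_auto[OF fg(2)] by blast
  have "f \<otimes>\<^bsub>BijGroup Alg\<^esub> g = compose Alg f g"
    using fg Aut_Bij by (auto simp: BijGroup_def)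
  then show "f \<otimes>\<^bsub>BijGroup Alg\<^esub> g \<in> cluster_automorphisms Q"
    using auto_is_cluster_automorphism[OF seed_iso_compose(1)[OF iso iso']]
    by (simp add: f_eq g_eq compose_auto[OF iso iso'])
qed

lemma cluster_Aut_simps:
  "carrier (cluster_Aut Q) = cluster_automorphisms Q" "\<one>\<^bsub>cluster_Aut Q\<^esub> = (\<lambda>A\<in>Alg. A)"
  "f \<in> cluster_automorphisms Q \<Longrightarrow> g \<in> cluster_automorphisms Q \<Longrightarrow> f \<otimes>\<^bsub>cluster_Aut Q\<^esub> g = compose Alg f g"
  using Aut_Bij by (auto simp: cluster_Aut_def BijGroup_def)

lemma group_cluster_Aut: "group (cluster_Aut Q)"
  unfolding cluster_Aut_def by (rule group.subgroup_imp_group[OF group_BijGroup subgroup_Aut])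

end

section \<open>Forgetting the frozen variables\<close>

lemma principal_part_verts:
  "verts (principal_part Q) = exch_verts Q" "exch_verts (principal_part Q) = exch_verts Q"
  by (simp_all add: principal_part_def verts_def exch_verts_def)

lemma has_matrix_principal_part:
  assumes "has_matrix Q b" shows "has_matrix (principal_part Q) b"
proof -
  have "exch_matrix (principal_part Q) j k = exch_matrix Q j k" if "j \<in> exch_verts Q" "k \<in> exch_verts Q" for j k
    using that by (simp add: exch_matrix_def principal_part_def)
  moreover have "arr (principal_part Q) j k = 0 \<or> arr (principal_part Q) k j = 0" for j k
    using assms by (simp add: has_matrix_def principal_part_def)
  ultimately show ?thesis using assms exch_verts_subset[of Q] by (auto simp: has_matrix_def principal_part_verts)
qed

text \<open>One matrix serves both algebras: the principal part has the same exchangeable vertices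
  and reads only the rows indexed by them.\<close>

locale quiver_pair = quiver_seed Q b + ex: quiver_seed "principal_part Q" b
  for Q :: quiver and b :: "nat \<Rightarrow> nat \<Rightarrow> int"

lemma quiver_pairI: "quiver_seed Q b \<Longrightarrow> quiver_pair Q b"
  unfolding quiver_pair_def quiver_seed_def using has_matrix_principal_part by (simp add: principal_part_verts)

context quiver_pair
begin

abbreviation "F \<equiv> frozen_verts Q"
abbreviation "t \<equiv> cluster_var (verts (principal_part Q)) b"
abbreviation "specialize \<equiv> place (forget F)"

lemma V_minus_E: "V - E = F"
  using verts_Un[of Q] exch_frozen_disjoint[of Q] by blast

lemma not_frozen: "k \<in> E \<Longrightarrow> k \<notin> F" and frozen_in_V: "k \<in> F \<Longrightarrow> k \<in> V" and exch_in_V: "k \<in> E \<Longrightarrow> k \<in> V"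
  using verts_Un[of Q] exch_frozen_disjoint[of Q] by blast+

lemma x_frozen: "set q \<subseteq> E \<Longrightarrow> k \<in> F \<Longrightarrow> x q k = indet k"
  using not_frozen by (intro cluster_var_outside) blast

lemma specialize_x: "set q \<subseteq> E \<Longrightarrow> k \<in> E \<Longrightarrow> specialize (x q k) = t q k"
  using place_forget_cluster_var[OF finite_verts exch_verts_subset, of q Q k b] not_frozen
  unfolding V_minus_E principal_part_verts by simp

lemma specialize_frozen: "k \<in> F \<Longrightarrow> specialize (indet k) = 1"
  by (simp add: forget_def)

text \<open>Cluster elements are subtraction-free and so are the substituted values; hence no
  denominator vanishes, although the specialization is not defined on the whole field.\<close>

lemma Alg_place_dom: "A \<in> Alg \<Longrightarrow> A \<in> place_dom (forget F)"
proof (induction rule: Alg_induct)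
  case (gen p k)
  show ?case by (rule place_subfree[OF cluster_var_subfree forget_subfree, THEN conjunct1])
next
  case (minus A)
  then have "const (- 1) * A \<in> place_dom (forget F)" by (intro place_closed place_const)
  then show ?case by simp
qed (simp_all add: place_closed)

lemma specialize_hom:
  assumes "A \<in> Alg" "B \<in> Alg"
  shows "specialize (A + B) = specialize A + specialize B" "specialize (A * B) = specialize A * specialize B"
    "specialize (- A) = - specialize A"
proof -
  show "specialize (A + B) = specialize A + specialize B" "specialize (A * B) = specialize A * specialize B"
    using assms Alg_place_dom by (simp_all add: place_hom)
  have "specialize (- A) = specialize (const (- 1) * A)" by simp
  also have "\<dots> = const (- 1) * specialize A" using Alg_place_dom[OF assms(1)] by (simp only: place_hom place_const)
  finally show "specialize (- A) = - specialize A" by simp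
qed

lemma gen_cases:
  assumes "k \<in> V" "set q \<subseteq> E"
  obtains "k \<in> E" "specialize (x q k) = t q k" | "k \<in> F" "x q k = indet k" "specialize (x q k) = 1"
  using assms specialize_x[OF assms(2), of k] x_frozen[OF assms(2), of k] specialize_frozen[of k] verts_Un[of Q]
  by (metis Un_iff)

lemma specialize_Alg: "A \<in> Alg \<Longrightarrow> specialize A \<in> ex.Alg"
proof (induction rule: Alg_induct)
  case (gen q k)
  from gen(2,1) show ?case
  proof (cases rule: gen_cases)
    case 1
    then show ?thesis using ex.Alg_x[of q k] gen by (simp add: principal_part_verts)
  qed (simp add: ex.Alg_closed(1))
qed (simp_all add: specialize_hom ex.Alg_closed(1,3,4,5))

lemma specialize_surj: "B \<in> ex.Alg \<Longrightarrow> \<exists>A\<in>Alg. specialize A = B"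
proof (induction rule: ex.Alg_induct)
  case one
  show ?case by (intro bexI[of _ 1]) (simp_all add: Alg_closed(1))
next
  case (gen q k)
  then have "x q k \<in> Alg" "specialize (x q k) = t q k"
    using Alg_x[of q k] specialize_x[of q k] exch_in_V[of k] by (simp_all add: principal_part_verts)
  then show ?case by auto
next
  case (minus B)
  then obtain A where "A \<in> Alg" "specialize A = B" by blast
  then show ?case by (intro bexI[of _ "- A"]) (simp_all add: specialize_hom(3) Alg_closed(3))
next
  case (add B C)
  then obtain A A' where "A \<in> Alg" "specialize A = B" "A' \<in> Alg" "specialize A' = C" by blast
  then show ?case by (intro bexI[of _ "A + A'"]) (simp_all add: specialize_hom(1) Alg_closed(4))
next
  case (mult B C)
  then obtain A A' where "A \<in> Alg" "specialize A = B" "A' \<in> Alg" "specialize A' = C" by blast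
  then show ?case by (intro bexI[of _ "A * A'"]) (simp_all add: specialize_hom(2) Alg_closed(5))
qed

definition exch_perm :: "(nat \<Rightarrow> nat) \<Rightarrow> nat \<Rightarrow> nat" where
  "exch_perm \<pi> k = (if k \<in> E then \<pi> k else k)"

lemma seed_iso_exch:
  assumes "seed_iso p \<pi>" shows "ex.seed_iso p (exch_perm \<pi>)"
proof -
  note d = seed_isoD[OF assms]
  have "bij_betw (exch_perm \<pi>) E E"
    unfolding bij_betw_def using d(4) inj_on_subset[OF d(3), of E]
    by (auto simp: exch_perm_def inj_on_def)
  then have "exch_perm \<pi> permutes E" by (rule bij_imp_permutes) (simp add: exch_perm_def)
  then have "bij (exch_perm \<pi>)" "exch_perm \<pi> ` E = E" by (simp_all add: permutes_bij permutes_image)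
  moreover have out: "exch_perm \<pi> k = k" if "k \<notin> E" for k using that by (simp add: exch_perm_def)
  moreover have "equal_up_to_signs E E b (matrix_path p b) (exch_perm \<pi>)"
    using d(6) exch_verts_subset[of Q] unfolding equal_up_to_signs_def by (auto simp: exch_perm_def subset_iff)
  ultimately show ?thesis
    unfolding ex.seed_iso_def unfolding principal_part_verts using d(1) out by simp
qed

lemma frozen_perm: "seed_iso p \<pi> \<Longrightarrow> k \<in> F \<Longrightarrow> \<pi> k \<in> F"
proof -
  assume iso: "seed_iso p \<pi>" and k: "k \<in> F"
  note d = seed_isoD[OF iso]
  have "\<pi> k \<in> V" using d(5) frozen_in_V[OF k] by blast
  moreover have "\<pi> k \<notin> E" using inj_image_mem_iff[OF d(3), of k E] d(4) k not_frozen by auto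
  ultimately show "\<pi> k \<in> F" using V_minus_E by blast
qed

text \<open>It suffices to compare on cluster elements. For exchangeable ones both sides follow the
  same path; frozen ones are permuted among themselves, so both sides are 1.\<close>

lemma specialize_auto:
  assumes iso: "seed_iso p \<pi>" and A: "A \<in> Alg"
  shows "specialize (field_auto p \<pi> A) = ex.field_auto p (exch_perm \<pi>) (specialize A)"
  using A
proof (induction rule: Alg_induct)
  case (gen q k)
  note d = seed_isoD[OF iso] and iso' = seed_iso_exch[OF iso]
  have pq: "set (p @ map \<pi> q) \<subseteq> E" using d(1) image_mono[OF gen(1), of \<pi>] unfolding d(4) by simp
  from gen(2,1) show ?case
  proof (cases rule: gen_cases)
    case 1
    have mp: "map (exch_perm \<pi>) q = map \<pi> q" using gen(1) by (auto simp: exch_perm_def)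
    have k: "\<pi> k \<in> E" "exch_perm \<pi> k = \<pi> k" using 1(1) d(4) by (auto simp: exch_perm_def)
    have q: "set q \<subseteq> exch_verts (principal_part Q)" using gen(1) by (simp add: principal_part_verts)
    show ?thesis
      unfolding 1(2) field_auto_x[OF iso gen(1)] specialize_x[OF pq k(1)] ex.field_auto_x[OF iso' q] mp k(2) ..
  next
    case 2
    have "field_auto p \<pi> (x q k) = indet (\<pi> k)"
      using frozen_perm[OF iso 2(1)] x_frozen[OF pq] by (simp add: field_auto_x[OF iso gen(1)])
    then show ?thesis
      using specialize_frozen[OF frozen_perm[OF iso 2(1)]] 2(3) ex.auto_hom(6)[OF iso'] by simp
  qed
qed (simp_all add: auto_hom[OF iso] specialize_hom auto_maps_Alg[OF iso] ex.auto_hom[OF seed_iso_exch[OF iso]])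

text \<open>Apply \<open>cluster_determined\<close> to the seed reached along \<open>q\<close>.\<close>

lemma auto_fixes_x:
  assumes iso: "seed_iso p \<pi>" and triv: "\<And>A. A \<in> Alg \<Longrightarrow> specialize (field_auto p \<pi> A) = specialize A"
    and q: "set q \<subseteq> E" and k: "k \<in> E"
  shows "field_auto p \<pi> (x q k) = x q k"
proof -
  note d = seed_isoD[OF iso]
  define r where "r = rev q @ p @ map \<pi> q"
  have pq: "set (p @ map \<pi> q) \<subseteq> E" using d(1) image_mono[OF q, of \<pi>] unfolding d(4) by simp
  then have r: "set r \<subseteq> E" using q by (simp add: r_def)
  have "cluster_var V (matrix_path q b) r (\<pi> k) = indet k"
  proof (rule cluster_determined[OF skew_matrix_path[OF skew q] finite_verts exch_verts_subset r _ _ k])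
    show "\<pi> ` E \<subseteq> E" using d(4) by simp
    fix j assume j: "j \<in> E"
    then have \<pi>j: "\<pi> j \<in> E" using d(4) by blast
    have "place (t q) (cluster_var (verts (principal_part Q)) (matrix_path q b) r (\<pi> j)) = t (q @ rev q @ (p @ map \<pi> q)) (\<pi> j)"
      by (simp only: cluster_var_append[symmetric] r_def)
    also have "\<dots> = t (p @ map \<pi> q) (\<pi> j)"
      using ex.x_cancel[of q "p @ map \<pi> q"] q pq by (simp only: principal_part_verts)
    also have "\<dots> = specialize (field_auto p \<pi> (x q j))"
      using specialize_x[OF pq \<pi>j] by (simp add: field_auto_x[OF iso q])
    also have "\<dots> = t q j" using triv[OF Alg_x[OF q exch_in_V[OF j]]] specialize_x[OF q j] by simp
    finally have "place (t q) (cluster_var (verts (principal_part Q)) (matrix_path q b) r (\<pi> j)) = place (t q) (indet j)" by simp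
    then have "cluster_var (verts (principal_part Q)) (matrix_path q b) r (\<pi> j) = indet j"
      by (rule injD[OF bij_is_inj[OF basis_bij[OF basis_cluster_var[OF skew q]]]])
    then show "cluster_var E (matrix_path q b) r (\<pi> j) = indet j" unfolding principal_part_verts .
  qed
  then have "x (q @ r) (\<pi> k) = x q k" by (simp add: cluster_var_append)
  then show ?thesis
    using x_cancel[OF q pq] by (simp add: field_auto_x[OF iso q] r_def)
qed

text \<open>The descended map. It is unique because \<open>specialize\<close> maps onto
  \<open>ex.Alg\<close> and extensionality settles the values elsewhere.\<close>

definition project :: "(ratfun \<Rightarrow> ratfun) \<Rightarrow> ratfun \<Rightarrow> ratfun" where
  "project f = (THE g. g \<in> extensional ex.Alg \<and> (\<forall>A\<in>Alg. g (specialize A) = specialize (f A)))"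

lemma project_eq:
  assumes "g \<in> extensional ex.Alg" "\<And>A. A \<in> Alg \<Longrightarrow> g (specialize A) = specialize (f A)"
  shows "project f = g"
  unfolding project_def
proof (rule the_equality)
  fix h assume h: "h \<in> extensional ex.Alg \<and> (\<forall>A\<in>Alg. h (specialize A) = specialize (f A))"
  show "h = g"
  proof (rule extensionalityI[of _ ex.Alg])
    fix B assume "B \<in> ex.Alg"
    then obtain A where "A \<in> Alg" "specialize A = B" using specialize_surj by blast
    then show "h B = g B" using h assms(2) by metis
  qed (use h assms(1) in auto)
qed (use assms in blast)

lemma project_auto:
  assumes iso: "seed_iso p \<pi>"
  shows "project (restrict (field_auto p \<pi>) Alg) = restrict (ex.field_auto p (exch_perm \<pi>)) ex.Alg"
  by (rule project_eq) (simp_all add: specialize_Alg specialize_auto[OF iso])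

lemma project_Aut:
  assumes "f \<in> cluster_automorphisms Q"
  shows "project f \<in> cluster_automorphisms (principal_part Q)"
    and "A \<in> Alg \<Longrightarrow> project f (specialize A) = specialize (f A)"
proof -
  obtain p \<pi> where iso: "seed_iso p \<pi>" and f: "f = restrict (field_auto p \<pi>) Alg"
    using cluster_automorphism_is_auto[OF assms] by blast
  show "project f \<in> cluster_automorphisms (principal_part Q)"
    unfolding f project_auto[OF iso] by (rule ex.auto_is_cluster_automorphism[OF seed_iso_exch[OF iso]])
  show "A \<in> Alg \<Longrightarrow> project f (specialize A) = specialize (f A)"
    unfolding f project_auto[OF iso] by (simp add: specialize_Alg specialize_auto[OF iso])
qed

lemma project_hom: "project \<in> hom (cluster_Aut Q) (cluster_Aut (principal_part Q))"
proof (rule homI)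
  fix f assume "f \<in> carrier (cluster_Aut Q)"
  then show "project f \<in> carrier (cluster_Aut (principal_part Q))"
    using project_Aut by (simp add: cluster_Aut_simps ex.cluster_Aut_simps)
next
  fix f g assume "f \<in> carrier (cluster_Aut Q)" "g \<in> carrier (cluster_Aut Q)"
  then have fg: "f \<in> cluster_automorphisms Q" "g \<in> cluster_automorphisms Q" by (simp_all add: cluster_Aut_simps)
  have gA: "g A \<in> Alg" if "A \<in> Alg" for A
    using Bij_imp_funcset[of g Alg] fg(2) Aut_Bij that by blast
  have "project (compose Alg f g) = compose ex.Alg (project f) (project g)"
    by (rule project_eq)
       (simp_all add: compose_def specialize_Alg project_Aut(2)[OF fg(1)] project_Aut(2)[OF fg(2)] gA)
  then show "project (f \<otimes>\<^bsub>cluster_Aut Q\<^esub> g) = project f \<otimes>\<^bsub>cluster_Aut (principal_part Q)\<^esub> project g"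
    using fg project_Aut(1) by (simp add: cluster_Aut_simps ex.cluster_Aut_simps)
qed

theorem Aut_embeds:
  assumes frozen: "\<And>p \<pi> k. seed_iso p \<pi> \<Longrightarrow>
      (\<And>q k. set q \<subseteq> E \<Longrightarrow> k \<in> E \<Longrightarrow> field_auto p \<pi> (x q k) = x q k) \<Longrightarrow>
      k \<in> F \<Longrightarrow> field_auto p \<pi> (indet k) = indet k"
  shows "\<exists>H. subgroup H (cluster_Aut (principal_part Q)) \<and>
    cluster_Aut Q \<cong> (cluster_Aut (principal_part Q))\<lparr>carrier := H\<rparr>"
proof -
  let ?G = "cluster_Aut Q" and ?K = "cluster_Aut (principal_part Q)"
  interpret group_hom ?G ?K project
    by (intro group_hom.intro group_hom_axioms.intro group_cluster_Aut ex.group_cluster_Aut project_hom)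
  have "kernel ?G ?K project = {\<one>\<^bsub>?G\<^esub>}"
  proof (intro equalityI subsetI)
    fix f assume "f \<in> kernel ?G ?K project"
    then have fA: "f \<in> cluster_automorphisms Q" and f1: "project f = (\<lambda>B\<in>ex.Alg. B)"
      by (simp_all add: kernel_def cluster_Aut_simps ex.cluster_Aut_simps)
    obtain p \<pi> where iso: "seed_iso p \<pi>" and f: "f = restrict (field_auto p \<pi>) Alg"
      using cluster_automorphism_is_auto[OF fA] by blast
    have triv: "specialize (field_auto p \<pi> A) = specialize A" if "A \<in> Alg" for A
    proof -
      have "specialize (f A) = project f (specialize A)" by (rule project_Aut(2)[OF fA that, symmetric])
      also have "\<dots> = specialize A" unfolding f1 using specialize_Alg[OF that] by simp
      finally show ?thesis using that by (simp add: f)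
    qed
    have fix_x: "field_auto p \<pi> (x q k) = x q k" if "set q \<subseteq> E" "k \<in> E" for q k
      by (rule auto_fixes_x[OF iso _ that]) (rule triv)
    have fix_frozen: "field_auto p \<pi> (indet k) = indet k" if "k \<in> F" for k
      by (rule frozen[OF iso _ that]) (rule fix_x)
    have "field_auto p \<pi> A = A" if "A \<in> Alg" for A
      using that
    proof (induction rule: Alg_induct)
      case (gen q k)
      from gen(2,1) show ?case
        by (cases rule: gen_cases) (use fix_x[OF gen(1)] fix_frozen in simp_all)
    qed (simp_all add: auto_hom[OF iso])
    then have "f = (\<lambda>A\<in>Alg. A)" unfolding f by (intro restrict_ext)
    then show "f \<in> {\<one>\<^bsub>?G\<^esub>}" by (simp add: cluster_Aut_simps)
  qed (auto simp: kernel_def)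
  then have "inj_on project (carrier ?G)" using inj_iff_trivial_ker by blast
  then have "project \<in> iso ?G (?K\<lparr>carrier := project ` carrier ?G\<rparr>)"
    using project_hom by (auto simp: iso_def hom_def bij_betw_def)
  with img_is_subgroup show ?thesis by (blast intro: is_isoI)
qed

end

section \<open>Principal coefficients\<close>

lemma ice_quiver_seed: "ice_quiver Q \<Longrightarrow> quiver_seed Q (exch_matrix Q)"
  by unfold_locales (simp_all add: ice_quiver_def has_matrix_def skew_def exch_matrix_def)

text \<open>By the identity block, for \<open>k = n + i\<close> the first exchange relation at
  \<open>i\<close> is linear in \<open>indet k\<close> and contains no other frozen variable.
  Everything else in it is fixed, so it can be solved for the image of
  \<open>indet k\<close>.\<close>

lemma principal_coefficients_fix_frozen:
  assumes pc: "has_principal_coefficients Q"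
    and iso: "matrix_seed.seed_iso (verts Q) (exch_verts Q) (exch_matrix Q) p \<pi>"
    and fix_x: "\<And>q k. set q \<subseteq> exch_verts Q \<Longrightarrow> k \<in> exch_verts Q \<Longrightarrow>
      matrix_seed.field_auto (verts Q) (exch_matrix Q) p \<pi> (cluster_var (verts Q) (exch_matrix Q) q k) =
      cluster_var (verts Q) (exch_matrix Q) q k"
    and k: "k \<in> frozen_verts Q"
  shows "matrix_seed.field_auto (verts Q) (exch_matrix Q) p \<pi> (indet k) = indet k"
proof -
  let ?b = "exch_matrix Q" and ?n = "nexch Q"
  interpret quiver_pair Q ?b
    using pc by (intro quiver_pairI ice_quiver_seed) (simp add: has_principal_coefficients_def)
  let ?A = "field_auto p \<pi>"
  have m: "nfroz Q = ?n" using pc by (simp add: has_principal_coefficients_def)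
  define i where "i = k - ?n"
  have i: "i \<in> E" "k = ?n + i" using k m by (auto simp: i_def frozen_verts_def exch_verts_def)
  have iV: "i \<in> V" using exch_in_V[OF i(1)] .
  have bF: "?b j i = (if j = k then 1 else 0)" if "j \<in> F" for j
  proof -
    obtain B where "\<And>j i. j \<in> V \<Longrightarrow> i \<in> E \<Longrightarrow> ?b j i = principal_matrix ?n B j i"
      using pc unfolding has_principal_coefficients_def by blast
    then show ?thesis
      using that i(1) frozen_in_V[OF that] by (simp add: principal_matrix_def frozen_verts_def i(2))
  qed
  have split: "(\<Prod>j\<in>V. y j) = (\<Prod>j\<in>E. y j) * (\<Prod>j\<in>F. y j)" for y :: "nat \<Rightarrow> ratfun"
    unfolding verts_Un[of Q]
    by (rule prod.union_disjoint) (auto simp: exch_frozen_disjoint exch_verts_def frozen_verts_def)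
  define M where "M e = (\<Prod>j\<in>E. indet j ^ e j)" for e :: "nat \<Rightarrow> nat"
  have AM: "?A (M e) = M e" for e
  proof -
    have pow: "?A (A ^ n) = ?A A ^ n" for A n by (induction n) (simp_all add: auto_hom[OF iso])
    have "?A (\<Prod>j\<in>T. indet j ^ e j) = (\<Prod>j\<in>T. indet j ^ e j)" if "T \<subseteq> E" for T
      using that
    proof (induction T rule: infinite_finite_induct)
      case (insert j T)
      then have "?A (indet j) = indet j" using fix_x[of "[]" j] by simp
      with insert show ?case by (simp add: auto_hom[OF iso] pow)
    qed (simp_all add: auto_hom[OF iso])
    then show ?thesis by (simp add: M_def)
  qed
  have pos: "(\<Prod>j\<in>V. indet j ^ nat (?b j i)) = M (\<lambda>j. nat (?b j i)) * indet k"
  proof -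
    have "(\<Prod>j\<in>F. indet j ^ nat (?b j i)) = (\<Prod>j\<in>F. if j = k then indet j else 1)"
      by (rule prod.cong) (simp_all add: bF)
    also have "\<dots> = indet k" using k by (simp add: frozen_verts_def)
    finally show ?thesis by (simp add: split M_def)
  qed
  have neg: "(\<Prod>j\<in>V. indet j ^ nat (- ?b j i)) = M (\<lambda>j. nat (- ?b j i))"
  proof -
    have "(\<Prod>j\<in>F. indet j ^ nat (- ?b j i)) = 1" by (rule prod.neutral) (simp add: bF)
    then show ?thesis by (simp add: split M_def)
  qed
  let ?P = "M (\<lambda>j. nat (?b j i))" and ?N = "M (\<lambda>j. nat (- ?b j i))"
  have exch: "x [i] i * indet i = ?P * indet k + ?N"
    using x_snoc_mult[of "[]" i] by (simp add: pos neg)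
  have "?A (x [i] i * indet i) = x [i] i * indet i"
    using fix_x[of "[i]" i] fix_x[of "[]" i] i(1) by (simp add: auto_hom[OF iso])
  then have "?P * ?A (indet k) + ?N = ?P * indet k + ?N"
    unfolding exch by (simp add: auto_hom[OF iso] AM)
  moreover have "?P \<noteq> 0" by (simp add: M_def prod_zero_iff exch_verts_def)
  ultimately show ?thesis by simp
qed

section \<open>Universal coefficients\<close>

context quiver_seed
begin

lemma coeff_group_carrier: "carrier (coeff_group Q) = {\<Prod>j\<in>frozen_verts Q. indet j powi a j | a. True}"
  by (simp add: coeff_group_def)

lemma coeff_group_mult:
  "p \<in> carrier (coeff_group Q) \<Longrightarrow> q \<in> carrier (coeff_group Q) \<Longrightarrow> p * q \<in> carrier (coeff_group Q)"
proof -
  assume "p \<in> carrier (coeff_group Q)" "q \<in> carrier (coeff_group Q)"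
  then obtain a c where "p = (\<Prod>j\<in>frozen_verts Q. indet j powi a j)" "q = (\<Prod>j\<in>frozen_verts Q. indet j powi c j)"
    by (auto simp: coeff_group_carrier)
  then have "p * q = (\<Prod>j\<in>frozen_verts Q. indet j powi (a j + c j))"
    by (simp add: power_int_add prod.distrib)
  then show ?thesis unfolding coeff_group_carrier by (intro CollectI exI[of _ "\<lambda>j. a j + c j"]) simp
qed

lemma indet_powi: "indet j powi n = indet j ^ nat n / indet j ^ nat (- n)"
  by (cases "n \<ge> 0") (simp_all add: power_int_def divide_inverse power_inverse)

text \<open>Elements of the coefficient group may have negative exponents, whereas common
  denominators in the localization have to lie in the algebra itself.\<close>

lemma coeff_group_fraction:
  assumes "p \<in> carrier (coeff_group Q)"
  obtains u v where "p = u / v" "u \<in> Alg" "v \<in> Alg" "u \<in> carrier (coeff_group Q)" "v \<noteq> 0"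
    "v \<in> carrier (coeff_group Q)"
proof -
  obtain a where a: "p = (\<Prod>j\<in>frozen_verts Q. indet j powi a j)" using assms by (auto simp: coeff_group_carrier)
  have Alg: "(\<Prod>j\<in>frozen_verts Q. indet j ^ e j) \<in> Alg" for e :: "nat \<Rightarrow> nat"
    using Alg_x[of "[]"] verts_Un[of Q] by (intro Alg_prod Alg_power) auto
  have grp: "(\<Prod>j\<in>frozen_verts Q. indet j ^ e j) \<in> carrier (coeff_group Q)" for e :: "nat \<Rightarrow> nat"
    unfolding coeff_group_carrier by (intro CollectI exI[of _ "\<lambda>j. int (e j)"]) simp
  have p: "p = (\<Prod>j\<in>frozen_verts Q. indet j ^ nat (a j)) / (\<Prod>j\<in>frozen_verts Q. indet j ^ nat (- a j))"
    unfolding a indet_powi prod_dividef ..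
  have nz: "(\<Prod>j\<in>frozen_verts Q. indet j ^ nat (- a j)) \<noteq> 0"
    by (simp add: prod_zero_iff frozen_verts_def)
  show ?thesis by (rule that[OF p Alg Alg grp nz grp])
qed

abbreviation "Loc \<equiv> carrier (localized_algebra Q)"

lemma Loc_eq: "Loc = {a / p | a p. a \<in> Alg \<and> p \<in> carrier (coeff_group Q)}"
  by (simp add: localized_algebra_def)

lemma LocE:
  assumes "A \<in> Loc" obtains u v where "A = u / v" "u \<in> Alg" "v \<in> Alg" "v \<in> carrier (coeff_group Q)" "v \<noteq> 0"
proof -
  obtain a p where "A = a / p" "a \<in> Alg" "p \<in> carrier (coeff_group Q)" using assms by (auto simp: Loc_eq)
  moreover obtain u v where "p = u / v" "u \<in> Alg" "v \<in> Alg" "u \<in> carrier (coeff_group Q)" "v \<noteq> 0"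
    using coeff_group_fraction[OF calculation(3)] by blast
  moreover have "u \<noteq> 0"
  proof -
    have "p \<noteq> 0" using calculation(3) by (auto simp: coeff_group_carrier prod_zero_iff frozen_verts_def)
    with calculation(4) show ?thesis by auto
  qed
  ultimately show ?thesis using that[of "a * v" u] by (simp add: Alg_closed(5))
qed

lemma LocI: "a \<in> Alg \<Longrightarrow> p \<in> carrier (coeff_group Q) \<Longrightarrow> a / p \<in> Loc"
  by (auto simp: Loc_eq)

lemma coeff_1: "1 \<in> carrier (coeff_group Q)"
  unfolding coeff_group_carrier by (intro CollectI exI[of _ "\<lambda>j. 0"]) simp

lemma Alg_Loc: "A \<in> Alg \<Longrightarrow> A \<in> Loc"
  using LocI[OF _ coeff_1] by simp

lemma coeff_Loc: "p \<in> carrier (coeff_group Q) \<Longrightarrow> p \<in> Loc"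
proof -
  assume "p \<in> carrier (coeff_group Q)"
  then obtain u v where "p = u / v" "u \<in> Alg" "v \<in> carrier (coeff_group Q)"
    using coeff_group_fraction by metis
  then show ?thesis by (simp add: LocI)
qed

lemma Loc_closed: "A \<in> Loc \<Longrightarrow> B \<in> Loc \<Longrightarrow> A + B \<in> Loc" "A \<in> Loc \<Longrightarrow> B \<in> Loc \<Longrightarrow> A * B \<in> Loc"
proof -
  assume A: "A \<in> Loc" and B: "B \<in> Loc"
  obtain u v where 1: "A = u / v" "u \<in> Alg" "v \<in> Alg" "v \<in> carrier (coeff_group Q)" "v \<noteq> 0" by (rule LocE[OF A])
  obtain u' v' where 2: "B = u' / v'" "u' \<in> Alg" "v' \<in> Alg" "v' \<in> carrier (coeff_group Q)" "v' \<noteq> 0" by (rule LocE[OF B])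
  have v: "v * v' \<in> carrier (coeff_group Q)" by (rule coeff_group_mult[OF 1(4) 2(4)])
  have "A + B = (u * v' + u' * v) / (v * v')" using 1(1,5) 2(1,5) by (simp add: field_simps)
  then show "A + B \<in> Loc"
    using LocI[OF Alg_closed(4)[OF Alg_closed(5)[OF 1(2) 2(3)] Alg_closed(5)[OF 2(2) 1(3)]] v] by simp
  have "A * B = (u * u') / (v * v')" using 1(1) 2(1) by simp
  then show "A * B \<in> Loc" using LocI[OF Alg_closed(5)[OF 1(2) 2(2)] v] by simp
qed

lemma auto_coeff:
  assumes iso: "seed_iso p \<pi>" and c: "c \<in> carrier (coeff_group Q)"
  shows "field_auto p \<pi> c \<in> carrier (coeff_group Q)"
proof -
  note d = seed_isoD[OF iso]
  let ?A = "field_auto p \<pi>" and ?F = "frozen_verts Q"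
  have F: "\<pi> k \<in> ?F" if "k \<in> ?F" for k
  proof -
    have "\<pi> k \<in> V" using that d(5) verts_Un[of Q] by blast
    moreover have "\<pi> k \<notin> E" using inj_image_mem_iff[OF d(3), of k E] d(4) that exch_frozen_disjoint[of Q] by auto
    ultimately show ?thesis using verts_Un[of Q] by blast
  qed
  have injF: "inj_on \<pi> ?F" using d(3) by (rule inj_on_subset) simp
  have imF: "\<pi> ` ?F = ?F" by (rule endo_inj_surj[OF _ _ injF]) (use F in \<open>auto simp: frozen_verts_def\<close>)
  obtain a where a: "c = (\<Prod>j\<in>?F. indet j powi a j)" using c by (auto simp: coeff_group_carrier)
  have ind: "?A (indet j) = indet (\<pi> j)" if "j \<in> ?F" for j
    unfolding field_auto_indet using F[OF that] d(1) exch_frozen_disjoint[of Q] by (intro cluster_var_outside) blast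
  have pow: "?A (A ^ n) = ?A A ^ n" for A n by (induction n) (simp_all add: auto_hom[OF iso])
  have prod: "?A (\<Prod>j\<in>T. A j) = (\<Prod>j\<in>T. ?A (A j))" for T :: "nat set" and A
    by (induction T rule: infinite_finite_induct) (simp_all add: auto_hom[OF iso])
  have "?A c = (\<Prod>j\<in>?F. indet (\<pi> j) powi a j)"
    unfolding a prod by (rule prod.cong) (simp_all add: indet_powi auto_hom[OF iso] pow ind)
  also have "\<dots> = (\<Prod>j\<in>?F. indet (\<pi> j) powi a (inv_into UNIV \<pi> (\<pi> j)))"
    using d(3) by simp
  also have "\<dots> = (\<Prod>j\<in>?F. indet j powi a (inv_into UNIV \<pi> j))"
    using prod.reindex[OF injF, of "\<lambda>j. indet j powi a (inv_into UNIV \<pi> j)"] unfolding imF by simp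
  finally show ?thesis
    unfolding coeff_group_carrier by (intro CollectI exI[of _ "\<lambda>j. a (inv_into UNIV \<pi> j)"]) simp
qed

lemma auto_Loc:
  assumes iso: "seed_iso p \<pi>" and A: "A \<in> Loc" shows "field_auto p \<pi> A \<in> Loc"
proof -
  obtain a c where "A = a / c" "a \<in> Alg" "c \<in> carrier (coeff_group Q)" using A by (auto simp: Loc_eq)
  then show ?thesis using LocI[OF auto_maps_Alg[OF iso] auto_coeff[OF iso]] by (simp add: auto_hom[OF iso])
qed

lemma localized_algebra_simps:
  "\<one>\<^bsub>localized_algebra Q\<^esub> = 1" "a \<oplus>\<^bsub>localized_algebra Q\<^esub> c = a + c" "a \<otimes>\<^bsub>localized_algebra Q\<^esub> c = a * c"
  by (simp_all add: localized_algebra_def)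

lemma auto_coefficient_specialization:
  assumes iso: "seed_iso p \<pi>"
    and fix_x: "\<And>q k. set q \<subseteq> E \<Longrightarrow> k \<in> E \<Longrightarrow> field_auto p \<pi> (x q k) = x q k"
  shows "coefficient_specialization Q Q (restrict (field_auto p \<pi>) Loc)"
  unfolding coefficient_specialization_def
proof (intro conjI allI impI ballI)
  let ?f = "restrict (field_auto p \<pi>) Loc"
  show "?f \<in> extensional Loc" by simp
  show "?f \<in> ring_hom (localized_algebra Q) (localized_algebra Q)"
    by (rule ring_hom_memI)
       (simp_all add: localized_algebra_simps auto_Loc[OF iso] Loc_closed auto_hom[OF iso] Alg_Loc Alg_closed(1))
  show "?f \<in> hom (coeff_group Q) (coeff_group Q)"
  proof (rule homI)
    fix c d assume cd: "c \<in> carrier (coeff_group Q)" "d \<in> carrier (coeff_group Q)"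
    have mult: "u \<otimes>\<^bsub>coeff_group Q\<^esub> v = u * v" for u v by (simp add: coeff_group_def)
    show "?f (c \<otimes>\<^bsub>coeff_group Q\<^esub> d) = ?f c \<otimes>\<^bsub>coeff_group Q\<^esub> ?f d"
      unfolding mult using cd by (simp add: coeff_Loc coeff_group_mult auto_hom[OF iso])
  qed (simp add: coeff_Loc auto_coeff[OF iso])
  fix q k assume q: "set q \<subseteq> E" and k: "k \<in> E"
  have "x q k \<in> Loc" using Alg_Loc[OF Alg_x[OF q]] k exch_verts_subset by blast
  then show "?f (snd (S q) k) = snd (S q) k"
    unfolding S_simps(1)[OF q] by (simp add: fix_x[OF q k])
qed

lemma universal_fix_frozen:
  assumes univ: "universal_geometric Q' Q"
    and iso: "seed_iso p \<pi>"
    and fix_x: "\<And>q k. set q \<subseteq> E \<Longrightarrow> k \<in> E \<Longrightarrow> field_auto p \<pi> (x q k) = x q k"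
    and k: "k \<in> frozen_verts Q"
  shows "field_auto p \<pi> (indet k) = indet k"
proof -
  have "coefficient_specialization Q Q (restrict (field_auto p \<pi>) Loc)"
    by (rule auto_coefficient_specialization[OF iso fix_x])
  moreover have "coefficient_specialization Q Q (restrict (field_auto [] (\<lambda>k. k)) Loc)"
    by (rule auto_coefficient_specialization[OF seed_iso_Nil]) (simp add: field_auto_Nil)
  ultimately have "restrict (field_auto p \<pi>) Loc = restrict (field_auto [] (\<lambda>k. k)) Loc"
    using univ unfolding universal_geometric_def by blast
  moreover have "indet k \<in> Loc" using Alg_Loc[OF Alg_x[of "[]" k]] k verts_Un[of Q] by auto
  ultimately show ?thesis by (metis field_auto_Nil restrict_apply')
qed

end

theorem corollary3p17:
  shows "(\<forall>Q. has_principal_coefficients Q \<and> nexch Q \<noteq> 1 \<longrightarrow>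
            (\<exists>H. subgroup H (cluster_Aut (principal_part Q)) \<and>
                 cluster_Aut Q \<cong> (cluster_Aut (principal_part Q))\<lparr>carrier := H\<rparr>)) \<and>
         (\<forall>Q Quniv. ice_quiver Q \<and> nfroz Q = 0 \<and> universal_geometric Q Quniv \<and>
            nexch Q \<noteq> 1 \<longrightarrow>
            (\<exists>H. subgroup H (cluster_Aut (principal_part Quniv)) \<and>
                 cluster_Aut Quniv \<cong> (cluster_Aut (principal_part Quniv))\<lparr>carrier := H\<rparr>))"
proof (intro conjI allI impI; elim conjE)
  fix Q assume pc: "has_principal_coefficients Q"
  then interpret quiver_pair Q "exch_matrix Q"
    by (intro quiver_pairI ice_quiver_seed) (simp add: has_principal_coefficients_def)
  show "\<exists>H. subgroup H (cluster_Aut (principal_part Q)) \<and>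
      cluster_Aut Q \<cong> (cluster_Aut (principal_part Q))\<lparr>carrier := H\<rparr>"
    by (rule Aut_embeds) (rule principal_coefficients_fix_frozen[OF pc])
next
  fix Q Quniv assume univ: "universal_geometric Q Quniv"
  then have "ice_quiver Quniv" by (simp add: universal_geometric_def RCA_def)
  then interpret quiver_pair Quniv "exch_matrix Quniv" by (intro quiver_pairI ice_quiver_seed)
  show "\<exists>H. subgroup H (cluster_Aut (principal_part Quniv)) \<and>
      cluster_Aut Quniv \<cong> (cluster_Aut (principal_part Quniv))\<lparr>carrier := H\<rparr>"
    by (rule Aut_embeds) (rule universal_fix_frozen[OF univ])
qed

end
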